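(* Let $s\in(1/4,1/2)$. Then there exist two sequences of initial data $f_n,\tilde f_n\in C^\infty(\mathbb{T})$, $n\in\mathbb{N}$, such that $(f_n)$ and $(\tilde f_n)$ are bounded in $H^s$, $$\lim_{n\to\infty}\|f_n-\tilde f_n\|_{H^s}=0,$$ but the corresponding solutions $u_n(t,x)$ and $\tilde u_n(t,x)$ of the defocusing cubic half-wave equation $$(i\partial_t-|D_x|)u=|u|^2u,\qquad (t,x)\in\mathbb{R}\times\mathbb{R}/(2\pi\mathbb{Z}),$$ with $u_n(0,\cdot)=f_n$ and $\tilde u_n(0,\cdot)=\tilde f_n$ respectively, satisfy $$\forall\,T>0,\qquad \liminf_{n\to\infty}\|u_n-\tilde u_n\|_{L^\infty([0,T];H^s)}>0.$$
   Context: $\mathbb{T}=\mathbb{R}/(2\pi\mathbb{Z})$, functions are complex valued, and $H^s=H^s(\mathbb{T})$ is the usual $2\pi$-periodic Sobolev space with norm $\|f\|_{H^s}^2\sim\sum_{k\in\mathbb{Z}}(1+k^2)^s|\widehat f(k)|^2$, where $f(x)=\sum_{k}\widehat f(k)e^{ikx}$. The operator $|D_x|$ is the Fourier multiplier $|D_x|e^{ikx}=|k|e^{ikx}$. For $C^\infty(\mathbb{T})$ initial data the equation has a unique global solution, which is in $C(\mathbb{R};H^\sigma)$ for every $\sigma>1/2$; this is the solution meant by "corresponding solution". *)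

theory Defs
  imports "HOL-Probability.Probability"
begin

text \<open>Functions on \<open>\<real> / 2\<pi>\<int>\<close> are represented by \<open>2\<pi>\<close>-periodic functions on the real line.\<close>

definition periodic_2pi :: "(real \<Rightarrow> complex) \<Rightarrow> bool" where
  "periodic_2pi f \<longleftrightarrow> (\<forall>x. f (x + 2 * pi) = f x)"

definition smooth_torus :: "(real \<Rightarrow> complex) set" where
  "smooth_torus = {f. periodic_2pi f \<and>
     (\<forall>m x. ((\<lambda>g y. vector_derivative g (at y)) ^^ m) f differentiable (at x))}"

definition fourier_coeff :: "(real \<Rightarrow> complex) \<Rightarrow> int \<Rightarrow> complex" where
  "fourier_coeff f k =
     (LINT x:{0..2 * pi}|lebesgue. f x * cis (- (of_int k * x))) / of_real (2 * pi)"

text \<open>The space \<open>H\<^sup>s\<close>, only meant for \<open>s \<ge> 0\<close>, so that its elements are \<open>L\<^sup>2\<close> functions.\<close>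

definition sobolev :: "real \<Rightarrow> (real \<Rightarrow> complex) set" where
  "sobolev s = {f. periodic_2pi f \<and> f \<in> borel_measurable lebesgue \<and>
     set_integrable lebesgue {0..2 * pi} (\<lambda>x. (cmod (f x))\<^sup>2) \<and>
     (\<lambda>k::int. (1 + (of_int k)\<^sup>2) powr s * (cmod (fourier_coeff f k))\<^sup>2) summable_on UNIV}"

text \<open>Meaningful on \<open>sobolev s\<close> only: the infinite sum is \<open>0\<close> by convention when it diverges.\<close>

definition sobolev_norm :: "real \<Rightarrow> (real \<Rightarrow> complex) \<Rightarrow> real" where
  "sobolev_norm s f =
     sqrt (\<Sum>\<^sub>\<infinity>k::int. (1 + (of_int k)\<^sup>2) powr s * (cmod (fourier_coeff f k))\<^sup>2)"

definition abs_D :: "(real \<Rightarrow> complex) \<Rightarrow> real \<Rightarrow> complex" where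
  "abs_D f x = (\<Sum>\<^sub>\<infinity>k::int. of_int \<bar>k\<bar> * fourier_coeff f k * cis (of_int k * x))"

definition continuous_in_sobolev :: "real \<Rightarrow> (real \<Rightarrow> real \<Rightarrow> complex) \<Rightarrow> bool" where
  "continuous_in_sobolev \<sigma> u \<longleftrightarrow>
     (\<forall>t. u t \<in> sobolev \<sigma>) \<and>
     (\<forall>t. ((\<lambda>\<tau>. sobolev_norm \<sigma> (\<lambda>x. u \<tau> x - u t x)) \<longlongrightarrow> 0) (at t))"

text \<open>
  The global solution \<open>u\<close>, with first argument time, for the initial datum \<open>f\<close>.
  Since \<open>u\<close> lies in \<open>C(\<real>; H\<^sup>\<sigma>)\<close> for all \<open>\<sigma> > 1/2\<close>, the series for \<open>|D\<^sub>x| u\<close> converges absolutely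
  and the equation holds in the classical, pointwise sense. The continuity of \<open>u t\<close> selects the
  continuous representative of the \<open>H\<^sup>\<sigma>\<close> class.
\<close>

definition half_wave_solution ::
  "(real \<Rightarrow> complex) \<Rightarrow> (real \<Rightarrow> real \<Rightarrow> complex) \<Rightarrow> bool" where
  "half_wave_solution f u \<longleftrightarrow>
     u 0 = f \<and>
     (\<forall>t. continuous_on UNIV (u t)) \<and>
     (\<forall>\<sigma> > 1/2. continuous_in_sobolev \<sigma> u) \<and>
     (\<forall>t x. (\<lambda>\<tau>. u \<tau> x) differentiable (at t) \<and>
        \<i> * vector_derivative (\<lambda>\<tau>. u \<tau> x) (at t) - abs_D (u t) x
          = of_real ((cmod (u t x))\<^sup>2) * u t x)"

definition Linf_sobolev_norm :: "real \<Rightarrow> real \<Rightarrow> (real \<Rightarrow> real \<Rightarrow> complex) \<Rightarrow> ereal" where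
  "Linf_sobolev_norm T s v =
     esssup (restrict_space lebesgue {0..T}) (\<lambda>t. ereal (sobolev_norm s (v t)))"

end

theory Submission
  imports Defs "HOL-Real_Asymp.Real_Asymp"
begin

text \<open>
  On functions with nonnegative frequencies \<open>\<bar>D\<bar> = D\<close>, so there the equation is a transport equation
  with the explicit solutions \<open>v (x - t)\<close>, \<open>v = f exp (- \<i> t \<bar>f\<bar>\<^sup>2)\<close>. Take for \<open>f\<close> a modulated Dirichlet
  kernel with frequencies in \<open>[N, N + K)\<close>, where \<open>K = N\<^sup>2\<^sup>s ln N \<ll> N\<close>, normalised in \<open>H\<^sup>s\<close>; its
  amplitude \<open>a\<close> is about \<open>\<surd>(ln N)\<close>. Replacing \<open>a\<close> by \<open>a + 1\<close> is a perturbation of size \<open>O(1 / a)\<close> in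
  \<open>H\<^sup>s\<close>, but the phases \<open>t \<bar>f\<bar>\<^sup>2\<close> differ by about \<open>t a\<close>, hence the two solutions separate at times
  \<open>t \<sim> 1 / a \<longrightarrow> 0\<close>. The negative frequencies of \<open>v\<close> are of size \<open>exp (- N / K)\<close>, seen with the
  submultiplicative weight \<open>exp (- k / K)\<close>, which beats the Gronwall losses over these short times.

  All estimates are done for the Fourier coefficients in the Banach algebra \<open>\<ell>\<^sup>1(\<int>)\<close>. Global solutions
  are limits of Galerkin approximations: conservation of mass and energy bounds the \<open>H\<^sup>1\<^sup>/\<^sup>2\<close> norm, a
  logarithmic inequality turns this into a double exponential bound for the weighted \<open>\<ell>\<^sup>1\<close> norm, and
  the norms with higher weights then obey linear Gronwall inequalities.
\<close>

section \<open>The Wiener algebra\<close>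

text \<open>The space l^1 serves as working space because it is an algebra, unlike H^s for s < 1/2,
  and because the l^1 norm of a packet does not exceed its amplitude. The delicate point is a
  competition of exponentials. On a time span of order 1 / a the approximate solution is bounded in
  l^1 only by about a exp(a / 2), so Gronwall for the error may cost a factor exp(4 exp(2 a)). With
  a close to sqrt(ln N), exp(2 a) stays below every positive power of N, while the gain exp(- N / K)
  has N / K of size N^(1 - 2 s) / ln N; here s < 1/2 enters. The amplitude must nevertheless tend to
  infinity, so that the data approach each other and the separation time shrinks: this is the
  purpose of the logarithm in K. The weight exp(- k / K) fits the packet: f times its conjugate has
  frequencies in (- K, K) only, so that the weight costs each factor of the exponential series at
  most e, while f itself carries exp(- N / K). The separation is measured at frequencies above N /
  2, where the H^s norm dominates a multiple of N^s times the L^2 norm.\<close>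

typedef wiener = "{a :: int \<Rightarrow> complex. (\<lambda>k. cmod (a k)) summable_on UNIV}"
  morphisms coeff Wiener
  by (rule exI[of _ "\<lambda>_. 0"]) simp

setup_lifting type_definition_wiener

lemma coeff_abs_summable: "(\<lambda>k. cmod (coeff a k)) summable_on UNIV"
  using coeff[of a] by simp

lemma coeff_Wiener: "(\<lambda>k. cmod (a k)) summable_on UNIV \<Longrightarrow> coeff (Wiener a) = a"
  by (rule Wiener_inverse) simp

lemma wiener_eqI: "(\<And>k. coeff a k = coeff b k) \<Longrightarrow> a = b"
  by (metis coeff_inject ext)

instantiation wiener :: real_normed_vector
begin

lift_definition zero_wiener :: wiener is "\<lambda>_. 0" by simp
lift_definition plus_wiener :: "wiener \<Rightarrow> wiener \<Rightarrow> wiener" is "\<lambda>a b k. a k + b k"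
proof -
  fix a b :: "int \<Rightarrow> complex"
  assume "(\<lambda>k. cmod (a k)) summable_on UNIV" "(\<lambda>k. cmod (b k)) summable_on UNIV"
  then have "(\<lambda>k. cmod (a k) + cmod (b k)) summable_on UNIV"
    by (rule summable_on_add)
  then show "(\<lambda>k. cmod (a k + b k)) summable_on UNIV"
    by (rule summable_on_comparison_test) (simp_all add: norm_triangle_ineq)
qed
lift_definition uminus_wiener :: "wiener \<Rightarrow> wiener" is "\<lambda>a k. - a k" by simp
lift_definition minus_wiener :: "wiener \<Rightarrow> wiener \<Rightarrow> wiener" is "\<lambda>a b k. a k - b k"
proof -
  fix a b :: "int \<Rightarrow> complex"
  assume "(\<lambda>k. cmod (a k)) summable_on UNIV" "(\<lambda>k. cmod (b k)) summable_on UNIV"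
  then have "(\<lambda>k. cmod (a k) + cmod (b k)) summable_on UNIV"
    by (rule summable_on_add)
  then show "(\<lambda>k. cmod (a k - b k)) summable_on UNIV"
    by (rule summable_on_comparison_test) (simp_all add: norm_triangle_ineq4)
qed
lift_definition scaleR_wiener :: "real \<Rightarrow> wiener \<Rightarrow> wiener" is "\<lambda>r a k. of_real r * a k"
  by (auto simp: norm_mult intro: summable_on_cmult_right)
lift_definition norm_wiener :: "wiener \<Rightarrow> real" is "\<lambda>a. \<Sum>\<^sub>\<infinity>k. cmod (a k)" .
definition dist_wiener :: "wiener \<Rightarrow> wiener \<Rightarrow> real" where "dist_wiener a b = norm (a - b)"
definition sgn_wiener :: "wiener \<Rightarrow> wiener" where "sgn_wiener a = scaleR (inverse (norm a)) a"
definition uniformity_wiener :: "(wiener \<times> wiener) filter" where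
  "uniformity_wiener = (INF e\<in>{0<..}. principal {(x, y). dist x y < e})"
definition open_wiener :: "wiener set \<Rightarrow> bool" where
  "open_wiener U \<longleftrightarrow> (\<forall>x\<in>U. \<forall>\<^sub>F (x', y) in uniformity. x' = x \<longrightarrow> y \<in> U)"

instance
proof
  fix a b c :: wiener and r q :: real
  show "a + b + c = a + (b + c)" by transfer (simp add: algebra_simps)
  show "a + b = b + a" by transfer (simp add: algebra_simps)
  show "0 + a = a" by transfer simp
  show "- a + a = 0" by transfer simp
  show "a - b = a + - b" by transfer simp
  show "r *\<^sub>R (a + b) = r *\<^sub>R a + r *\<^sub>R b" by transfer (simp add: algebra_simps)
  show "(r + q) *\<^sub>R a = r *\<^sub>R a + q *\<^sub>R a" by transfer (simp add: algebra_simps)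
  show "r *\<^sub>R q *\<^sub>R a = (r * q) *\<^sub>R a" by transfer (simp add: algebra_simps)
  show "1 *\<^sub>R a = a" by transfer simp
  show "dist a b = norm (a - b)" by (rule dist_wiener_def)
  show "sgn a = scaleR (inverse (norm a)) a" by (rule sgn_wiener_def)
  show "uniformity = (INF e\<in>{0<..}. principal {(x::wiener, y). dist x y < e})"
    by (rule uniformity_wiener_def)
  show "open U \<longleftrightarrow> (\<forall>x\<in>U. \<forall>\<^sub>F (x', y) in uniformity. x' = x \<longrightarrow> y \<in> U)" for U :: "wiener set"
    by (rule open_wiener_def)
  show "norm a = 0 \<longleftrightarrow> a = 0"
  proof
    show "a = 0" if "norm a = 0"
      using that
    proof transfer
      fix a :: "int \<Rightarrow> complex"
      assume "(\<lambda>k. cmod (a k)) summable_on UNIV" "(\<Sum>\<^sub>\<infinity>k. cmod (a k)) = 0"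
      then have "cmod (a k) = 0" for k
        using nonneg_infsum_le_0D[of "\<lambda>k. cmod (a k)" UNIV k] by auto
      then show "a = (\<lambda>_. 0)" by auto
    qed
  qed (transfer, simp)
  show "norm (a + b) \<le> norm a + norm b"
  proof transfer
    fix a b :: "int \<Rightarrow> complex"
    assume ab: "(\<lambda>k. cmod (a k)) summable_on UNIV" "(\<lambda>k. cmod (b k)) summable_on UNIV"
    then have s: "(\<lambda>k. cmod (a k) + cmod (b k)) summable_on UNIV"
      by (rule summable_on_add)
    then have "(\<lambda>k. cmod (a k + b k)) summable_on UNIV"
      by (rule summable_on_comparison_test) (simp_all add: norm_triangle_ineq)
    then have "(\<Sum>\<^sub>\<infinity>k. cmod (a k + b k)) \<le> (\<Sum>\<^sub>\<infinity>k. cmod (a k) + cmod (b k))"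
      using s by (rule infsum_mono) (simp_all add: norm_triangle_ineq)
    also have "\<dots> = (\<Sum>\<^sub>\<infinity>k. cmod (a k)) + (\<Sum>\<^sub>\<infinity>k. cmod (b k))"
      using ab by (rule infsum_add)
    finally show "(\<Sum>\<^sub>\<infinity>k. cmod (a k + b k)) \<le> (\<Sum>\<^sub>\<infinity>k. cmod (a k)) + (\<Sum>\<^sub>\<infinity>k. cmod (b k))" .
  qed
  show "norm (r *\<^sub>R a) = \<bar>r\<bar> * norm a"
    by transfer (simp add: norm_mult infsum_cmult_right')
qed

end

lemma coeff_simps [simp]:
  "coeff 0 k = 0" "coeff (a + b) k = coeff a k + coeff b k" "coeff (- a) k = - coeff a k"
  "coeff (a - b) k = coeff a k - coeff b k" "coeff (r *\<^sub>R a) k = of_real r * coeff a k"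
  by (transfer, simp)+

text \<open>Bounding all finite partial sums encodes summability and the size of the sum together.
  No conventional value of a divergent series can pass for a small norm, and the bound survives
  coefficientwise limits.\<close>

definition wle :: "(int \<Rightarrow> real) \<Rightarrow> wiener \<Rightarrow> real \<Rightarrow> bool" where
  "wle w a B \<longleftrightarrow> (\<forall>F. finite F \<longrightarrow> (\<Sum>k\<in>F. w k * cmod (coeff a k)) \<le> B)"

lemma wleD: "wle w a B \<Longrightarrow> finite F \<Longrightarrow> (\<Sum>k\<in>F. w k * cmod (coeff a k)) \<le> B"
  by (simp add: wle_def)

lemma wleI: "(\<And>F. finite F \<Longrightarrow> (\<Sum>k\<in>F. w k * cmod (coeff a k)) \<le> B) \<Longrightarrow> wle w a B"
  by (simp add: wle_def)

lemma wle_nonneg: "wle w a B \<Longrightarrow> 0 \<le> B"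
  using wleD[of w a B "{}"] by simp

lemma wle_mono: "wle w a B \<Longrightarrow> B \<le> C \<Longrightarrow> wle w a C"
  by (force simp: wle_def)

lemma wle_norm: "wle (\<lambda>_. 1) a (norm a)"
  unfolding wle_def norm_wiener.rep_eq
  by (auto intro!: finite_sum_le_infsum coeff_abs_summable)

lemma wle_imp_norm: "wle (\<lambda>_. 1) a B \<Longrightarrow> norm a \<le> B"
  unfolding norm_wiener.rep_eq
  by (rule infsum_le_finite_sums) (auto simp: coeff_abs_summable wle_def)

lemma norm_leI:
  assumes "\<And>F. finite F \<Longrightarrow> (\<Sum>k\<in>F. cmod (coeff a k)) \<le> B"
  shows "norm a \<le> B"
  using assms by (intro wle_imp_norm wleI) simp

lemma sum_coeff_le_norm: "finite F \<Longrightarrow> (\<Sum>k\<in>F. cmod (coeff a k)) \<le> norm a"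
  using wle_norm[of a] by (force simp: wle_def)

lemma coeff_le_norm: "cmod (coeff a k) \<le> norm a"
  using sum_coeff_le_norm[of "{k}" a] by simp

lemma wle_summable:
  assumes "wle w a B" "\<And>k. 0 \<le> w k"
  shows "(\<lambda>k. w k * cmod (coeff a k)) summable_on UNIV"
  by (rule nonneg_bdd_above_summable_on)
    (use assms in \<open>auto simp: wle_def bdd_above_def\<close>)

lemma wle_infsum:
  assumes "wle w a B" "\<And>k. 0 \<le> w k"
  shows "(\<Sum>\<^sub>\<infinity>k. w k * cmod (coeff a k)) \<le> B"
  by (rule infsum_le_finite_sums[OF wle_summable[OF assms]]) (use assms in \<open>auto simp: wle_def\<close>)

lemma bounded_linear_coeff: "bounded_linear (\<lambda>a. coeff a k)"
  by (rule bounded_linear_intro[where K = 1]) (auto simp: coeff_le_norm scaleR_conv_of_real)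

lemmas tendsto_coeff = bounded_linear.tendsto[OF bounded_linear_coeff]

text \<open>Fatou for weighted sums: a finite partial sum is continuous in its coefficients, so
  convergence of the single coefficients is enough. This carries bounds uniform along an
  approximation over to the limit.\<close>

lemma wle_tendsto:
  assumes "\<And>k. (\<lambda>n. coeff (X n) k) \<longlonglongrightarrow> coeff a k" "\<forall>\<^sub>F n in sequentially. wle w (X n) B"
  shows "wle w a B"
proof (rule wleI)
  fix F :: "int set" assume F: "finite F"
  have "(\<lambda>n. \<Sum>k\<in>F. w k * cmod (coeff (X n) k)) \<longlonglongrightarrow> (\<Sum>k\<in>F. w k * cmod (coeff a k))"
    by (intro tendsto_intros assms)
  then show "(\<Sum>k\<in>F. w k * cmod (coeff a k)) \<le> B"
    by (rule tendsto_upperbound) (use assms(2) F in \<open>auto elim!: eventually_mono simp: wle_def\<close>)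
qed

instance wiener :: banach
proof
  fix X :: "nat \<Rightarrow> wiener"
  assume X: "Cauchy X"
  have "convergent (\<lambda>n. coeff (X n) k)" for k
    using bounded_linear.Cauchy[OF bounded_linear_coeff X] by (simp add: Cauchy_convergent_iff)
  then obtain l where l: "\<And>k. (\<lambda>n. coeff (X n) k) \<longlonglongrightarrow> l k"
    unfolding convergent_def by metis
  \<comment> \<open>With \<open>m\<close> fixed, \<open>n\<close> tends to infinity inside a finite
    partial sum. The same estimate then yields both the summability of the limit and the convergence
    in norm.\<close>
  have tail: "(\<Sum>k\<in>F. cmod (coeff (X m) k - l k)) \<le> e"
    if "finite F" and m: "\<And>n. n \<ge> m \<Longrightarrow> norm (X m - X n) < e" for F m e
  proof -
    have "(\<lambda>n. \<Sum>k\<in>F. cmod (coeff (X m) k - coeff (X n) k)) \<longlonglongrightarrow> (\<Sum>k\<in>F. cmod (coeff (X m) k - l k))"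
      by (intro tendsto_intros l)
    moreover have "\<forall>\<^sub>F n in sequentially. (\<Sum>k\<in>F. cmod (coeff (X m) k - coeff (X n) k)) \<le> e"
      using eventually_ge_at_top[of m]
    proof eventually_elim
      case (elim n)
      have "(\<Sum>k\<in>F. cmod (coeff (X m - X n) k)) \<le> norm (X m - X n)"
        using \<open>finite F\<close> by (rule sum_coeff_le_norm)
      then show ?case using m[OF elim] by simp
    qed
    ultimately show ?thesis
      by (rule tendsto_upperbound) simp
  qed
  have c: "\<exists>m. \<forall>n\<ge>m. norm (X m - X n) < e" if "e > 0" for e :: real
    using X that unfolding Cauchy_def dist_norm by (meson order_refl)
  obtain m1 where m1: "\<And>n. n \<ge> m1 \<Longrightarrow> norm (X m1 - X n) < 1"
    using c[of 1] by auto
  have "(\<lambda>k. cmod (coeff (X m1) k - l k)) summable_on UNIV"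
    by (rule nonneg_bdd_above_summable_on) (use tail[OF _ m1] in \<open>auto simp: bdd_above_def\<close>)
  then have "(\<lambda>k. cmod (coeff (X m1) k - l k) + cmod (coeff (X m1) k)) summable_on UNIV"
    by (intro summable_on_add coeff_abs_summable)
  then have "(\<lambda>k. cmod (l k)) summable_on UNIV"
  proof (rule summable_on_comparison_test)
    fix k
    show "cmod (l k) \<le> cmod (coeff (X m1) k - l k) + cmod (coeff (X m1) k)"
      using norm_triangle_ineq[of "l k - coeff (X m1) k" "coeff (X m1) k"]
      by (simp add: norm_minus_commute)
  qed simp
  then have cl: "coeff (Wiener l) = l"
    by (rule coeff_Wiener)
  have "X \<longlonglongrightarrow> Wiener l"
  proof (rule LIMSEQ_I)
    fix e :: real assume "e > 0"
    then obtain M where M: "\<And>m n. m \<ge> M \<Longrightarrow> n \<ge> M \<Longrightarrow> norm (X m - X n) < e / 2"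
      using X unfolding Cauchy_def dist_norm by (meson half_gt_zero)
    show "\<exists>no. \<forall>n\<ge>no. norm (X n - Wiener l) < e"
    proof (intro exI[of _ M] allI impI)
      fix n assume n: "n \<ge> M"
      have "wle (\<lambda>_. 1) (X n - Wiener l) (e / 2)"
        unfolding wle_def using tail[of _ n "e / 2"] M n by (auto simp: cl)
      from wle_imp_norm[OF this] show "norm (X n - Wiener l) < e"
        using \<open>e > 0\<close> by simp
    qed
  qed
  then show "convergent X"
    by (auto simp: convergent_def)
qed

section \<open>Evaluation and Fourier coefficients\<close>

lemma norm_summable: "(\<lambda>k. norm (f k)) summable_on A \<Longrightarrow> f summable_on A" for f :: "'i \<Rightarrow> 'a :: banach"
  by (rule Infinite_Sum.abs_summable_summable)

text \<open>The junk value \<open>0\<close> of \<open>infsum\<close> never occurs below: all series converge absolutely.\<close>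

definition ev :: "wiener \<Rightarrow> real \<Rightarrow> complex" where
  "ev a x = (\<Sum>\<^sub>\<infinity>k. coeff a k * cis (of_int k * x))"

lemma ev_has_sum: "((\<lambda>k. coeff a k * cis (of_int k * x)) has_sum ev a x) UNIV"
  unfolding ev_def
  by (rule has_sum_infsum, rule norm_summable) (simp add: norm_mult coeff_abs_summable)

lemma ev_eqI: "((\<lambda>k. coeff a k * cis (of_int k * x)) has_sum z) UNIV \<Longrightarrow> ev a x = z"
  using ev_has_sum has_sum_unique by blast

lemma norm_ev_le: "cmod (ev a x) \<le> norm a"
  unfolding ev_def norm_wiener.rep_eq
  using norm_infsum_bound[of "\<lambda>k. coeff a k * cis (of_int k * x)" UNIV]
  by (simp add: norm_mult coeff_abs_summable)

lemma ev_add: "ev (a + b) x = ev a x + ev b x"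
  by (rule ev_eqI) (simp add: distrib_right has_sum_add ev_has_sum)

lemma ev_scaleR: "ev (r *\<^sub>R a) x = r *\<^sub>R ev a x"
  by (rule ev_eqI) (simp add: scaleR_conv_of_real mult.assoc has_sum_cmult_right ev_has_sum)

lemma bounded_linear_ev: "bounded_linear (\<lambda>a. ev a x)"
  by (rule bounded_linear_intro[where K = 1]) (simp_all add: norm_ev_le ev_add ev_scaleR)

lemma ev_minus: "ev (- a) x = - ev a x" and ev_diff: "ev (a - b) x = ev a x - ev b x"
  using linear_neg[OF bounded_linear.linear[OF bounded_linear_ev, of x], of a]
    linear_diff[OF bounded_linear.linear[OF bounded_linear_ev, of x], of a b]
  by simp_all

lemma cis_has_vector_derivative:
  "((\<lambda>x. cis (c * x)) has_vector_derivative \<i> * of_real c * cis (c * x)) (at x within S)"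
proof -
  have "((\<lambda>z. exp (\<i> * of_real c * z)) has_field_derivative \<i> * of_real c * exp (\<i> * of_real c * of_real x)) (at (of_real x))"
    by (auto intro!: derivative_eq_intros)
  from has_vector_derivative_real_field[OF this, of S] show ?thesis
    by (simp add: cis_conv_exp mult.assoc)
qed

lemma cis_int_2pi: "cis (of_int k * (2 * pi)) = 1"
  using cis_multiple_2pi[of "of_int k"] by (simp add: mult.commute)

lemma periodic_ev: "periodic_2pi (ev a)"
proof -
  have "cis (of_int k * (x + 2 * pi)) = cis (of_int k * x)" for k x
    by (simp add: distrib_left cis_mult[symmetric] cis_int_2pi)
  then show ?thesis
    by (simp add: periodic_2pi_def ev_def)
qed

lemma continuous_on_ev: "continuous_on S (ev a)"
proof (rule uniform_limit_theorem)
  show "uniform_limit S (\<lambda>F x. \<Sum>k\<in>F. coeff a k * cis (of_int k * x)) (ev a) (finite_subsets_at_top UNIV)"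
    by (rule Weierstrass_m_test_general'[where M = "\<lambda>k. cmod (coeff a k)"])
      (auto simp: norm_mult coeff_abs_summable ev_has_sum)
qed (auto intro!: always_eventually continuous_intros continuous_on_cis)

definition monomial :: "int \<Rightarrow> complex \<Rightarrow> wiener" where
  "monomial j z = Wiener (\<lambda>k. if k = j then z else 0)"

lemma has_sum_single: "((\<lambda>k. if k = j then f k else 0) has_sum f j) UNIV"
  for f :: "int \<Rightarrow> 'a :: {comm_monoid_add, topological_space}"
  by (rule has_sum_finite_neutralI[of "{j}"]) auto

lemma coeff_monomial: "coeff (monomial j z) k = (if k = j then z else 0)"
proof -
  have "(\<lambda>k. cmod (if k = j then z else 0)) summable_on UNIV"
    using has_sum_imp_summable[OF has_sum_single[of j "\<lambda>_. cmod z"]]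
    by (simp add: if_distrib cong: if_cong)
  then show ?thesis
    unfolding monomial_def by (subst coeff_Wiener) auto
qed

lemma ev_monomial: "ev (monomial j z) x = z * cis (of_int j * x)"
proof (rule ev_eqI)
  have "((\<lambda>k. if k = j then z * cis (of_int k * x) else 0) has_sum z * cis (of_int j * x)) UNIV"
    by (rule has_sum_single[where f = "\<lambda>k. z * cis (of_int k * x)"])
  then show "((\<lambda>k. coeff (monomial j z) k * cis (of_int k * x)) has_sum z * cis (of_int j * x)) UNIV"
    by (rule has_sum_cong[THEN iffD1, rotated]) (simp add: coeff_monomial)
qed

lemma norm_monomial [simp]: "norm (monomial j z) = cmod z"
proof -
  have "(\<Sum>\<^sub>\<infinity>k. cmod (coeff (monomial j z) k)) = (\<Sum>\<^sub>\<infinity>k. if k = j then cmod z else 0)"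
    by (rule infsum_cong) (simp add: coeff_monomial)
  also have "\<dots> = cmod z"
    using has_sum_single[of j "\<lambda>_. cmod z"] by (rule infsumI)
  finally show ?thesis
    by (simp add: norm_wiener.rep_eq)
qed

lemma bounded_linear_monomial: "bounded_linear (monomial j)"
  by (rule bounded_linear_intro[where K = 1])
    (auto intro!: wiener_eqI simp: coeff_monomial scaleR_conv_of_real)

text \<open>Absolute convergence in the Banach space. Hence identities between bounded linear maps
  need only be tested on single exponentials.\<close>

lemma has_sum_monomial: "((\<lambda>k. monomial k (coeff a k)) has_sum a) UNIV"
proof -
  have "(\<lambda>k. monomial k (coeff a k)) summable_on UNIV"
    by (rule norm_summable) (simp add: coeff_abs_summable)
  then obtain b where b: "((\<lambda>k. monomial k (coeff a k)) has_sum b) UNIV"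
    by (auto simp: summable_on_def)
  have "coeff b j = coeff a j" for j
  proof -
    have "((\<lambda>k. coeff (monomial k (coeff a k)) j) has_sum coeff b j) UNIV"
      by (rule has_sum_bounded_linear[OF bounded_linear_coeff b])
    then have "((\<lambda>k. if k = j then coeff a k else 0) has_sum coeff b j) UNIV"
      by (rule has_sum_cong[THEN iffD1, rotated]) (simp add: coeff_monomial)
    then show ?thesis
      using has_sum_single[of j "coeff a"] has_sum_unique by blast
  qed
  then show ?thesis
    using b wiener_eqI[of b a] by simp
qed

lemma fourier_coeff_continuous:
  assumes "continuous_on {0..2 * pi} f"
  shows "fourier_coeff f k = integral {0..2 * pi} (\<lambda>x. f x * cis (- (of_int k * x))) / of_real (2 * pi)"
proof -
  have "set_integrable lebesgue {0..2 * pi} (\<lambda>x. f x * cis (- (of_int k * x)))"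
    by (intro absolutely_integrable_continuous_real continuous_intros continuous_on_cis assms)
  then show ?thesis
    unfolding fourier_coeff_def by (simp add: set_lebesgue_integral_eq_integral)
qed

lemma fourier_coeff_cis:
  "fourier_coeff (\<lambda>x. z * cis (of_int j * x)) k = (if k = j then z else 0)"
proof -
  have cont: "continuous_on {0..2 * pi} (\<lambda>x. z * cis (of_int j * x))"
    by (intro continuous_intros continuous_on_cis)
  have eq: "z * cis (of_int j * x) * cis (- (of_int k * x)) = z * cis (of_int (j - k) * x)" for x
    by (simp add: mult.assoc cis_mult left_diff_distrib)
  have "((\<lambda>x. z * cis (of_int (j - k) * x)) has_integral (if k = j then of_real (2 * pi) * z else 0)) {0..2 * pi}"
  proof (cases "k = j")
    case True
    then show ?thesis
      using has_integral_const_real[of z 0 "2 * pi"] by (simp add: scaleR_conv_of_real)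
  next
    case False
    define m :: real where "m = of_int (j - k)"
    have m: "m \<noteq> 0" using False by (simp add: m_def)
    have "((\<lambda>x. z / (\<i> * of_real m) * cis (m * x)) has_vector_derivative
        z / (\<i> * of_real m) * (\<i> * of_real m * cis (m * x))) (at x within {0..2 * pi})" for x
      by (rule has_vector_derivative_mult_right, rule cis_has_vector_derivative)
    then have "((\<lambda>x. z * cis (m * x)) has_integral
        z / (\<i> * of_real m) * cis (m * (2 * pi)) - z / (\<i> * of_real m) * cis (m * 0)) {0..2 * pi}"
      using m by (intro fundamental_theorem_of_calculus) (auto simp: field_simps)
    moreover have "cis (m * (2 * pi)) = 1"
      unfolding m_def by (rule cis_int_2pi)
    ultimately show ?thesis
      using False by (simp add: m_def)
  qed
  from integral_unique[OF this] show ?thesis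
    unfolding fourier_coeff_continuous[OF cont] eq by auto
qed

text \<open>Both sides are bounded linear in \<open>a\<close>, so the orthogonality of exponentials
  decides. This is the link between coefficient sequences and the integrals in the definitions of
  the problem.\<close>

lemma fourier_coeff_ev: "fourier_coeff (ev a) k = coeff a k"
proof -
  have i: "(\<lambda>x. ev a x * cis (- (of_int k * x))) integrable_on {0..2 * pi}" for a
    by (intro integrable_continuous_real continuous_intros continuous_on_cis continuous_on_ev)
  have bl: "bounded_linear (\<lambda>a. fourier_coeff (ev a) k)"
  proof (rule bounded_linear_intro[where K = 1])
    fix a b r
    show "fourier_coeff (ev (a + b)) k = fourier_coeff (ev a) k + fourier_coeff (ev b) k"
      by (simp add: fourier_coeff_continuous[OF continuous_on_ev] ev_add distrib_right
          integral_add[OF i i] add_divide_distrib)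
    show "fourier_coeff (ev (r *\<^sub>R a)) k = r *\<^sub>R fourier_coeff (ev a) k"
      by (simp add: fourier_coeff_continuous[OF continuous_on_ev] ev_scaleR integral_cmul)
        (simp add: scaleR_conv_of_real)
    have "norm (integral {0..2 * pi} (\<lambda>x. ev a x * cis (- (of_int k * x)))) \<le> norm a * (2 * pi - 0)"
      by (intro integral_bound continuous_intros continuous_on_cis continuous_on_ev)
        (auto simp: norm_mult norm_ev_le)
    then show "norm (fourier_coeff (ev a) k) \<le> norm a * 1"
      by (simp add: fourier_coeff_continuous[OF continuous_on_ev] norm_divide norm_mult field_simps)
  qed
  have "((\<lambda>j. fourier_coeff (ev (monomial j (coeff a j))) k) has_sum fourier_coeff (ev a) k) UNIV"
    by (rule has_sum_bounded_linear[OF bl has_sum_monomial])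
  moreover have "fourier_coeff (ev (monomial j (coeff a j))) k = (if j = k then coeff a j else 0)" for j
    unfolding ev_monomial[abs_def] fourier_coeff_cis by simp
  ultimately show ?thesis
    using has_sum_unique[OF _ has_sum_single[of k "coeff a"]] by simp
qed

text \<open>Reduces algebraic laws for convolution and conjugation to pointwise identities between
  complex numbers.\<close>

lemma ev_inject: "(\<And>x. ev a x = ev b x) \<Longrightarrow> a = b"
  by (rule wiener_eqI, subst (1 2) fourier_coeff_ev[symmetric], rule arg_cong[of "ev a"]) auto

text \<open>Fubini for the absolutely convergent double series, after the change of variables from
  \<open>(j, l)\<close> to \<open>(j + l, j)\<close>. The general field allows both complex
  coefficients and real weighted moduli.\<close>

lemma convolution_has_sum:
  fixes p q :: "int \<Rightarrow> 'a :: {real_normed_field, banach}"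
  assumes p: "(\<lambda>k. norm (p k)) summable_on UNIV" and q: "(\<lambda>k. norm (q k)) summable_on UNIV"
  shows "((\<lambda>k. \<Sum>\<^sub>\<infinity>j. p j * q (k - j)) has_sum (\<Sum>\<^sub>\<infinity>k. p k) * (\<Sum>\<^sub>\<infinity>k. q k)) UNIV"
    and "(\<lambda>j. p j * q (k - j)) summable_on UNIV"
proof -
  let ?f = "\<lambda>(j, l). p j * q l"
  have "(\<lambda>x. norm (?f x)) summable_on UNIV \<times> UNIV"
  proof (rule summable_on_SigmaI[where g = "\<lambda>j. norm (p j) * (\<Sum>\<^sub>\<infinity>l. norm (q l))"])
    show "((\<lambda>l. norm (?f (j, l))) has_sum norm (p j) * (\<Sum>\<^sub>\<infinity>l. norm (q l))) UNIV" for j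
      by (simp add: norm_mult has_sum_cmult_right[OF has_sum_infsum[OF q]])
  qed (auto intro: summable_on_cmult_left[OF p])
  then have s: "?f summable_on UNIV \<times> UNIV"
    by (rule norm_summable)
  have "(?f has_sum (\<Sum>\<^sub>\<infinity>k. p k) * (\<Sum>\<^sub>\<infinity>k. q k)) (UNIV \<times> UNIV)"
    by (rule has_sum_SigmaI[OF _ _ s, where g = "\<lambda>j. p j * (\<Sum>\<^sub>\<infinity>k. q k)"])
      (auto intro!: has_sum_cmult_right has_sum_cmult_left has_sum_infsum norm_summable p q)
  then have h: "((\<lambda>(k, j). p j * q (k - j)) has_sum (\<Sum>\<^sub>\<infinity>k. p k) * (\<Sum>\<^sub>\<infinity>k. q k)) (UNIV \<times> UNIV)"
    by (rule has_sum_reindex_bij_witness[THEN iffD1, rotated -1,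
          where j1 = "\<lambda>(j, l). (j + l, j)" and i1 = "\<lambda>(k, j). (j, k - j)"]) auto
  show s2: "(\<lambda>j. p j * q (k - j)) summable_on UNIV" for k
  proof (rule norm_summable, rule summable_on_comparison_test[OF summable_on_cmult_left[OF p]])
    fix j
    have "norm (q (k - j)) \<le> (\<Sum>\<^sub>\<infinity>l. norm (q l))"
      using finite_sum_le_infsum[OF q, of "{k - j}"] by simp
    then show "norm (p j * q (k - j)) \<le> norm (p j) * (\<Sum>\<^sub>\<infinity>l. norm (q l))"
      by (simp add: norm_mult mult_left_mono)
  qed simp
  show "((\<lambda>k. \<Sum>\<^sub>\<infinity>j. p j * q (k - j)) has_sum (\<Sum>\<^sub>\<infinity>k. p k) * (\<Sum>\<^sub>\<infinity>k. q k)) UNIV"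
    by (rule has_sum_SigmaD[OF h]) (simp add: s2 has_sum_infsum)
qed

section \<open>Convolution\<close>

text \<open>As a commutative unital Banach algebra the type inherits the exponential series and its
  derivative, from which the explicit solutions are built.\<close>

instantiation wiener :: "{comm_ring_1, real_normed_algebra_1}"
begin

definition times_wiener :: "wiener \<Rightarrow> wiener \<Rightarrow> wiener" where
  "times_wiener a b = Wiener (\<lambda>k. \<Sum>\<^sub>\<infinity>j. coeff a j * coeff b (k - j))"

definition one_wiener :: wiener where
  "one_wiener = monomial 0 1"

lemma coeff_mult_le:
  "cmod (\<Sum>\<^sub>\<infinity>j. coeff a j * coeff b (k - j)) \<le> (\<Sum>\<^sub>\<infinity>j. cmod (coeff a j) * cmod (coeff b (k - j)))"
  using norm_infsum_bound[of "\<lambda>j. coeff a j * coeff b (k - j)" UNIV]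
    convolution_has_sum(2)[of "\<lambda>k. cmod (coeff a k)" "\<lambda>k. cmod (coeff b k)" k]
  by (simp add: norm_mult coeff_abs_summable)

lemma coeff_mult: "coeff (a * b) k = (\<Sum>\<^sub>\<infinity>j. coeff a j * coeff b (k - j))"
proof -
  have "(\<lambda>k. cmod (\<Sum>\<^sub>\<infinity>j. coeff a j * coeff b (k - j))) summable_on UNIV"
    using convolution_has_sum(1)[of "\<lambda>k. cmod (coeff a k)" "\<lambda>k. cmod (coeff b k)"]
    by (intro summable_on_comparison_test[OF _ coeff_mult_le])
      (auto simp: coeff_abs_summable intro: has_sum_imp_summable)
  then show ?thesis
    unfolding times_wiener_def by (subst coeff_Wiener) auto
qed

lemma coeff_1: "coeff 1 k = (if k = 0 then 1 else 0)"
  by (simp add: one_wiener_def coeff_monomial)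

lemma ev_1: "ev 1 x = 1"
  by (simp add: one_wiener_def ev_monomial)

lemma ev_mult: "ev (a * b) x = ev a x * ev b x"
proof (rule ev_eqI)
  let ?e = "\<lambda>k. cis (of_int k * x)"
  have "((\<lambda>k. \<Sum>\<^sub>\<infinity>j. (coeff a j * ?e j) * (coeff b (k - j) * ?e (k - j))) has_sum ev a x * ev b x) UNIV"
    unfolding ev_def by (rule convolution_has_sum) (simp_all add: norm_mult coeff_abs_summable)
  moreover have "(\<Sum>\<^sub>\<infinity>j. (coeff a j * ?e j) * (coeff b (k - j) * ?e (k - j))) = coeff (a * b) k * ?e k" for k
  proof -
    have "?e j * ?e (k - j) = ?e k" for j
      by (simp add: cis_mult left_diff_distrib)
    then have "(coeff a j * ?e j) * (coeff b (k - j) * ?e (k - j)) = (coeff a j * coeff b (k - j)) * ?e k" for j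
      by (metis mult.assoc mult.left_commute)
    then show ?thesis
      unfolding coeff_mult by (simp only: infsum_cmult_left')
  qed
  ultimately show "((\<lambda>k. coeff (a * b) k * ?e k) has_sum ev a x * ev b x) UNIV"
    by simp
qed

text \<open>With \<open>\<gamma> = 0\<close> this says that submultiplicative weights give submultiplicative norms;
  the four-weight form also covers the Leibniz-type bounds for polynomial weights.\<close>

lemma wle_mult_aux:
  assumes w: "\<And>j k. w (j + k) \<le> \<alpha> j * \<beta> k + \<gamma> j * \<delta> k"
    and nn: "\<And>k. 0 \<le> \<alpha> k" "\<And>k. 0 \<le> \<beta> k" "\<And>k. 0 \<le> \<gamma> k" "\<And>k. 0 \<le> \<delta> k" "\<And>k. 0 \<le> w k"
    and b: "wle \<alpha> a A" "wle \<beta> b B" "wle \<gamma> a C" "wle \<delta> b D" and F: "finite F"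
  shows "(\<Sum>k\<in>F. w k * cmod (coeff (a * b) k)) \<le> A * B + C * D"
proof -
  let ?a = "\<lambda>k. cmod (coeff a k)" and ?b = "\<lambda>k. cmod (coeff b k)"
  define G where "G p q k = (\<Sum>\<^sub>\<infinity>j. (p j * ?a j) * (q (k - j) * ?b (k - j)))" for p q k
  note s = wle_summable[OF b(1) nn(1)] wle_summable[OF b(2) nn(2)] wle_summable[OF b(3) nn(3)] wle_summable[OF b(4) nn(4)]
  note cs = convolution_has_sum(2)[of "\<lambda>j. \<alpha> j * ?a j" "\<lambda>j. \<beta> j * ?b j"]
    convolution_has_sum(2)[of "\<lambda>j. \<gamma> j * ?a j" "\<lambda>j. \<delta> j * ?b j"]
  have p: "w k * cmod (coeff (a * b) k) \<le> G \<alpha> \<beta> k + G \<gamma> \<delta> k" for k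
  proof -
    have sk: "(\<lambda>j. (\<alpha> j * ?a j) * (\<beta> (k - j) * ?b (k - j))) summable_on UNIV"
      "(\<lambda>j. (\<gamma> j * ?a j) * (\<delta> (k - j) * ?b (k - j))) summable_on UNIV"
      using cs[of k] s nn by (simp_all add: abs_mult)
    have "w k * cmod (coeff (a * b) k) \<le> w k * (\<Sum>\<^sub>\<infinity>j. ?a j * ?b (k - j))"
      unfolding coeff_mult by (intro mult_left_mono coeff_mult_le nn)
    also have "\<dots> = (\<Sum>\<^sub>\<infinity>j. w k * (?a j * ?b (k - j)))"
      by (simp add: infsum_cmult_right')
    also have "\<dots> \<le> (\<Sum>\<^sub>\<infinity>j. (\<alpha> j * ?a j) * (\<beta> (k - j) * ?b (k - j)) + (\<gamma> j * ?a j) * (\<delta> (k - j) * ?b (k - j)))"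
    proof (rule infsum_mono)
      show "(\<lambda>j. w k * (?a j * ?b (k - j))) summable_on UNIV"
        using convolution_has_sum(2)[of ?a ?b k]
        by (intro summable_on_cmult_right) (simp add: coeff_abs_summable)
      show "w k * (?a j * ?b (k - j)) \<le> (\<alpha> j * ?a j) * (\<beta> (k - j) * ?b (k - j)) + (\<gamma> j * ?a j) * (\<delta> (k - j) * ?b (k - j))" for j
        using mult_right_mono[OF w[of j "k - j"], of "?a j * ?b (k - j)"] by (simp add: algebra_simps)
    qed (intro summable_on_add sk)
    also have "\<dots> = G \<alpha> \<beta> k + G \<gamma> \<delta> k"
      unfolding G_def by (rule infsum_add[OF sk])
    finally show ?thesis .
  qed
  have q: "(\<Sum>k\<in>F. G p q k) \<le> P * Q"
    if "wle p a P" "wle q b Q" "\<And>k. 0 \<le> p k" "\<And>k. 0 \<le> q k" for p q P Q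
  proof -
    have "(G p q has_sum (\<Sum>\<^sub>\<infinity>k. p k * ?a k) * (\<Sum>\<^sub>\<infinity>k. q k * ?b k)) UNIV"
      unfolding G_def using wle_summable[OF that(1,3)] wle_summable[OF that(2,4)] that
      by (intro convolution_has_sum(1)) (simp_all add: abs_mult)
    then have "(\<Sum>k\<in>F. G p q k) \<le> (\<Sum>\<^sub>\<infinity>k. p k * ?a k) * (\<Sum>\<^sub>\<infinity>k. q k * ?b k)"
      by (rule finite_sum_le_has_sum) (auto simp: G_def F that intro!: infsum_nonneg)
    also have "\<dots> \<le> P * Q"
      using wle_infsum[OF that(1,3)] wle_infsum[OF that(2,4)] wle_nonneg[OF that(1)] that
      by (intro mult_mono infsum_nonneg) auto
    finally show ?thesis .
  qed
  have "(\<Sum>k\<in>F. w k * cmod (coeff (a * b) k)) \<le> (\<Sum>k\<in>F. G \<alpha> \<beta> k) + (\<Sum>k\<in>F. G \<gamma> \<delta> k)"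
    unfolding sum.distrib[symmetric] by (intro sum_mono p)
  also have "\<dots> \<le> A * B + C * D"
    by (intro add_mono q b nn)
  finally show ?thesis .
qed

instance
proof
  fix a b c :: wiener and r :: real
  show "a * b * c = a * (b * c)" "a * b = b * a" "1 * a = a" "a * 1 = a"
    "(a + b) * c = a * c + b * c" "a * (b + c) = a * b + a * c"
    "r *\<^sub>R a * b = r *\<^sub>R (a * b)" "a * r *\<^sub>R b = r *\<^sub>R (a * b)"
    by (rule ev_inject; simp add: ev_mult ev_add ev_1 ev_scaleR algebra_simps)+
  show "(0 :: wiener) \<noteq> 1"
    by (metis coeff_1 coeff_simps(1) zero_neq_one)
  show "norm (1 :: wiener) = 1"
    by (simp add: one_wiener_def)
  show "norm (a * b) \<le> norm a * norm b"
  proof (rule norm_leI)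
    fix F :: "int set" assume "finite F"
    then show "(\<Sum>k\<in>F. cmod (coeff (a * b) k)) \<le> norm a * norm b"
      using wle_mult_aux[of "\<lambda>_. 1" "\<lambda>_. 1" "\<lambda>_. 1" "\<lambda>_. 0" "\<lambda>_. 0" a "norm a" b "norm b" 0 0 F]
      by (auto simp: wle_norm wle_def[of "\<lambda>_. 0"])
  qed
qed

end

lemma wle_mult:
  assumes "\<And>j k. w (j + k) \<le> w j * w k" "\<And>k. 0 \<le> w k" "wle w a A" "wle w b B"
  shows "wle w (a * b) (A * B)"
proof (rule wleI)
  fix F :: "int set" assume "finite F"
  then show "(\<Sum>k\<in>F. w k * cmod (coeff (a * b) k)) \<le> A * B"
    using wle_mult_aux[of w w w "\<lambda>_. 0" "\<lambda>_. 0" a A b B 0 0 F] assms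
    by (auto simp: wle_def[of "\<lambda>_. 0"])
qed

definition pw :: "nat \<Rightarrow> int \<Rightarrow> real" where
  "pw m k = (1 + \<bar>of_int k\<bar>) ^ m"

lemma pw_pos: "0 < pw m k"
  by (auto simp: pw_def)

lemma pw_ge_1: "1 \<le> pw m k"
  by (simp add: pw_def)

lemma pw_minus [simp]: "pw m (- k) = pw m k"
  by (simp add: pw_def)

text \<open>The size of \<open>j + k\<close> is controlled by the larger of the two frequencies, so
  the weight falls on one factor only. The bound is therefore linear in the weighted norms, which
  later makes the Gronwall inequality for every \<open>m\<close> linear.\<close>

lemma wle_pw_mult:
  assumes "wle (pw m) a A" "wle (pw m) b B"
  shows "wle (pw m) (a * b) (2 ^ m * (A * norm b + norm a * B))"
proof (rule wleI)
  fix F :: "int set" assume F: "finite F"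
  have "(\<Sum>k\<in>F. pw m k * cmod (coeff (a * b) k)) \<le> (2 ^ m * A) * norm b + norm a * (2 ^ m * B)"
  proof (rule wle_mult_aux[of "pw m" "\<lambda>k. 2 ^ m * pw m k" "\<lambda>_. 1" "\<lambda>_. 1" "\<lambda>k. 2 ^ m * pw m k"])
    show "pw m (j + k) \<le> 2 ^ m * pw m j * 1 + 1 * (2 ^ m * pw m k)" for j k
    proof -
      let ?j = "1 + \<bar>real_of_int j\<bar>" and ?k = "1 + \<bar>real_of_int k\<bar>"
      have "pw m (j + k) \<le> (2 * max ?j ?k) ^ m"
        unfolding pw_def by (rule power_mono) (simp_all add: max_def abs_if)
      also have "\<dots> = 2 ^ m * (max ?j ?k) ^ m"
        by (rule power_mult_distrib)
      also have "(max ?j ?k) ^ m \<le> ?j ^ m + ?k ^ m"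
        by (cases "?j \<le> ?k") (simp_all add: max_def)
      finally show ?thesis
        by (simp add: pw_def algebra_simps)
    qed
    show "wle (\<lambda>k. 2 ^ m * pw m k) a (2 ^ m * A)" "wle (\<lambda>k. 2 ^ m * pw m k) b (2 ^ m * B)"
      using assms by (auto simp: wle_def mult.assoc sum_distrib_left[symmetric])
  qed (auto simp: wle_norm F pw_pos less_imp_le)
  then show "(\<Sum>k\<in>F. pw m k * cmod (coeff (a * b) k)) \<le> 2 ^ m * (A * norm b + norm a * B)"
    by (simp add: algebra_simps)
qed

section \<open>Complex conjugation and Fourier multipliers\<close>

definition star :: "wiener \<Rightarrow> wiener" where
  "star a = Wiener (\<lambda>k. cnj (coeff a (- k)))"

lemma bij_uminus_int: "bij_betw uminus (UNIV :: int set) UNIV"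
  by (rule bij_betwI[of _ _ _ uminus]) auto

lemma coeff_star: "coeff (star a) k = cnj (coeff a (- k))"
proof -
  have "(\<lambda>k. cmod (cnj (coeff a (- k)))) summable_on UNIV"
    using summable_on_reindex_bij_betw[OF bij_uminus_int, of "\<lambda>k. cmod (coeff a k)"]
    by (simp add: coeff_abs_summable)
  then show ?thesis
    unfolding star_def by (subst coeff_Wiener) auto
qed

lemma ev_star: "ev (star a) x = cnj (ev a x)"
proof -
  have "ev (star a) x = (\<Sum>\<^sub>\<infinity>k. cnj (coeff a (- k) * cis (of_int (- k) * x)))"
    unfolding ev_def by (simp add: coeff_star cis_cnj)
  also have "\<dots> = cnj (\<Sum>\<^sub>\<infinity>k. coeff a (- k) * cis (of_int (- k) * x))"
    by (rule infsum_cnj)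
  also have "(\<Sum>\<^sub>\<infinity>k. coeff a (- k) * cis (of_int (- k) * x)) = ev a x"
    unfolding ev_def
    using infsum_reindex_bij_betw[OF bij_uminus_int, of "\<lambda>k. coeff a k * cis (of_int k * x)"] by simp
  finally show ?thesis .
qed

lemma norm_star [simp]: "norm (star a) = norm a"
  unfolding norm_wiener.rep_eq coeff_star
  using infsum_reindex_bij_betw[OF bij_uminus_int, of "\<lambda>k. cmod (coeff a k)"] by simp

lemma star_add: "star (a + b) = star a + star b" and star_mult: "star (a * b) = star a * star b"
  and star_diff: "star (a - b) = star a - star b"
  and star_star [simp]: "star (star a) = a" and star_scaleR: "star (r *\<^sub>R a) = r *\<^sub>R star a"
  and star_minus: "star (- a) = - star a" and star_1 [simp]: "star 1 = 1"
  by (rule ev_inject; simp add: ev_star ev_add ev_mult ev_diff ev_minus ev_scaleR ev_1)+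

lemma bounded_linear_star: "bounded_linear star"
  by (rule bounded_linear_intro[where K = 1]) (auto simp: star_add star_scaleR)

lemma wle_star: "wle w a B \<Longrightarrow> wle (\<lambda>k. w (- k)) (star a) B"
  unfolding wle_def
proof (intro allI impI)
  fix F :: "int set"
  assume a: "\<forall>F. finite F \<longrightarrow> (\<Sum>k\<in>F. w k * cmod (coeff a k)) \<le> B" and F: "finite F"
  have "(\<Sum>k\<in>uminus ` F. w k * cmod (coeff a k)) = (\<Sum>k\<in>F. w (- k) * cmod (coeff (star a) k))"
    by (subst sum.reindex) (auto simp: coeff_star inj_on_def)
  then show "(\<Sum>k\<in>F. w (- k) * cmod (coeff (star a) k)) \<le> B"
    using a F by (metis finite_imageI)
qed

text \<open>Defined for unbounded symbols as well. If the product sequence is not summable,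
  \<open>Wiener\<close> returns an unspecified value; coefficients are therefore read off only after
  a proof of summability.\<close>

definition fmult :: "(int \<Rightarrow> complex) \<Rightarrow> wiener \<Rightarrow> wiener" where
  "fmult m a = Wiener (\<lambda>k. m k * coeff a k)"

lemma coeff_fmult_summable:
  "(\<lambda>k. cmod (m k * coeff a k)) summable_on UNIV \<Longrightarrow> coeff (fmult m a) k = m k * coeff a k"
  unfolding fmult_def by (subst coeff_Wiener) auto

lemma coeff_fmult:
  assumes "\<And>k. cmod (m k) \<le> C"
  shows "coeff (fmult m a) k = m k * coeff a k"
  by (rule coeff_fmult_summable,
      rule summable_on_comparison_test[OF summable_on_cmult_right[OF coeff_abs_summable[of a], of C]])
    (auto simp: norm_mult assms mult_right_mono)

lemma norm_fmult:
  assumes "\<And>k. cmod (m k) \<le> C"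
  shows "norm (fmult m a) \<le> C * norm a"
proof (rule norm_leI)
  fix F :: "int set" assume F: "finite F"
  have "0 \<le> C" using assms[of 0] norm_ge_zero order_trans by blast
  have "(\<Sum>k\<in>F. cmod (coeff (fmult m a) k)) \<le> (\<Sum>k\<in>F. C * cmod (coeff a k))"
    by (intro sum_mono) (simp add: coeff_fmult[OF assms] norm_mult assms mult_right_mono)
  also have "\<dots> \<le> C * norm a"
    using sum_coeff_le_norm[OF F, of a] \<open>0 \<le> C\<close> by (simp add: sum_distrib_left[symmetric] mult_left_mono)
  finally show "(\<Sum>k\<in>F. cmod (coeff (fmult m a) k)) \<le> C * norm a" .
qed

lemma bounded_linear_fmult:
  assumes "\<And>k. cmod (m k) \<le> C"
  shows "bounded_linear (fmult m)"
  by (rule bounded_linear_intro[where K = C])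
    (auto intro!: wiener_eqI simp: coeff_fmult[OF assms] algebra_simps norm_fmult[OF assms])

text \<open>\<open>wiener\<close> is only a real algebra; multiplication by \<open>\<i>\<close> is multiplication by \<open>J\<close>.\<close>

definition J :: wiener where "J = monomial 0 \<i>"

lemma ev_J: "ev J x = \<i>"
  by (simp add: J_def ev_monomial)

lemma norm_J [simp]: "norm J = 1"
  by (simp add: J_def)

lemma J_squared: "J * J = -1" and star_J: "star J = - J"
  by (rule ev_inject; simp add: ev_mult ev_J ev_minus ev_1 ev_star)+

lemma coeff_J_mult: "coeff (J * a) k = \<i> * coeff a k"
proof -
  have "J * a = fmult (\<lambda>_. \<i>) a"
  proof (rule ev_inject)
    fix x
    have "ev (fmult (\<lambda>_. \<i>) a) x = \<i> * ev a x"
      by (rule ev_eqI) (simp add: coeff_fmult[where C = 1] mult.assoc has_sum_cmult_right ev_has_sum)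
    then show "ev (J * a) x = ev (fmult (\<lambda>_. \<i>) a) x"
      by (simp add: ev_mult ev_J)
  qed
  then show ?thesis
    by (simp add: coeff_fmult[where C = 1])
qed

lemma norm_J_mult [simp]: "norm (J * a) = norm a"
  unfolding norm_wiener.rep_eq coeff_J_mult by (simp add: norm_mult)

section \<open>Ordinary differential equations in Banach spaces\<close>

text \<open>Uniformity is required on one bounded time interval only, because the bounds on
  approximate solutions deteriorate as the interval grows.\<close>

lemma has_vector_derivative_limit:
  fixes f :: "nat \<Rightarrow> real \<Rightarrow> 'a :: banach"
  assumes der: "\<And>n t. \<bar>t\<bar> < T \<Longrightarrow> (f n has_vector_derivative f' n t) (at t)"
    and lim: "\<And>t. \<bar>t\<bar> < T \<Longrightarrow> (\<lambda>n. f n t) \<longlonglongrightarrow> g t"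
    and unif: "uniform_limit {-T<..<T} f' g' sequentially" and t: "\<bar>t\<bar> < T"
  shows "(g has_vector_derivative g' t) (at t)"
proof -
  let ?S = "{-T<..<T}"
  have tS: "t \<in> ?S" using t by auto
  have "\<exists>h. \<forall>x\<in>?S. (\<lambda>n. f n x) \<longlonglongrightarrow> h x \<and> (h has_derivative (\<lambda>r. r *\<^sub>R g' x)) (at x within ?S)"
  proof (rule has_derivative_sequence[where ?x0.0 = t and f' = "\<lambda>n x r. r *\<^sub>R f' n x"])
    show "(f n has_derivative (\<lambda>r. r *\<^sub>R f' n x)) (at x within ?S)" if "x \<in> ?S" for n x
      using der[of x n] that by (auto simp: has_vector_derivative_def intro: has_derivative_at_withinI)
    show "\<forall>\<^sub>F n in sequentially. \<forall>x\<in>?S. \<forall>r. norm (r *\<^sub>R f' n x - r *\<^sub>R g' x) \<le> e * norm r" if "e > 0" for e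
      using uniform_limitD[OF unif that]
    proof eventually_elim
      case (elim n)
      have "norm (r *\<^sub>R f' n x - r *\<^sub>R g' x) \<le> e * norm r" if "x \<in> ?S" for x r
        using elim that mult_left_mono[of "norm (f' n x - g' x)" e "\<bar>r\<bar>"]
        by (force simp: dist_norm scaleR_diff_right[symmetric] mult.commute)
      then show ?case by blast
    qed
    show "(\<lambda>n. f n t) \<longlonglongrightarrow> g t" by (rule lim[OF t])
  qed (use tS in auto)
  then obtain h where h: "\<And>x. x \<in> ?S \<Longrightarrow> (\<lambda>n. f n x) \<longlonglongrightarrow> h x"
    "\<And>x. x \<in> ?S \<Longrightarrow> (h has_derivative (\<lambda>r. r *\<^sub>R g' x)) (at x within ?S)" by blast
  have "h x = g x" if "x \<in> ?S" for x
    using LIMSEQ_unique[OF h(1)[OF that] lim] that by auto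
  then have "(g has_derivative (\<lambda>r. r *\<^sub>R g' t)) (at t within ?S)"
    using has_derivative_transform[OF tS, of g h] h(2)[OF tS] by metis
  then show ?thesis
    using at_within_open[OF tS] by (simp add: has_vector_derivative_def)
qed

lemma convergent_of_cauchy_bound:
  fixes X :: "nat \<Rightarrow> 'a :: banach"
  assumes B: "B \<longlonglongrightarrow> 0" and le: "\<And>n j. norm (X (n + j) - X n) \<le> B n"
  shows "convergent X"
  unfolding Cauchy_convergent_iff[symmetric]
proof (rule metric_CauchyI)
  fix e :: real assume "e > 0"
  then have "\<forall>\<^sub>F n in sequentially. B n < e / 2"
    by (intro order_tendstoD(2)[OF B]) simp
  then obtain N where N: "B N < e / 2"
    by (auto simp: eventually_sequentially)
  have "dist (X n) (X N) < e / 2" if "N \<le> n" for n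
    using le_less_trans[OF le[of N "n - N"] N] that by (simp only: dist_norm le_add_diff_inverse)
  then show "\<exists>N. \<forall>m\<ge>N. \<forall>n\<ge>N. dist (X m) (X n) < e"
    using dist_triangle_half_l by blast
qed

lemma norm_limit_diff_le:
  assumes lim: "X \<longlonglongrightarrow> l" and le: "\<And>j. norm (X (n + j) - X n) \<le> C"
  shows "norm (X n - l) \<le> C"
proof (rule tendsto_upperbound)
  show "(\<lambda>j. norm (X n - X (j + n))) \<longlonglongrightarrow> norm (X n - l)"
    by (intro tendsto_intros LIMSEQ_ignore_initial_segment lim)
  show "\<forall>\<^sub>F j in sequentially. norm (X n - X (j + n)) \<le> C"
    using le by (intro always_eventually allI) (simp add: add.commute norm_minus_commute)
qed simp

lemma uniform_limit_of_bound:
  assumes e: "e \<longlonglongrightarrow> (0 :: real)" and le: "\<And>n x. x \<in> S \<Longrightarrow> dist (f n x) (g x) \<le> e n"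
  shows "uniform_limit S f g sequentially"
proof (rule uniform_limitI)
  fix q :: real assume "q > 0"
  with e have "\<forall>\<^sub>F n in sequentially. e n < q"
    by (rule order_tendstoD)
  then show "\<forall>\<^sub>F n in sequentially. \<forall>x\<in>S. dist (f n x) (g x) < q"
  proof eventually_elim
    case (elim n)
    show ?case by (intro ballI le_less_trans[OF le elim])
  qed
qed

lemma antiderivative_exists:
  fixes g :: "real \<Rightarrow> 'a :: banach"
  assumes "continuous_on UNIV g"
  shows "\<exists>G. G 0 = 0 \<and> (\<forall>t. (G has_vector_derivative g t) (at t))"
proof -
  \<comment> \<open>For either sign of \<open>t\<close> one of the two intervals is empty or a
    point, so this is the oriented integral from 0 to \<open>t\<close>.\<close>
  define G where "G t = integral {0..t} g - integral {t..0} g" for t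
  have int: "g integrable_on {a..b}" for a b
    by (intro integrable_continuous_real continuous_on_subset[OF assms]) auto
  have "(G has_vector_derivative g t) (at t)" for t
  proof -
    define r where "r = \<bar>t\<bar> + 1"
    have t: "t \<in> {-r<..<r}" by (auto simp: r_def)
    have "((\<lambda>s. integral {-r..s} g - integral {-r..0} g) has_vector_derivative g t - 0) (at t within {-r..r})"
      by (intro has_vector_derivative_diff integral_has_vector_derivative continuous_on_subset[OF assms]
          has_vector_derivative_const) (use t in auto)
    then have "((\<lambda>s. integral {-r..s} g - integral {-r..0} g) has_vector_derivative g t) (at t within {-r<..<r})"
      by (auto intro: has_vector_derivative_within_subset)
    then have "(G has_vector_derivative g t) (at t within {-r<..<r})"
    proof (rule has_vector_derivative_transform[OF t, rotated])
      fix s assume s: "s \<in> {-r<..<r}"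
      show "G s = integral {-r..s} g - integral {-r..0} g"
      proof (cases "0 \<le> s")
        case True
        then show ?thesis
          using Henstock_Kurzweil_Integration.integral_combine[of "-r" 0 s g] int t s by (cases "s = 0") (auto simp: G_def algebra_simps)
      next
        case False
        then show ?thesis
          using Henstock_Kurzweil_Integration.integral_combine[of "-r" s 0 g] int t s by (auto simp: G_def algebra_simps)
      qed
    qed
    then show ?thesis
      using at_within_open[OF t] by simp
  qed
  then show ?thesis
    by (intro exI[of _ G]) (simp add: G_def)
qed

lemma norm_le_of_derivative_le:
  fixes G :: "real \<Rightarrow> 'a :: real_normed_vector"
  assumes der: "\<And>s. s \<in> {0..t} \<Longrightarrow> (G has_vector_derivative G' s) (at s)"
    and H: "\<And>s. s \<in> {0..t} \<Longrightarrow> (H has_vector_derivative h s) (at s)"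
    and le: "\<And>s. s \<in> {0..t} \<Longrightarrow> norm (G' s) \<le> h s" and t: "0 \<le> t"
  shows "norm (G t - G 0) \<le> H t - H 0"
proof (cases "t = 0")
  case False
  have "continuous_on {0..t} G" "continuous_on {0..t} H"
    using has_vector_derivative_continuous[OF der] has_vector_derivative_continuous[OF H]
    by (auto intro!: continuous_at_imp_continuous_on)
  then show ?thesis
    using False t der H le by (intro differentiable_bound_general[of 0 t G H G' h]) auto
qed simp

lemma exp_has_vector_derivative:
  "((\<lambda>s. C * exp (b * s)) has_vector_derivative C * b * exp (b * s)) (at s within S)" for C b s :: real
  by (auto intro!: derivative_eq_intros simp: has_real_derivative_iff_has_vector_derivative[symmetric])

text \<open>Integration against exp(b |s|) gains the factor 1 / b. With \<open>b\<close> twice a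
  Lipschitz constant this gain is the contraction factor 1/2 of the Picard iteration.\<close>

lemma exp_growth_bound:
  fixes G :: "real \<Rightarrow> 'a :: real_normed_vector"
  assumes der: "\<And>s. (G has_vector_derivative G' s) (at s)" and "G 0 = 0" and b: "0 < b"
    and le: "\<And>s. norm (G' s) \<le> C * exp (b * \<bar>s\<bar>)"
  shows "norm (G t) \<le> C / b * exp (b * \<bar>t\<bar>)"
proof -
  have C: "0 \<le> C" using order_trans[OF norm_ge_zero le[of 0]] by simp
  have pos: "norm (G t) \<le> C / b * exp (b * t)"
    if "0 \<le> t" "\<And>s. (G has_vector_derivative G' s) (at s)" "G 0 = 0"
      "\<And>s. norm (G' s) \<le> C * exp (b * \<bar>s\<bar>)" for G :: "real \<Rightarrow> 'a" and G' t
  proof -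
    have "norm (G t - G 0) \<le> C / b * exp (b * t) - C / b * exp (b * 0)"
    proof (rule norm_le_of_derivative_le[OF that(2)])
      show "((\<lambda>s. C / b * exp (b * s)) has_vector_derivative C * exp (b * s)) (at s)" for s
        using exp_has_vector_derivative[of "C / b" b s UNIV] b by simp
      show "norm (G' s) \<le> C * exp (b * s)" if "s \<in> {0..t}" for s
        using \<open>\<And>s. norm (G' s) \<le> C * exp (b * \<bar>s\<bar>)\<close>[of s] that by simp
    qed (rule \<open>0 \<le> t\<close>)
    also have "\<dots> \<le> C / b * exp (b * t)"
      using C b by simp
    finally show ?thesis
      using \<open>G 0 = 0\<close> by simp
  qed
  show ?thesis
  proof (cases "0 \<le> t")
    case False
    have "((\<lambda>s. G (- s)) has_vector_derivative - G' (- s)) (at s)" for s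
      using vector_diff_chain_at[of uminus "-1" s G "G' (- s)"] der[of "- s"]
      by (simp add: o_def has_vector_derivative_minus has_vector_derivative_id)
    from pos[OF _ this, of "- t"] show ?thesis
      using False le[of "- s" for s] \<open>G 0 = 0\<close> by simp
  qed (use pos[of t G G'] assms in auto)
qed

text \<open>Measured against exp(2 L |t|), each iteration halves the increment. The solution is
  therefore global at once, without gluing short time intervals.\<close>

theorem picard:
  fixes F :: "'a :: banach \<Rightarrow> 'a"
  assumes L: "0 < L" and lip: "\<And>x y. norm (F x - F y) \<le> L * norm (x - y)"
  shows "\<exists>x. x 0 = x0 \<and> (\<forall>t. (x has_vector_derivative F (x t)) (at t))"
proof -
  have F_cont: "continuous_on S F" for S
    by (rule lipschitz_on_continuous_on[of L]) (use L lip in \<open>auto intro!: lipschitz_onI simp: dist_norm\<close>)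
  define P where "P x G \<longleftrightarrow> G 0 = 0 \<and> (\<forall>t. (G has_vector_derivative F (x t)) (at t))" for x :: "real \<Rightarrow> 'a" and G
  define X where "X = rec_nat (\<lambda>_. x0) (\<lambda>n x t. x0 + (SOME G. P x G) t)"
  have X_simps: "X 0 = (\<lambda>_. x0)" "\<And>n. X (Suc n) = (\<lambda>t. x0 + (SOME G. P (X n) G) t)"
    by (simp_all add: X_def)
  have X: "continuous_on UNIV (X n) \<and> X (Suc n) 0 = x0 \<and>
      (\<forall>t. (X (Suc n) has_vector_derivative F (X n t)) (at t))" for n
  proof (induction n)
    case 0
    have "\<exists>G. P (X 0) G"
      using antiderivative_exists[of "\<lambda>t. F (X 0 t)"] by (simp add: P_def X_simps(1))
    then have "P (X 0) (SOME G. P (X 0) G)"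
      by (rule someI_ex)
    then show ?case
      by (auto simp: X_simps P_def intro!: derivative_eq_intros)
  next
    case (Suc n)
    then have c: "continuous_on UNIV (X (Suc n))"
      by (auto intro!: continuous_at_imp_continuous_on has_vector_derivative_continuous)
    have "\<exists>G. P (X (Suc n)) G"
      using antiderivative_exists[OF continuous_on_compose2[OF F_cont c subset_UNIV]] by (simp add: P_def)
    then have "P (X (Suc n)) (SOME G. P (X (Suc n)) G)"
      by (rule someI_ex)
    then show ?case
      using c by (auto simp: X_simps(2)[of "Suc n"] P_def intro!: derivative_eq_intros)
  qed
  define C where "C = norm (F x0) / (2 * L)"
  have C: "0 \<le> C" using L by (simp add: C_def)
  have step: "norm (X (Suc n) t - X n t) \<le> C * (1/2) ^ n * exp (2 * L * \<bar>t\<bar>)" for n t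
  proof (induction n arbitrary: t)
    case 0
    have "norm (X 1 t - x0) \<le> norm (F x0) / (2 * L) * exp (2 * L * \<bar>t\<bar>)"
    proof (rule exp_growth_bound[where G' = "\<lambda>_. F x0"])
      show "((\<lambda>t. X 1 t - x0) has_vector_derivative F x0) (at s)" for s
        using X[of 0] has_vector_derivative_diff_const by (fastforce simp: X_simps(1))
      show "norm (F x0) \<le> norm (F x0) * exp (2 * L * \<bar>s\<bar>)" for s
        using L by (simp add: mult_le_cancel_left1)
    qed (use X[of 0] L in auto)
    then show ?case by (simp add: C_def X_simps(1))
  next
    case (Suc n)
    have "norm (X (Suc (Suc n)) t - X (Suc n) t) \<le> (L * (C * (1/2) ^ n)) / (2 * L) * exp (2 * L * \<bar>t\<bar>)"
    proof (rule exp_growth_bound[where G' = "\<lambda>s. F (X (Suc n) s) - F (X n s)"])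
      show "((\<lambda>t. X (Suc (Suc n)) t - X (Suc n) t) has_vector_derivative F (X (Suc n) s) - F (X n s)) (at s)" for s
        using X by (intro has_vector_derivative_diff) auto
      show "norm (F (X (Suc n) s) - F (X n s)) \<le> L * (C * (1/2) ^ n) * exp (2 * L * \<bar>s\<bar>)" for s
        using order_trans[OF lip mult_left_mono[OF Suc[of s]]] L by (simp add: mult.assoc)
    qed (use X[of n] X[of "Suc n"] L in auto)
    then show ?case using L by simp
  qed
  \<comment> \<open>Keeping the subtracted \<open>(1/2) ^ (n + k)\<close> makes the telescoping
    induction on \<open>k\<close> close exactly; it is dropped afterwards.\<close>
  have steps: "norm (X (n + k) t - X n t) \<le> 2 * C * exp (2 * L * \<bar>t\<bar>) * ((1/2) ^ n - (1/2) ^ (n + k))" for n k t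
  proof (induction k)
    case (Suc k)
    have "norm (X (n + Suc k) t - X n t) \<le> norm (X (Suc (n + k)) t - X (n + k) t) + norm (X (n + k) t - X n t)"
      using norm_triangle_ineq[of "X (Suc (n + k)) t - X (n + k) t" "X (n + k) t - X n t"] by simp
    also have "\<dots> \<le> C * (1/2) ^ (n + k) * exp (2 * L * \<bar>t\<bar>) +
        2 * C * exp (2 * L * \<bar>t\<bar>) * ((1/2) ^ n - (1/2) ^ (n + k))"
      by (intro add_mono step Suc.IH)
    also have "\<dots> = 2 * C * exp (2 * L * \<bar>t\<bar>) * ((1/2) ^ n - (1/2) ^ (n + Suc k))"
      by (simp add: algebra_simps)
    finally show ?case .
  qed simp
  define B where "B T n = 2 * C * exp (2 * L * T) * (1/2) ^ n" for T n
  have B_lim: "B T \<longlonglongrightarrow> 0" for T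
    unfolding B_def by (intro tendsto_mult_right_zero LIMSEQ_power_zero) simp
  have X_B: "norm (X (n + k) t - X n t) \<le> B T n" if "\<bar>t\<bar> \<le> T" for n k t T
  proof -
    have "norm (X (n + k) t - X n t) \<le> 2 * C * exp (2 * L * \<bar>t\<bar>) * (1/2) ^ n"
      using order_trans[OF steps[of n k t] mult_left_mono[of _ "(1/2) ^ n"]] C by simp
    also have "\<dots> \<le> B T n"
      unfolding B_def using that L C by (intro mult_right_mono mult_left_mono) auto
    finally show ?thesis .
  qed
  have conv: "convergent (\<lambda>n. X n t)" for t
    by (rule convergent_of_cauchy_bound[OF B_lim]) (rule X_B[OF order_refl])
  define x where "x t = lim (\<lambda>n. X n t)" for t
  have lim: "(\<lambda>n. X n t) \<longlonglongrightarrow> x t" for t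
    using conv by (simp add: x_def convergent_LIMSEQ_iff)
  have X_x: "norm (X n t - x t) \<le> B T n" if "\<bar>t\<bar> \<le> T" for t T n
    using norm_limit_diff_le[of "\<lambda>n. X n t", OF lim, of n "B T n"] X_B[OF that] by simp
  have "(x has_vector_derivative F (x t)) (at t)" for t
  proof (rule has_vector_derivative_limit[where f = "\<lambda>n. X (Suc n)" and f' = "\<lambda>n t. F (X n t)" and g' = "\<lambda>t. F (x t)"])
    define T where "T = \<bar>t\<bar> + 1"
    show "uniform_limit {- T<..<T} (\<lambda>n t. F (X n t)) (\<lambda>t. F (x t)) sequentially"
    proof (rule uniform_limit_of_bound)
      show "(\<lambda>n. L * B T n) \<longlonglongrightarrow> 0"
        by (rule tendsto_mult_right_zero[OF B_lim])
      fix n t assume "t \<in> {- T<..<T}"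
      then have "norm (X n t - x t) \<le> B T n"
        by (intro X_x) auto
      then show "dist (F (X n t)) (F (x t)) \<le> L * B T n"
        unfolding dist_norm using L by (intro order_trans[OF lip] mult_left_mono) auto
    qed
    show "\<bar>t\<bar> < T" by (simp add: T_def)
  qed (use X lim in \<open>auto intro: LIMSEQ_Suc\<close>)
  moreover have "x 0 = x0"
  proof (rule LIMSEQ_unique[OF LIMSEQ_Suc[OF lim]])
    show "(\<lambda>n. X (Suc n) 0) \<longlonglongrightarrow> x0" using X by simp
  qed
  ultimately show ?thesis by blast
qed

section \<open>The Galerkin system and its conservation laws\<close>

lemma coeff_mult_star_0: "coeff (a * star b) 0 = (\<Sum>\<^sub>\<infinity>j. coeff a j * cnj (coeff b j))"
  by (simp add: coeff_mult coeff_star)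

text \<open>The real part of the mean over the circle. Hence \<open>tr (a * star b)\<close> is the
  real L^2 inner product, and the conservation laws become computations in the algebra.\<close>

definition tr :: "wiener \<Rightarrow> real" where "tr a = Re (coeff a 0)"

lemma bounded_linear_tr: "bounded_linear tr"
  unfolding tr_def by (rule bounded_linear_compose[OF bounded_linear_Re bounded_linear_coeff])

lemma tr_add: "tr (a + b) = tr a + tr b" and tr_minus: "tr (- a) = - tr a"
  by (simp_all add: tr_def)

lemma tr_star: "tr (star a) = tr a"
  by (simp add: tr_def coeff_star)

text \<open>A self-adjoint element is a real-valued function, and \<i> times it has purely imaginary
  mean. The nonlinear term of the mass law and the energy law both cancel for this reason.\<close>

lemma tr_J_self_adjoint: "star a = a \<Longrightarrow> tr (J * a) = 0"
  using tr_star[of "J * a"] by (simp add: star_mult star_J tr_minus)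

lemma summable_coeff_squared: "(\<lambda>j. (cmod (coeff a j))\<^sup>2) summable_on UNIV"
  by (rule summable_on_comparison_test[OF summable_on_cmult_right[OF coeff_abs_summable[of a], of "norm a"]])
    (auto simp: power2_eq_square intro!: mult_right_mono coeff_le_norm)

lemma tr_self_star: "tr (a * star a) = (\<Sum>\<^sub>\<infinity>j. (cmod (coeff a j))\<^sup>2)"
proof -
  have "(\<lambda>j. coeff a j * cnj (coeff a j)) summable_on UNIV"
    by (rule norm_summable) (use summable_coeff_squared[of a] in \<open>simp add: norm_mult power2_eq_square\<close>)
  then show ?thesis
    by (simp add: tr_def coeff_mult_star_0 infsum_Re[symmetric] complex_norm_square[symmetric] flip: of_real_power)
qed

lemma tr_self_star_nonneg: "0 \<le> tr (a * star a)"
  by (auto simp: tr_self_star intro!: infsum_nonneg)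

lemma sum_coeff_squared_le: "finite F \<Longrightarrow> (\<Sum>j\<in>F. (cmod (coeff a j))\<^sup>2) \<le> tr (a * star a)"
  unfolding tr_self_star by (intro finite_sum_le_infsum summable_coeff_squared) auto

lemma tr_fmult_star:
  assumes m: "\<And>k. cmod (of_real (m k)) \<le> C"
  shows "tr (fmult (\<lambda>k. of_real (m k)) a * star b) = tr (a * star (fmult (\<lambda>k. of_real (m k)) b))"
  unfolding tr_def coeff_mult_star_0 coeff_fmult[of "\<lambda>k. of_real (m k)", OF m]
  by (simp add: mult.commute mult.left_commute)

definition cubic :: "wiener \<Rightarrow> wiener" where "cubic a = a * a * star a"

lemma norm_cubic_diff:
  assumes "norm a \<le> R" "norm b \<le> R"
  shows "norm (cubic a - cubic b) \<le> 3 * R\<^sup>2 * norm (a - b)"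
proof -
  have R: "0 \<le> R" using assms(1) norm_ge_zero order_trans by blast
  have "cubic a - cubic b = (a - b) * (a * star a) + (a - b) * (b * star a) + star (a - b) * (b * b)"
    by (simp add: cubic_def star_diff algebra_simps)
  also have "norm \<dots> \<le> norm (a - b) * (R * R) + norm (a - b) * (R * R) + norm (a - b) * (R * R)"
    by (intro norm_triangle_mono order_trans[OF norm_mult_ineq] mult_mono)
      (auto simp: assms R)
  finally show ?thesis
    by (simp add: power2_eq_square algebra_simps)
qed

lemma wle_pw_cubic:
  assumes "wle (pw m) a A"
  shows "wle (pw m) (cubic a) (3 * 4 ^ m * (norm a)\<^sup>2 * A)"
proof -
  have A: "0 \<le> A" using assms by (rule wle_nonneg)
  have s: "wle (pw m) (star a) A"
    using wle_star[OF assms] by simp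
  note wle_pw_mult[OF wle_pw_mult[OF assms assms] s]
  then show ?thesis
    unfolding cubic_def
  proof (rule wle_mono)
    have "2 ^ m * (2 ^ m * (A * norm a + norm a * A) * norm (star a) + norm (a * a) * A)
        \<le> 2 ^ m * (2 ^ m * (A * norm a + norm a * A) * norm a + 2 ^ m * (norm a * norm a) * A)"
      using A norm_mult_ineq[of a a] mult_right_mono[of 1 "2 ^ m" "norm a * norm a"]
      by (intro mult_left_mono add_mono mult_right_mono) auto
    also have "\<dots> = 3 * (2 ^ m * 2 ^ m) * (norm a)\<^sup>2 * A"
      by (simp add: algebra_simps power2_eq_square)
    also have "2 ^ m * 2 ^ m = (4 :: real) ^ m"
      by (simp add: power_mult_distrib[symmetric])
    finally show "2 ^ m * (2 ^ m * (A * norm a + norm a * A) * norm (star a) + norm (a * a) * A)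
        \<le> 3 * 4 ^ m * (norm a)\<^sup>2 * A" .
  qed
qed

text \<open>The map is the radial retraction onto the ball of radius \<open>R\<close>. The constant
  2 counts the change of the vector and the change of the scaling factor separately, which works in
  any normed space. It turns a locally Lipschitz vector field into a globally Lipschitz one.\<close>

lemma radial_cutoff_lipschitz:
  fixes x y :: "'a :: real_normed_vector"
  assumes "0 < R"
  shows "norm ((R / max R (norm x)) *\<^sub>R x - (R / max R (norm y)) *\<^sub>R y) \<le> 2 * norm (x - y)"
proof -
  let ?p = "max R (norm x)" and ?q = "max R (norm y)"
  have p: "0 < ?p" "0 < ?q" using assms by auto
  have "(R / ?p) *\<^sub>R x - (R / ?q) *\<^sub>R y = (R / ?p) *\<^sub>R (x - y) + (R / ?p - R / ?q) *\<^sub>R y"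
    by (simp add: algebra_simps)
  also have "norm \<dots> \<le> norm (x - y) + norm (x - y)"
  proof (rule norm_triangle_mono)
    have "R / ?p \<le> 1" "0 \<le> R / ?p" using assms by auto
    then show "norm ((R / ?p) *\<^sub>R (x - y)) \<le> norm (x - y)"
      using mult_right_mono[of "R / ?p" 1 "norm (x - y)", OF _ norm_ge_zero]
      by (simp only: norm_scaleR abs_of_nonneg mult_1)
    have "R / ?p - R / ?q = (R / ?p) * ((?q - ?p) / ?q)"
      using p by (simp add: field_simps)
    then have "norm ((R / ?p - R / ?q) *\<^sub>R y) = (R / ?p) * (\<bar>?q - ?p\<bar> * (norm y / ?q))"
      using assms p by (simp add: abs_mult)
    also have "\<dots> \<le> 1 * (norm (x - y) * 1)"
    proof (intro mult_mono)
      show "\<bar>?q - ?p\<bar> \<le> norm (x - y)"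
        using norm_triangle_ineq3[of x y] by (auto simp: max_def)
    qed (use assms p in auto)
    finally show "norm ((R / ?p - R / ?q) *\<^sub>R y) \<le> norm (x - y)" by simp
  qed
  finally show ?thesis by simp
qed

definition proj :: "nat \<Rightarrow> wiener \<Rightarrow> wiener" where
  "proj M = fmult (\<lambda>k. of_real (if \<bar>k\<bar> \<le> int M then 1 else 0))"

text \<open>The operator |D| cut off at \<open>M\<close>, hence bounded. As for \<open>proj\<close>,
  the symbol is written with \<open>of_real\<close> so that the self-adjointness of real
  multipliers, \<open>tr_fmult_star\<close>, applies.\<close>

definition tabs :: "nat \<Rightarrow> wiener \<Rightarrow> wiener" where
  "tabs M = fmult (\<lambda>k. of_real (if \<bar>k\<bar> \<le> int M then of_int \<bar>k\<bar> else 0))"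

lemma proj_bound: "cmod (of_real (if \<bar>k\<bar> \<le> int M then 1 else 0)) \<le> 1"
  by simp

lemma tabs_bound: "cmod (of_real (if \<bar>k\<bar> \<le> int M then of_int \<bar>k\<bar> else 0)) \<le> real M"
  by auto

lemma coeff_proj: "coeff (proj M a) k = (if \<bar>k\<bar> \<le> int M then coeff a k else 0)"
  unfolding proj_def by (subst coeff_fmult[OF proj_bound]) simp

lemma coeff_tabs: "coeff (tabs M a) k = (if \<bar>k\<bar> \<le> int M then of_int \<bar>k\<bar> * coeff a k else 0)"
  unfolding tabs_def by (subst coeff_fmult[OF tabs_bound]) (simp del: of_int_abs)

lemma bounded_linear_proj: "bounded_linear (proj M)"
  unfolding proj_def by (rule bounded_linear_fmult[OF proj_bound])

lemma bounded_linear_tabs: "bounded_linear (tabs M)"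
  unfolding tabs_def by (rule bounded_linear_fmult[OF tabs_bound])

lemma norm_proj: "norm (proj M a) \<le> norm a"
  unfolding proj_def by (rule order_trans[OF norm_fmult[OF proj_bound]]) simp

lemma norm_tabs: "norm (tabs M a) \<le> real M * norm a"
  unfolding tabs_def by (rule norm_fmult[OF tabs_bound])

lemma tr_proj: "tr (proj M a * star b) = tr (a * star (proj M b))"
  unfolding proj_def by (rule tr_fmult_star[OF proj_bound])

lemma tr_tabs: "tr (tabs M a * star b) = tr (a * star (tabs M b))"
  unfolding tabs_def by (rule tr_fmult_star[OF tabs_bound])

lemma proj_J: "proj M (J * a) = J * proj M a" and tabs_J: "tabs M (J * a) = J * tabs M a"
  by (rule wiener_eqI; simp add: coeff_proj coeff_tabs coeff_J_mult)+

definition galerkin :: "nat \<Rightarrow> wiener \<Rightarrow> wiener" where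
  "galerkin M a = - (J * (tabs M a + proj M (cubic a)))"

lemma proj_galerkin: "proj M (galerkin M a) = galerkin M a"
  by (rule wiener_eqI) (simp add: coeff_proj galerkin_def coeff_J_mult coeff_tabs)

text \<open>Infinitesimal conservation of mass. The truncated |D| is self-adjoint, so \<i> times it
  pairs with \<open>a\<close> to zero; in the cubic term the projection moves onto \<open>a\<close>,
  which it fixes, and leaves \<i> times the real function |a|^4.\<close>

lemma tr_galerkin:
  assumes "proj M a = a"
  shows "tr (galerkin M a * star a) = 0"
proof -
  have "tr (J * tabs M a * star a) = tr (J * a * star (tabs M a))"
    using tr_tabs[of M "J * a" a] by (simp add: tabs_J)
  moreover have "tr (J * tabs M a * star a) = - tr (J * a * star (tabs M a))"
    using tr_star[of "J * tabs M a * star a"] by (simp add: star_mult star_J tr_minus mult_ac)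
  moreover have "tr (J * proj M (cubic a) * star a) = 0"
  proof -
    have "tr (J * proj M (cubic a) * star a) = tr (J * (cubic a * star a))"
      using tr_proj[of M "J * cubic a" a] by (simp add: proj_J assms mult.assoc)
    also have "\<dots> = 0"
      by (rule tr_J_self_adjoint) (simp add: cubic_def star_mult mult_ac)
    finally show ?thesis .
  qed
  moreover have "galerkin M a * star a = - (J * tabs M a * star a) - J * proj M (cubic a) * star a"
    by (simp add: galerkin_def algebra_simps)
  ultimately show ?thesis
    using tr_add[of "- (J * tabs M a * star a)" "- (J * proj M (cubic a) * star a)"] by (simp add: tr_minus)
qed

lemma constant_of_zero_derivative:
  fixes f :: "real \<Rightarrow> 'a :: real_normed_vector"
  assumes "\<And>t. (f has_vector_derivative 0) (at t)"
  shows "f t = f 0"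
proof -
  obtain c where "\<And>x. x \<in> UNIV \<Longrightarrow> f x = c"
    by (rule has_vector_derivative_zero_constant[OF convex_UNIV assms]) (rule that)
  then show ?thesis by simp
qed

lemma norm_galerkin_diff:
  assumes "norm a \<le> R" "norm b \<le> R"
  shows "norm (galerkin M a - galerkin M b) \<le> (real M + 3 * R\<^sup>2) * norm (a - b)"
proof -
  have "galerkin M a - galerkin M b = - (J * (tabs M (a - b) + proj M (cubic a - cubic b)))"
    unfolding galerkin_def linear_diff[OF bounded_linear.linear[OF bounded_linear_tabs]]
      linear_diff[OF bounded_linear.linear[OF bounded_linear_proj]]
    by (simp add: distrib_left right_diff_distrib)
  then have "norm (galerkin M a - galerkin M b) = norm (tabs M (a - b) + proj M (cubic a - cubic b))"
    by simp
  also have "\<dots> \<le> real M * norm (a - b) + 3 * R\<^sup>2 * norm (a - b)"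
    by (intro norm_triangle_mono norm_tabs order_trans[OF norm_proj norm_cubic_diff] assms)
  finally show ?thesis by (simp add: algebra_simps)
qed

text \<open>Uses x \<le> 1 + x^2 on the \<open>2 * M + 1\<close> available modes. The dependence on
  \<open>M\<close> is harmless: the bound only has to show that the radial cutoff is never
  active.\<close>

lemma norm_le_of_proj:
  assumes "proj M a = a"
  shows "norm a \<le> real (2 * M + 1) + tr (a * star a)"
proof (rule norm_leI)
  fix F :: "int set" assume F: "finite F"
  let ?G = "{- int M..int M}"
  have z: "coeff a k = 0" if "k \<notin> ?G" for k
  proof -
    have "coeff a k = coeff (proj M a) k" using assms by simp
    also have "\<dots> = 0" using that by (auto simp: coeff_proj)
    finally show ?thesis .
  qed
  have "(\<Sum>k\<in>F. cmod (coeff a k)) = (\<Sum>k\<in>F \<inter> ?G. cmod (coeff a k))"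
    using F by (intro sum.mono_neutral_cong_right) (auto simp: z)
  also have "\<dots> \<le> (\<Sum>k\<in>?G. cmod (coeff a k))"
    by (rule sum_mono2) auto
  also have "\<dots> \<le> (\<Sum>k\<in>?G. 1 + (cmod (coeff a k))\<^sup>2)"
  proof (rule sum_mono)
    fix k show "cmod (coeff a k) \<le> 1 + (cmod (coeff a k))\<^sup>2"
      using zero_le_power2[of "cmod (coeff a k) - 1 / 2"] by (simp add: power2_eq_square algebra_simps)
  qed
  also have "\<dots> = real (2 * M + 1) + (\<Sum>k\<in>?G. (cmod (coeff a k))\<^sup>2)"
    by (simp add: sum.distrib)
  also have "\<dots> \<le> real (2 * M + 1) + tr (a * star a)"
    by (intro add_left_mono sum_coeff_squared_le) auto
  finally show "(\<Sum>k\<in>F. cmod (coeff a k)) \<le> real (2 * M + 1) + tr (a * star a)" .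
qed

lemma has_vector_derivative_star:
  "(c has_vector_derivative c') F \<Longrightarrow> ((\<lambda>t. star (c t)) has_vector_derivative star c') F"
  by (rule bounded_linear.has_vector_derivative[OF bounded_linear_star])

lemma mass_derivative:
  assumes "(c has_vector_derivative c') (at t)"
  shows "((\<lambda>t. tr (c t * star (c t))) has_vector_derivative 2 * tr (c' * star (c t))) (at t)"
proof -
  have "((\<lambda>t. tr (c t * star (c t))) has_vector_derivative tr (c t * star c' + c' * star (c t))) (at t)"
    by (intro bounded_linear.has_vector_derivative[OF bounded_linear_tr] has_vector_derivative_mult
        has_vector_derivative_star assms)
  then show ?thesis
    using tr_star[of "c' * star (c t)"] by (simp add: tr_add star_mult mult.commute)
qed

text \<open>The vector field is composed with the radial cutoff and solved globally. The range of
  \<open>proj M\<close> is invariant since the field takes values in it, and mass is still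
  conserved; the resulting a priori bound keeps the solution inside the ball where the cutoff is the
  identity.\<close>

theorem galerkin_solution:
  assumes c0: "proj M c0 = c0"
  shows "\<exists>c. c 0 = c0 \<and> (\<forall>t. proj M (c t) = c t \<and> (c has_vector_derivative galerkin M (c t)) (at t))"
proof -
  define R where "R = real (2 * M + 2) + tr (c0 * star c0)"
  have R: "0 < R" using tr_self_star_nonneg[of c0] by (simp add: R_def)
  define r where "r a = (R / max R (norm a)) *\<^sub>R a" for a :: wiener
  have nr: "norm (r a) \<le> R" for a
  proof -
    have "norm (r a) = R * (norm a / max R (norm a))"
      using R by (simp add: r_def)
    also have "\<dots> \<le> R * 1"
      using R by (intro mult_left_mono) auto
    finally show ?thesis by simp
  qed
  define L where "L = (real M + 3 * R\<^sup>2) * 2"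
  have "0 < L" using R by (simp add: L_def add_nonneg_pos)
  moreover have "norm (galerkin M (r a) - galerkin M (r b)) \<le> L * norm (a - b)" for a b
  proof -
    have "norm (galerkin M (r a) - galerkin M (r b)) \<le> (real M + 3 * R\<^sup>2) * norm (r a - r b)"
      by (intro norm_galerkin_diff nr)
    also have "\<dots> \<le> (real M + 3 * R\<^sup>2) * (2 * norm (a - b))"
      unfolding r_def by (intro mult_left_mono radial_cutoff_lipschitz R) auto
    finally show ?thesis by (simp only: L_def mult.assoc)
  qed
  ultimately obtain c where c: "c 0 = c0"
    and der: "\<And>t. (c has_vector_derivative galerkin M (r (c t))) (at t)"
    using picard[of L "\<lambda>a. galerkin M (r a)" c0] by auto
  have pc: "proj M (c t) = c t" for t
  proof -
    have "((\<lambda>t. c t - proj M (c t)) has_vector_derivative 0) (at t)" for t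
      using has_vector_derivative_diff[OF der bounded_linear.has_vector_derivative[OF bounded_linear_proj der], of M t]
      by (simp add: proj_galerkin)
    from constant_of_zero_derivative[OF this, of t] show ?thesis
      by (simp add: c c0)
  qed
  \<comment> \<open>The cut-off argument is a nonzero scalar multiple \<open>l\<close> of
    \<open>c t\<close>, so the mass identity at \<open>r (c t)\<close> gives \<open>l\<close> times
    the desired one.\<close>
  have "tr (galerkin M (r (c t)) * star (c t)) = 0" for t
  proof -
    define l where "l = R / max R (norm (c t))"
    have l: "l \<noteq> 0" using R by (simp add: l_def)
    have "proj M (r (c t)) = r (c t)"
      using pc[of t] linear_scale[OF bounded_linear.linear[OF bounded_linear_proj], of M l "c t"]
      by (simp add: r_def l_def)
    from tr_galerkin[OF this] have "l * tr (galerkin M (r (c t)) * star (c t)) = 0"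
      using linear_scale[OF bounded_linear.linear[OF bounded_linear_tr], of l]
      by (simp add: r_def[of "c t"] star_scaleR flip: l_def)
    then show ?thesis using l by simp
  qed
  then have "((\<lambda>t. tr (c t * star (c t))) has_vector_derivative 0) (at t)" for t
    using mass_derivative[OF der[of t]] by simp
  then have "tr (c t * star (c t)) = tr (c0 * star c0)" for t
    using constant_of_zero_derivative[of "\<lambda>t. tr (c t * star (c t))" t] c by simp
  then have "norm (c t) \<le> R" for t
    using norm_le_of_proj[OF pc, of t] by (simp add: R_def)
  then have "r (c t) = c t" for t
    using R by (simp add: r_def max_absorb1)
  then show ?thesis
    using c pc der by (intro exI[of _ c]) simp
qed

text \<open>Four times the usual Hamiltonian, with quadratic part weighted 1/2 and quartic part
  weighted 1/4, taken with the truncated |D|. In the defocusing case both terms are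
  nonnegative.\<close>

definition energy :: "nat \<Rightarrow> wiener \<Rightarrow> real" where
  "energy M a = 2 * tr (tabs M a * star a) + tr ((a * star a) * (a * star a))"

text \<open>Hamiltonian structure: the derivative of the energy is 4
  \<open>tr (G * star c')\<close>, where \<open>G\<close> is a quarter of the gradient and
  \<open>c' = - (J * G)\<close>. The pairing is \<i> times the real function |G|^2 and has no real
  mean.\<close>

theorem energy_conservation:
  assumes pc: "\<And>t. proj M (c t) = c t" and der: "\<And>t. (c has_vector_derivative galerkin M (c t)) (at t)"
  shows "energy M (c t) = energy M (c 0)"
proof (rule constant_of_zero_derivative)
  fix t
  define a c' where "a = c t" and "c' = galerkin M a"
  define G where "G = tabs M a + proj M (cubic a)"
  have c': "c' = - (J * G)" and proj_c': "proj M c' = c'"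
    by (simp_all add: c'_def galerkin_def G_def proj_galerkin[unfolded galerkin_def])
  have der_E: "((\<lambda>t. energy M (c t)) has_vector_derivative
      2 * tr (tabs M a * star c' + tabs M c' * star a)
      + tr ((a * star a) * (a * star c' + c' * star a) + (a * star c' + c' * star a) * (a * star a))) (at t)"
    unfolding energy_def a_def c'_def
    by (intro has_vector_derivative_add has_vector_derivative_mult_right bounded_linear.has_vector_derivative[OF bounded_linear_tr]
        has_vector_derivative_mult has_vector_derivative_star bounded_linear.has_vector_derivative[OF bounded_linear_tabs] der)
  have e1: "tr (tabs M c' * star a) = tr (tabs M a * star c')"
    unfolding tr_tabs[of M c' a]
    using tr_star[of "c' * star (tabs M a)"] by (simp add: star_mult mult.commute)
  have e2: "tr ((a * star a) * (a * star c' + c' * star a) + (a * star c' + c' * star a) * (a * star a))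
      = 4 * tr (proj M (cubic a) * star c')"
  proof -
    have "tr (a * star a * (c' * star a)) = tr (cubic a * star c')"
      using tr_star[of "a * star a * (c' * star a)"] by (simp add: cubic_def star_mult mult_ac)
    moreover have "tr (cubic a * star c') = tr (proj M (cubic a) * star c')"
      by (simp add: tr_proj proj_c')
    moreover have "a * star a * (a * star c') = cubic a * star c'"
      by (simp add: cubic_def mult_ac)
    moreover have "(a * star a) * (a * star c' + c' * star a) + (a * star c' + c' * star a) * (a * star a)
        = a * star a * (a * star c') + a * star a * (c' * star a)
          + (a * star a * (a * star c') + a * star a * (c' * star a))"
      by (simp add: algebra_simps)
    ultimately show ?thesis
      by (simp only: tr_add)
  qed
  have "tr (G * star c') = 0"
  proof -
    have "G * star c' = J * (G * star G)"
      by (simp add: c' star_minus star_mult star_J mult_ac)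
    then show ?thesis
      by (simp add: tr_J_self_adjoint star_mult mult.commute)
  qed
  then have e3: "tr (tabs M a * star c') + tr (proj M (cubic a) * star c') = 0"
    by (simp add: G_def distrib_right tr_add)
  have "2 * tr (tabs M a * star c' + tabs M c' * star a)
      + tr ((a * star a) * (a * star c' + c' * star a) + (a * star c' + c' * star a) * (a * star a)) = 0"
    unfolding e2 tr_add[of "tabs M a * star c'"] e1 using e3 by simp
  then show "((\<lambda>t. energy M (c t)) has_vector_derivative 0) (at t)"
    using der_E by simp
qed

section \<open>Gronwall estimates\<close>

text \<open>The oscillating factors of the linear flow are removed by conjugation, so only the
  source term \<open>g\<close> contributes.\<close>

lemma duhamel:
  fixes x :: "int \<Rightarrow> real \<Rightarrow> complex"
  assumes F: "finite F" and t: "0 \<le> t" and w: "\<And>k. 0 \<le> w k"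
    and der: "\<And>k s. k \<in> F \<Longrightarrow> s \<in> {0..t} \<Longrightarrow>
      (x k has_vector_derivative \<i> * of_real (l k) * x k s + g k s) (at s)"
    and H: "\<And>s. s \<in> {0..t} \<Longrightarrow> (H has_vector_derivative h s) (at s)"
    and g: "\<And>s. s \<in> {0..t} \<Longrightarrow> (\<Sum>k\<in>F. w k * cmod (g k s)) \<le> h s"
  shows "(\<Sum>k\<in>F. w k * cmod (x k t)) \<le> (\<Sum>k\<in>F. w k * cmod (x k 0)) + (H t - H 0)"
proof -
  \<comment> \<open>The weighted sum of moduli need not be differentiable. Packing the conjugated
    coefficients into one \<open>wiener\<close>-valued curve replaces it by the mean value
    inequality for vector-valued functions.\<close>
  define z where "z s = (\<Sum>k\<in>F. monomial k (of_real (w k) * (cis (- l k * s) * x k s)))" for s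
  define z' where "z' s = (\<Sum>k\<in>F. monomial k (of_real (w k) * (cis (- l k * s) * g k s)))" for s
  have "(z has_vector_derivative z' s) (at s)" if s: "s \<in> {0..t}" for s
    unfolding z_def z'_def
  proof (intro has_vector_derivative_sum bounded_linear.has_vector_derivative[OF bounded_linear_monomial] has_vector_derivative_mult_right)
    fix k assume k: "k \<in> F"
    have "((\<lambda>s. cis (- l k * s) * x k s) has_vector_derivative
        cis (- l k * s) * (\<i> * of_real (l k) * x k s + g k s) + \<i> * of_real (- l k) * cis (- l k * s) * x k s) (at s)"
      by (intro has_vector_derivative_mult cis_has_vector_derivative der k s)
    then show "((\<lambda>s. cis (- l k * s) * x k s) has_vector_derivative cis (- l k * s) * g k s) (at s)"
      by (simp add: algebra_simps)
  qed
  moreover have "norm (z' s) \<le> h s" if "s \<in> {0..t}" for s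
    unfolding z'_def
    by (rule order_trans[OF norm_sum]) (use g[OF that] w in \<open>simp add: norm_mult\<close>)
  ultimately have "norm (z t - z 0) \<le> H t - H 0"
    using H t by (intro norm_le_of_derivative_le) auto
  moreover have "norm (z 0) \<le> (\<Sum>k\<in>F. w k * cmod (x k 0))"
    unfolding z_def by (rule order_trans[OF norm_sum]) (simp add: norm_mult w)
  moreover have "(\<Sum>k\<in>F. w k * cmod (x k t)) \<le> norm (z t)"
  proof -
    have "coeff (z t) k = of_real (w k) * (cis (- l k * t) * x k t)" if "k \<in> F" for k
    proof -
      have "coeff (z t) k = (\<Sum>j\<in>F. coeff (monomial j (of_real (w j) * (cis (- l j * t) * x j t))) k)"
        unfolding z_def by (rule linear_sum[OF bounded_linear.linear[OF bounded_linear_coeff]])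
      also have "\<dots> = of_real (w k) * (cis (- l k * t) * x k t)"
        using F that by (simp add: coeff_monomial)
      finally show ?thesis .
    qed
    then have "(\<Sum>k\<in>F. w k * cmod (x k t)) = (\<Sum>k\<in>F. cmod (coeff (z t) k))"
      by (simp add: norm_mult w)
    then show ?thesis using sum_coeff_le_norm[OF F] by simp
  qed
  ultimately show ?thesis
    using norm_triangle_ineq[of "z t - z 0" "z 0"] by simp
qed

lemma nonincreasing_on:
  fixes f :: "real \<Rightarrow> real"
  assumes "0 \<le> t" "\<And>s. s \<in> {0..t} \<Longrightarrow> (f has_real_derivative f' s) (at s)" "\<And>s. s \<in> {0..t} \<Longrightarrow> f' s \<le> 0"
  shows "f t \<le> f 0"
  using assms by (intro DERIV_nonpos_imp_nonincreasing[of 0 t f]) (auto intro!: exI)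

text \<open>The premise is the integral inequality, with \<open>H\<close> as an arbitrary
  antiderivative of the right-hand side vanishing at 0. Thus \<open>y\<close> need only be
  continuous, as is the case for a norm along a curve.\<close>

lemma gronwall:
  fixes y :: "real \<Rightarrow> real"
  assumes cont: "continuous_on UNIV y" and "0 \<le> B" "0 \<le> r"
    and le: "\<And>H s. H 0 = 0 \<Longrightarrow> (\<And>s. (H has_vector_derivative B * y s + r) (at s)) \<Longrightarrow> s \<in> {0..t} \<Longrightarrow> y s \<le> y0 + H s"
    and t: "0 \<le> t"
  shows "y t \<le> (y0 + r * t) * exp (B * t)"
proof -
  have "continuous_on UNIV (\<lambda>s. B * y s + r)"
    by (intro continuous_intros cont)
  then obtain H where H: "H 0 = 0" "\<And>s. (H has_vector_derivative B * y s + r) (at s)"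
    using antiderivative_exists by blast
  note yH = le[OF H]
  have "(y0 + H t) * exp (- (B * t)) - r * t \<le> (y0 + H 0) * exp (- (B * 0)) - r * 0"
  proof (rule nonincreasing_on[OF t])
    fix s assume s: "s \<in> {0..t}"
    show "((\<lambda>t. (y0 + H t) * exp (- (B * t)) - r * t) has_real_derivative
        (B * y s + r) * exp (- (B * s)) + (y0 + H s) * (exp (- (B * s)) * - B) - r) (at s)"
      using H(2)[of s] by (auto intro!: derivative_eq_intros simp: has_real_derivative_iff_has_vector_derivative[symmetric])
    have "(B * y s + r) * exp (- (B * s)) + (y0 + H s) * (exp (- (B * s)) * - B) - r
        = B * exp (- (B * s)) * (y s - (y0 + H s)) + r * (exp (- (B * s)) - 1)"
      by (simp add: algebra_simps)
    also have "\<dots> \<le> 0 + 0"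
      using yH[OF s] assms s by (intro add_mono) (auto simp: mult_nonneg_nonpos)
    finally show "(B * y s + r) * exp (- (B * s)) + (y0 + H s) * (exp (- (B * s)) * - B) - r \<le> 0" by simp
  qed
  then have "(y0 + H t) * exp (- (B * t)) \<le> y0 + r * t"
    by (simp add: H)
  then have "y0 + H t \<le> (y0 + r * t) * exp (B * t)"
    by (simp add: exp_minus field_simps)
  then show ?thesis
    using yH[of t] t by simp
qed

text \<open>An Osgood argument: a majorant with growth at most Z (1 + ln Z) still exists for all
  times, because ln (1 + ln Z) then grows at most linearly. The price is a double
  exponential.\<close>

lemma log_gronwall:
  fixes y :: "real \<Rightarrow> real"
  assumes cont: "continuous_on UNIV y" and C: "0 \<le> C" and y: "\<And>s. 0 \<le> y s" and y0: "0 \<le> y0"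
    and le: "\<And>H s. H 0 = 0 \<Longrightarrow> (\<And>s. (H has_vector_derivative C * (1 + ln (1 + y s)) * (1 + y s)) (at s)) \<Longrightarrow>
      s \<in> {0..t} \<Longrightarrow> y s \<le> y0 + H s"
    and t: "0 \<le> t"
  shows "ln (1 + y t) \<le> (1 + ln (1 + y0)) * exp (C * t)"
proof -
  have pos: "1 + y s > 0" for s using y[of s] by simp
  have "continuous_on UNIV (\<lambda>s. C * (1 + ln (1 + y s)) * (1 + y s))"
    using pos by (intro continuous_intros cont) (auto simp: less_imp_neq[symmetric])
  then obtain H where H: "H 0 = 0" "\<And>s. (H has_vector_derivative C * (1 + ln (1 + y s)) * (1 + y s)) (at s)"
    using antiderivative_exists by blast
  note yH = le[OF H]
  define Z where "Z s = 1 + (y0 + H s)" for s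
  have Z: "1 + y s \<le> Z s" "1 \<le> Z s" if "s \<in> {0..t}" for s
    using yH[OF that] y[of s] by (auto simp: Z_def)
  have "ln (1 + ln (Z t)) - C * t \<le> ln (1 + ln (Z 0)) - C * 0"
  proof (rule nonincreasing_on[OF t])
    fix s assume s: "s \<in> {0..t}"
    have lnZ: "0 \<le> ln (Z s)" using Z(2)[OF s] by simp
    have dZ: "(Z has_real_derivative C * (1 + ln (1 + y s)) * (1 + y s)) (at s)"
      unfolding Z_def using H(2)[of s]
      by (auto intro!: derivative_eq_intros simp: has_real_derivative_iff_has_vector_derivative[symmetric])
    show "((\<lambda>t. ln (1 + ln (Z t)) - C * t) has_real_derivative
        C * (1 + ln (1 + y s)) * (1 + y s) / Z s / (1 + ln (Z s)) - C) (at s)"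
      using Z[OF s] lnZ by (auto intro!: derivative_eq_intros dZ add_pos_nonneg)
    have "(1 + ln (1 + y s)) * (1 + y s) \<le> (1 + ln (Z s)) * Z s"
      using Z[OF s] y[of s] by (intro mult_mono) auto
    then have "C * ((1 + ln (1 + y s)) * (1 + y s)) \<le> C * ((1 + ln (Z s)) * Z s)"
      using C by (rule mult_left_mono)
    moreover have D: "0 < Z s * (1 + ln (Z s))"
      using Z(2)[OF s] lnZ by (intro mult_pos_pos) linarith+
    ultimately show "C * (1 + ln (1 + y s)) * (1 + y s) / Z s / (1 + ln (Z s)) - C \<le> 0"
      using D by (simp add: pos_divide_le_eq mult_ac)
  qed
  then have "ln (1 + ln (Z t)) \<le> ln (1 + ln (1 + y0)) + C * t"
    by (simp add: Z_def H)
  then have "exp (ln (1 + ln (Z t))) \<le> exp (ln (1 + ln (1 + y0))) * exp (C * t)"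
    by (simp flip: exp_add)
  moreover have "0 \<le> ln (Z t)" "0 \<le> ln (1 + y0)"
    using Z(2)[of t] t y0 by auto
  ultimately have "1 + ln (Z t) \<le> (1 + ln (1 + y0)) * exp (C * t)"
    by (simp add: add_pos_nonneg)
  moreover have "ln (1 + y t) \<le> ln (Z t)"
    using Z(1)[of t] pos[of t] t by simp
  ultimately show ?thesis by simp
qed

lemma sum_inverse_le_ln: "(\<Sum>k\<in>{- int R..int R}. 1 / (1 + \<bar>real_of_int k\<bar>)) \<le> 2 * (1 + ln (1 + real R))"
proof -
  have "(\<Sum>k\<in>{- int R..int R}. 1 / (1 + \<bar>real_of_int k\<bar>)) \<le> 2 * harm (Suc R)"
  proof (induction R)
    case (Suc R)
    have "{- int (Suc R)..int (Suc R)} = insert (int (Suc R)) (insert (- int (Suc R)) {- int R..int R})"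
      by auto
    then have "(\<Sum>k\<in>{- int (Suc R)..int (Suc R)}. 1 / (1 + \<bar>real_of_int k\<bar>))
        = 2 / (2 + real R) + (\<Sum>k\<in>{- int R..int R}. 1 / (1 + \<bar>real_of_int k\<bar>))"
      by simp
    also have "\<dots> \<le> 2 * harm (Suc (Suc R))"
      using Suc.IH unfolding harm_Suc[of "Suc R"] by (simp add: inverse_eq_divide add_ac)
    finally show ?case .
  qed (simp add: harm_def)
  also have "harm (Suc R) \<le> ln (real (Suc R)) + (1 :: real)"
    using decseqD[OF decseq_harm_diff_ln, of 0 R] by (simp add: harm_expand)
  finally show ?thesis by (simp add: add.commute)
qed

lemma pw_nonneg [simp]: "0 \<le> pw m k"
  using pw_pos[of m k] by simp

text \<open>A Brezis--Gallouet inequality: split the sum at \<open>\<bar>k\<bar> \<approx> y\<close>.\<close>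

lemma log_inequality:
  assumes y: "wle (pw 1) a y" and Q: "\<And>F. finite F \<Longrightarrow> (\<Sum>k\<in>F. pw 1 k * (cmod (coeff a k))\<^sup>2) \<le> Q"
  shows "(norm a)\<^sup>2 \<le> (4 * Q + 2) * (1 + ln (1 + y))"
proof -
  have y0: "0 \<le> y" using y by (rule wle_nonneg)
  have Q0: "0 \<le> Q" using Q[of "{}"] by simp
  define R where "R = nat \<lfloor>y\<rfloor>"
  have R: "real R \<le> y" "y < real R + 1" using y0 by (auto simp: R_def)
  let ?G = "{- int R..int R}"
  define p where "p = (\<Sum>k\<in>?G. cmod (coeff a k))"
  have "p = (\<Sum>k\<in>?G. (1 / sqrt (pw 1 k)) * (sqrt (pw 1 k) * cmod (coeff a k)))"
    unfolding p_def using pw_pos[of 1] by (intro sum.cong) (auto simp: less_imp_neq[symmetric])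
  then have "p\<^sup>2 \<le> (\<Sum>k\<in>?G. (1 / sqrt (pw 1 k))\<^sup>2) * (\<Sum>k\<in>?G. (sqrt (pw 1 k) * cmod (coeff a k))\<^sup>2)"
    by (simp only: Cauchy_Schwarz_ineq_sum)
  also have "\<dots> = (\<Sum>k\<in>?G. 1 / pw 1 k) * (\<Sum>k\<in>?G. pw 1 k * (cmod (coeff a k))\<^sup>2)"
    using pw_pos[of 1] by (simp add: power_divide power_mult_distrib less_imp_le)
  also have "\<dots> \<le> (2 * (1 + ln (1 + y))) * Q"
  proof (rule mult_mono)
    have "ln (1 + real R) \<le> ln (1 + y)"
      using R by simp
    then show "(\<Sum>k\<in>?G. 1 / pw 1 k) \<le> 2 * (1 + ln (1 + y))"
      using sum_inverse_le_ln[of R] by (simp add: pw_def)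
  qed (use Q y0 pw_pos[of 1] in \<open>auto intro!: sum_nonneg mult_nonneg_nonneg\<close>)
  finally have p2: "p\<^sup>2 \<le> 2 * Q * (1 + ln (1 + y))" by (simp add: mult_ac)
  have "norm a \<le> p + 1"
  proof (rule norm_leI)
    fix F :: "int set" assume F: "finite F"
    have "(\<Sum>k\<in>F. cmod (coeff a k)) = (\<Sum>k\<in>F \<inter> ?G. cmod (coeff a k)) + (\<Sum>k\<in>F - ?G. cmod (coeff a k))"
      using sum.Int_Diff[OF F, of "\<lambda>k. cmod (coeff a k)" ?G] by simp
    also have "(\<Sum>k\<in>F \<inter> ?G. cmod (coeff a k)) \<le> p"
      unfolding p_def by (rule sum_mono2) auto
    also have "(\<Sum>k\<in>F - ?G. cmod (coeff a k)) \<le> 1"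
    proof -
      have "(real R + 1) * (\<Sum>k\<in>F - ?G. cmod (coeff a k)) \<le> (\<Sum>k\<in>F - ?G. pw 1 k * cmod (coeff a k))"
        unfolding sum_distrib_left
      proof (intro sum_mono mult_right_mono)
        fix k assume "k \<in> F - ?G"
        then have "int R \<le> \<bar>k\<bar>" by auto
        then show "real R + 1 \<le> pw 1 k" by (simp add: pw_def)
      qed auto
      also have "\<dots> \<le> y" using wleD[OF y, of "F - ?G"] F by simp
      also have "\<dots> \<le> (real R + 1) * 1" using R by simp
      finally show ?thesis by (rule mult_left_le_imp_le) auto
    qed
    finally show "(\<Sum>k\<in>F. cmod (coeff a k)) \<le> p + 1" by simp
  qed
  then have "(norm a)\<^sup>2 \<le> (p + 1)\<^sup>2" by (rule power_mono) simp
  also have "\<dots> \<le> 2 * p\<^sup>2 + 2"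
    using zero_le_power2[of "p - 1"] by (simp add: power2_eq_square algebra_simps)
  also have "\<dots> \<le> 2 * (2 * Q * (1 + ln (1 + y))) + 2 * (1 + ln (1 + y))"
    using p2 y0 by (intro add_mono) auto
  also have "\<dots> = (4 * Q + 2) * (1 + ln (1 + y))" by (simp add: algebra_simps)
  finally show ?thesis .
qed

section \<open>Bounds uniform in the Galerkin cutoff\<close>

lemma coeff_eq_0_of_proj:
  assumes "proj M a = a" "k \<notin> {- int M..int M}"
  shows "coeff a k = 0"
proof -
  have "coeff a k = coeff (proj M a) k" using assms by simp
  also have "\<dots> = 0" using assms(2) by (auto simp: coeff_proj)
  finally show ?thesis .
qed

lemma proj_eqI:
  assumes "\<And>k. k \<notin> {- int M..int M} \<Longrightarrow> coeff a k = 0"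
  shows "proj M a = a"
proof (rule wiener_eqI)
  fix k show "coeff (proj M a) k = coeff a k"
    using assms[of k] by (cases "k \<in> {- int M..int M}") (auto simp: coeff_proj)
qed

lemma proj_mono: "proj M a = a \<Longrightarrow> M \<le> M' \<Longrightarrow> proj M' a = a"
  by (rule proj_eqI) (auto intro!: coeff_eq_0_of_proj[of M])

lemma wle_of_proj:
  assumes "proj M a = a" "\<And>k. 0 \<le> w k"
  shows "wle w a (\<Sum>k\<in>{- int M..int M}. w k * cmod (coeff a k))"
proof (rule wleI)
  fix F :: "int set" assume "finite F"
  then have "(\<Sum>k\<in>F. w k * cmod (coeff a k)) = (\<Sum>k\<in>F \<inter> {- int M..int M}. w k * cmod (coeff a k))"
    by (intro sum.mono_neutral_cong_right) (auto simp: coeff_eq_0_of_proj[OF assms(1)])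
  also have "\<dots> \<le> (\<Sum>k\<in>{- int M..int M}. w k * cmod (coeff a k))"
    by (rule sum_mono2) (auto simp: assms)
  finally show "(\<Sum>k\<in>F. w k * cmod (coeff a k)) \<le> (\<Sum>k\<in>{- int M..int M}. w k * cmod (coeff a k))" .
qed

lemma wle_imp_norm_pw: "wle (pw m) a B \<Longrightarrow> norm a \<le> B"
proof (rule wle_imp_norm, unfold wle_def[of "\<lambda>_. 1"], intro allI impI)
  fix F :: "int set"
  assume a: "wle (pw m) a B" and F: "finite F"
  have "(\<Sum>k\<in>F. 1 * cmod (coeff a k)) \<le> (\<Sum>k\<in>F. pw m k * cmod (coeff a k))"
    by (intro sum_mono mult_right_mono pw_ge_1) auto
  then show "(\<Sum>k\<in>F. 1 * cmod (coeff a k)) \<le> B"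
    using wleD[OF a F] by simp
qed

text \<open>The equation with \<open>\<mu> = -1\<close> is the time reversal of the one with \<open>\<mu> = 1\<close>.\<close>

lemma galerkin_coeff_derivative:
  assumes "(c has_vector_derivative \<mu> *\<^sub>R galerkin M (c t)) (at t)"
  shows "((\<lambda>t. coeff (c t) k) has_vector_derivative
      \<i> * of_real (- \<mu> * (if \<bar>k\<bar> \<le> int M then of_int \<bar>k\<bar> else 0)) * coeff (c t) k
      + (- \<i> * of_real \<mu> * coeff (proj M (cubic (c t))) k)) (at t)"
proof -
  have "coeff (\<mu> *\<^sub>R galerkin M a) k =
      \<i> * of_real (- \<mu> * (if \<bar>k\<bar> \<le> int M then of_int \<bar>k\<bar> else 0)) * coeff a k
      + (- \<i> * of_real \<mu> * coeff (proj M (cubic a)) k)" for a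
    by (auto simp: galerkin_def coeff_J_mult coeff_tabs algebra_simps simp del: of_int_abs)
  then show ?thesis
    using bounded_linear.has_vector_derivative[OF bounded_linear_coeff assms, of k] by simp
qed

lemma continuous_on_weighted_sum:
  assumes "continuous_on S c"
  shows "continuous_on S (\<lambda>t. \<Sum>k\<in>F. w k * cmod (coeff (c t) k))"
  by (intro continuous_intros bounded_linear.continuous_on[OF bounded_linear_coeff] assms)

lemma continuous_on_of_derivative:
  "(\<And>t. (c has_vector_derivative c' t) (at t)) \<Longrightarrow> continuous_on S c"
  by (auto intro!: continuous_at_imp_continuous_on dest: has_vector_derivative_continuous)

text \<open>Apart from time and \<open>m\<close>, the bound sees only \<open>Q\<close> and the
  initial weighted norms, never the cutoff \<open>M\<close>. The log estimate at
  \<open>m = 1\<close> bounds the l^1 norm on the whole time interval; that bound then serves as a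
  constant coefficient for every \<open>m\<close>.\<close>

lemma galerkin_bound_forward:
  assumes mu: "\<bar>\<mu>\<bar> = 1" and der: "\<And>t. (c has_vector_derivative \<mu> *\<^sub>R galerkin M (c t)) (at t)"
    and pc: "\<And>t. proj M (c t) = c t"
    and Q: "\<And>t F. finite F \<Longrightarrow> (\<Sum>k\<in>F. pw 1 k * (cmod (coeff (c t) k))\<^sup>2) \<le> Q"
    and Y: "\<And>m. wle (pw m) (c 0) (Y m)" and t: "0 \<le> t"
  shows "wle (pw m) (c t)
    (Y m * exp (3 * 4 ^ m * (exp ((1 + ln (1 + Y 1)) * exp (12 * (4 * Q + 2) * t)))\<^sup>2 * t))"
proof -
  define F where "F = {- int M..int M}"
  \<comment> \<open>Since \<open>c s\<close> has no modes beyond \<open>M\<close>, this finite sum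
    is the whole weighted norm, and it is visibly continuous in time.\<close>
  define y where "y m s = (\<Sum>k\<in>F. pw m k * cmod (coeff (c s) k))" for m s
  have cont: "continuous_on UNIV (y m)" for m
    unfolding y_def by (intro continuous_on_weighted_sum) (rule continuous_on_of_derivative[OF der])
  have wle_y: "wle (pw m) (c s) (y m s)" for m s
    unfolding y_def F_def by (rule wle_of_proj[OF pc]) simp
  have y_nonneg: "0 \<le> y m s" for m s using wle_y by (rule wle_nonneg)
  have y_0: "y m 0 \<le> Y m" for m
    unfolding y_def using Y by (rule wleD) (simp add: F_def)
  have Q0: "0 \<le> Q" using Q[of "{}"] by simp
  have D: "y m s \<le> Y m + H s"
    if "H 0 = 0" "\<And>r. (H has_vector_derivative h r) (at r)" "0 \<le> s"
      "\<And>r. r \<in> {0..s} \<Longrightarrow> 3 * 4 ^ m * (norm (c r))\<^sup>2 * y m r \<le> h r" for m s H h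
  proof -
    have "y m s \<le> y m 0 + (H s - H 0)"
      unfolding y_def
    proof (rule duhamel[OF _ that(3) _ galerkin_coeff_derivative[OF der] that(2)])
      fix r assume r: "r \<in> {0..s}"
      have "(\<Sum>k\<in>F. pw m k * cmod (- \<i> * of_real \<mu> * coeff (proj M (cubic (c r))) k))
          \<le> (\<Sum>k\<in>F. pw m k * cmod (coeff (cubic (c r)) k))"
        by (intro sum_mono mult_left_mono) (auto simp: norm_mult coeff_proj mu)
      also have "\<dots> \<le> 3 * 4 ^ m * (norm (c r))\<^sup>2 * y m r"
        by (rule wleD[OF wle_pw_cubic[OF wle_y]]) (simp add: F_def)
      finally show "(\<Sum>k\<in>F. pw m k * cmod (- \<i> * of_real \<mu> * coeff (proj M (cubic (c r))) k)) \<le> h r"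
        using that(4)[OF r] by simp
    qed (auto simp: F_def)
    then show ?thesis using that(1) y_0[of m] by simp
  qed
  \<comment> \<open>The 12 is the constant \<open>3 * 4 ^ m\<close> of \<open>wle_pw_cubic\<close>
    at \<open>m = 1\<close>; the other factor comes from \<open>log_inequality\<close>.\<close>
  define C where "C = 12 * (4 * Q + 2)"
  have C: "0 \<le> C" using Q0 by (simp add: C_def)
  define b where "b s = exp ((1 + ln (1 + Y 1)) * exp (C * s))" for s
  have Y1: "0 \<le> Y 1" using Y by (rule wle_nonneg)
  have log_ineq: "(norm (c s))\<^sup>2 \<le> (4 * Q + 2) * (1 + ln (1 + y 1 s))" for s
    by (rule log_inequality[OF wle_y Q])
  have y1: "y 1 s \<le> b s" if s: "0 \<le> s" for s
  proof -
    have "ln (1 + y 1 s) \<le> (1 + ln (1 + Y 1)) * exp (C * s)"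
    proof (rule log_gronwall[OF cont C y_nonneg Y1 _ s])
      fix H r assume H: "H 0 = 0" "\<And>s. (H has_vector_derivative C * (1 + ln (1 + y 1 s)) * (1 + y 1 s)) (at s)"
        and r: "r \<in> {0..s}"
      show "y 1 r \<le> Y 1 + H r"
      proof (rule D[OF H])
        fix q
        have "3 * 4 ^ 1 * (norm (c q))\<^sup>2 * y 1 q \<le> 12 * ((4 * Q + 2) * (1 + ln (1 + y 1 q))) * (1 + y 1 q)"
          using log_ineq[of q] y_nonneg[of 1 q] Q0 by (intro mult_mono) auto
        then show "3 * 4 ^ 1 * (norm (c q))\<^sup>2 * y 1 q \<le> C * (1 + ln (1 + y 1 q)) * (1 + y 1 q)"
          by (simp only: C_def mult.assoc)
      qed (use r in auto)
    qed
    then have "exp (ln (1 + y 1 s)) \<le> b s"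
      by (simp add: b_def)
    then show ?thesis using y_nonneg[of 1 s] by (simp add: add_pos_nonneg)
  qed
  have b_mono: "b r \<le> b s" if "r \<le> s" for r s
    unfolding b_def using that C Y1 by (auto intro!: mult_left_mono)
  have norm_b: "norm (c s) \<le> b t" if "s \<in> {0..t}" for s
    using wle_imp_norm_pw[OF wle_y, of s 1] y1[of s] b_mono[of s t] that by auto
  have "y m t \<le> (Y m + 0 * t) * exp (3 * 4 ^ m * (b t)\<^sup>2 * t)"
  proof (rule gronwall[OF cont _ _ _ t])
    fix H s assume H: "H 0 = 0" "\<And>s. (H has_vector_derivative 3 * 4 ^ m * (b t)\<^sup>2 * y m s + 0) (at s)"
      and s: "s \<in> {0..t}"
    show "y m s \<le> Y m + H s"
    proof (rule D[OF H])
      fix r assume "r \<in> {0..s}"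
      then show "3 * 4 ^ m * (norm (c r))\<^sup>2 * y m r \<le> 3 * 4 ^ m * (b t)\<^sup>2 * y m r + 0"
        using norm_b[of r] s y_nonneg[of m r] by (auto intro!: mult_mono power_mono)
    qed (use s in auto)
  qed auto
  then show ?thesis
    using wle_mono[OF wle_y] by (simp add: b_def C_def)
qed

text \<open>The nonnegative symbol is the square of the multiplier \<open>q\<close>, the truncated
  root of |k|, which turns the pairing into a squared L^2 norm.\<close>

lemma tr_tabs_self:
  "tr (tabs M a * star a) \<ge> 0" "finite F \<Longrightarrow> proj M a = a \<Longrightarrow> (\<Sum>k\<in>F. \<bar>of_int k\<bar> * (cmod (coeff a k))\<^sup>2) \<le> tr (tabs M a * star a)"
proof -
  define q where "q k = (if \<bar>k\<bar> \<le> int M then sqrt \<bar>of_int k\<bar> else 0)" for k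
  have q: "cmod (of_real (q k)) \<le> sqrt M" for k
    by (auto simp: q_def)
  define b where "b = fmult (\<lambda>k. of_real (q k)) a"
  have cb: "coeff b k = of_real (q k) * coeff a k" for k
    unfolding b_def by (rule coeff_fmult[OF q])
  have "tabs M a = fmult (\<lambda>k. of_real (q k)) b"
  proof (rule wiener_eqI)
    fix k
    have "coeff (fmult (\<lambda>k. of_real (q k)) b) k = of_real (q k * q k) * coeff a k"
      by (simp add: coeff_fmult[OF q] cb)
    then show "coeff (tabs M a) k = coeff (fmult (\<lambda>k. of_real (q k)) b) k"
      by (simp add: coeff_tabs q_def abs_if del: of_real_mult)
  qed
  then have eq: "tr (tabs M a * star a) = tr (b * star b)"
    by (simp add: tr_fmult_star[OF q] b_def)
  show "tr (tabs M a * star a) \<ge> 0"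
    unfolding eq by (rule tr_self_star_nonneg)
  assume F: "finite F" and pa: "proj M a = a"
  have "\<bar>of_int k\<bar> * (cmod (coeff a k))\<^sup>2 = (cmod (coeff b k))\<^sup>2" for k
    using coeff_eq_0_of_proj[OF pa, of k]
    by (cases "k \<in> {- int M..int M}") (auto simp: cb q_def norm_mult power_mult_distrib)
  then show "(\<Sum>k\<in>F. \<bar>of_int k\<bar> * (cmod (coeff a k))\<^sup>2) \<le> tr (tabs M a * star a)"
    unfolding eq using sum_coeff_squared_le[OF F, of b] by simp
qed

text \<open>The bound \<open>B\<close> is chosen before \<open>M\<close>. This is possible because
  the datum already lies below \<open>M0\<close>: its initial mass, energy and weighted norms are
  the same for every larger cutoff.\<close>

theorem galerkin_uniform_bound:
  assumes c0: "proj M0 c0 = c0"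
  shows "\<exists>B. \<forall>M\<ge>M0. \<forall>c. c 0 = c0 \<longrightarrow>
    (\<forall>t. proj M (c t) = c t \<and> (c has_vector_derivative galerkin M (c t)) (at t)) \<longrightarrow>
    (\<forall>m T t. \<bar>t\<bar> \<le> T \<longrightarrow> wle (pw m) (c t) (B m T))"
proof -
  \<comment> \<open>The weight 1 + |k| splits into mass plus the quadratic form of |D|; the latter
    is at most half the energy since the quartic term is nonnegative.\<close>
  define Q where "Q = tr (c0 * star c0) + energy M0 c0 / 2"
  define Y where "Y m = (\<Sum>k\<in>{- int M0..int M0}. pw m k * cmod (coeff c0 k))" for m
  have Y: "wle (pw m) c0 (Y m)" for m
    unfolding Y_def by (rule wle_of_proj[OF c0]) simp
  have Y_nonneg: "0 \<le> Y m" for m using Y by (rule wle_nonneg)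
  define b where "b T = exp ((1 + ln (1 + Y 1)) * exp (12 * (4 * Q + 2) * T))" for T
  define B where "B m T = Y m * exp (3 * 4 ^ m * (b T)\<^sup>2 * T)" for m T
  show ?thesis
  proof (intro exI[of _ B] allI impI)
    fix M c m and T t :: real
    assume M: "M0 \<le> M" and c: "c 0 = c0" and t: "\<bar>t\<bar> \<le> T"
      and sol: "\<forall>t. proj M (c t) = c t \<and> (c has_vector_derivative galerkin M (c t)) (at t)"
    from sol have pc: "\<And>t. proj M (c t) = c t" and der: "\<And>t. (c has_vector_derivative galerkin M (c t)) (at t)"
      by auto
    have Q: "(\<Sum>k\<in>F. pw 1 k * (cmod (coeff (c t) k))\<^sup>2) \<le> Q" if F: "finite F" for t F
    proof -
      have "((\<lambda>t. tr (c t * star (c t))) has_vector_derivative 0) (at t)" for t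
        using mass_derivative[OF der[of t]] tr_galerkin[OF pc[of t]] by simp
      then have mass: "tr (c t * star (c t)) = tr (c0 * star c0)"
        using constant_of_zero_derivative[of "\<lambda>t. tr (c t * star (c t))" t] c by simp
      have "tabs M c0 = tabs M0 c0"
      proof (rule wiener_eqI)
        fix k show "coeff (tabs M c0) k = coeff (tabs M0 c0) k"
          using M coeff_eq_0_of_proj[OF c0, of k] by (cases "k \<in> {- int M0..int M0}") (auto simp: coeff_tabs)
      qed
      then have "energy M (c t) = energy M0 c0"
        using energy_conservation[OF pc der, of t] c by (simp add: energy_def)
      moreover have "0 \<le> tr ((c t * star (c t)) * (c t * star (c t)))"
        using tr_self_star_nonneg[of "c t * star (c t)"] by (simp add: star_mult mult.commute)
      ultimately have en: "tr (tabs M (c t) * star (c t)) \<le> energy M0 c0 / 2"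
        by (simp add: energy_def)
      have "(\<Sum>k\<in>F. pw 1 k * (cmod (coeff (c t) k))\<^sup>2)
          = (\<Sum>k\<in>F. (cmod (coeff (c t) k))\<^sup>2) + (\<Sum>k\<in>F. \<bar>of_int k\<bar> * (cmod (coeff (c t) k))\<^sup>2)"
        by (simp add: pw_def sum.distrib[symmetric] algebra_simps)
      also have "\<dots> \<le> Q"
        unfolding Q_def mass[symmetric]
        by (intro add_mono sum_coeff_squared_le F order_trans[OF tr_tabs_self(2)[OF F pc] en])
      finally show ?thesis .
    qed
    then have Q0: "0 \<le> Q" using Q[of "{}"] by simp
    have "wle (pw m) (c t) (Y m * exp (3 * 4 ^ m * (b \<bar>t\<bar>)\<^sup>2 * \<bar>t\<bar>))"
    proof (cases "0 \<le> t")
      case True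
      then show ?thesis
        using galerkin_bound_forward[of 1 c M Q Y t m] der pc Q Y by (simp add: b_def c)
    next
      case False
      have "((\<lambda>s. c (- s)) has_vector_derivative (-1) *\<^sub>R galerkin M (c (- s))) (at s)" for s
        using vector_diff_chain_at[of uminus "-1" s c "galerkin M (c (- s))"] der[of "- s"]
        by (simp add: o_def has_vector_derivative_minus has_vector_derivative_id)
      then show ?thesis
        using galerkin_bound_forward[of "-1" "\<lambda>s. c (- s)" M Q Y "- t" m] False pc Q Y by (simp add: b_def c)
    qed
    then show "wle (pw m) (c t) (B m T)"
    proof (rule wle_mono)
      have "b \<bar>t\<bar> \<le> b T"
        unfolding b_def using t Q0 Y_nonneg[of 1] by (auto intro!: mult_left_mono)
      moreover have "0 \<le> b \<bar>t\<bar>" by (simp add: b_def)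
      ultimately show "Y m * exp (3 * 4 ^ m * (b \<bar>t\<bar>)\<^sup>2 * \<bar>t\<bar>) \<le> B m T"
        unfolding B_def using t Y_nonneg[of m] by (auto intro!: mult_left_mono mult_mono power_mono)
    qed
  qed
qed

section \<open>Global solutions of the half-wave equation\<close>

lemma wle_diff:
  assumes "wle w a A" "wle w b B" "\<And>k. 0 \<le> w k"
  shows "wle w (a - b) (A + B)"
proof (rule wleI)
  fix F :: "int set" assume F: "finite F"
  have "(\<Sum>k\<in>F. w k * cmod (coeff (a - b) k)) \<le> (\<Sum>k\<in>F. w k * cmod (coeff a k) + w k * cmod (coeff b k))"
    by (intro sum_mono) (simp add: assms(3) mult_left_mono norm_triangle_ineq4 flip: distrib_left)
  also have "\<dots> \<le> A + B"
    unfolding sum.distrib by (intro add_mono wleD assms F)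
  finally show "(\<Sum>k\<in>F. w k * cmod (coeff (a - b) k)) \<le> A + B" .
qed

lemma norm_proj_diff:
  assumes "wle (pw 1) a E"
  shows "norm (a - proj M a) \<le> E / (real M + 1)"
proof (rule norm_leI)
  fix F :: "int set" assume F: "finite F"
  have "(real M + 1) * (\<Sum>k\<in>F. cmod (coeff (a - proj M a) k)) \<le> (\<Sum>k\<in>F. pw 1 k * cmod (coeff a k))"
    unfolding sum_distrib_left
  proof (rule sum_mono)
    fix k show "(real M + 1) * (cmod (coeff (a - proj M a) k)) \<le> pw 1 k * cmod (coeff a k)"
    proof (cases "\<bar>k\<bar> \<le> int M")
      case False
      then have "real M \<le> \<bar>of_int k\<bar>" by linarith
      then have "real M + 1 \<le> pw 1 k" by (simp add: pw_def)
      then show ?thesis using False by (simp add: coeff_proj mult_right_mono)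
    qed (simp add: coeff_proj)
  qed
  also have "\<dots> \<le> E" by (rule wleD[OF assms F])
  finally show "(\<Sum>k\<in>F. cmod (coeff (a - proj M a) k)) \<le> E / (real M + 1)"
    by (simp add: field_simps)
qed

text \<open>Two errors drive the difference: the Lipschitz error of the cubic term and the modes of
  \<open>cubic (c s)\<close> lost beyond \<open>M\<close>. One power of the weight bounds the second
  by \<open>E / (real M + 1)\<close>, which makes the Galerkin sequence Cauchy with a rate.\<close>

lemma galerkin_difference_forward:
  assumes mu: "\<bar>\<mu>\<bar> = 1" and M: "M \<le> M'" and t: "0 \<le> t" and init: "c' 0 = c 0"
    and der: "\<And>t. (c has_vector_derivative \<mu> *\<^sub>R galerkin M (c t)) (at t)"
    and pc: "\<And>t. proj M (c t) = c t"
    and der': "\<And>t. (c' has_vector_derivative \<mu> *\<^sub>R galerkin M' (c' t)) (at t)"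
    and pc': "\<And>t. proj M' (c' t) = c' t"
    and R: "\<And>s. s \<in> {0..t} \<Longrightarrow> norm (c s) \<le> R" "\<And>s. s \<in> {0..t} \<Longrightarrow> norm (c' s) \<le> R"
    and E: "\<And>s. s \<in> {0..t} \<Longrightarrow> wle (pw 1) (cubic (c s)) E"
  shows "norm (c' t - c t) \<le> E / (real M + 1) * t * exp (3 * R\<^sup>2 * t)"
proof -
  define F where "F = {- int M'..int M'}"
  define d where "d t = c' t - c t" for t
  define l where "l k = - \<mu> * (if \<bar>k\<bar> \<le> int M' then of_int \<bar>k\<bar> else 0)" for k :: int
  define g where "g k s = - \<i> * of_real \<mu> * (coeff (proj M' (cubic (c' s))) k - coeff (proj M (cubic (c s))) k)" for k s
  have E0: "0 \<le> E" using E[of 0] t wle_nonneg by auto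
  have dd: "((\<lambda>t. coeff (d t) k) has_vector_derivative \<i> * of_real (l k) * coeff (d s) k + g k s) (at s)" for k s
  proof -
    define L where "L = - \<mu> * (if \<bar>k\<bar> \<le> int M then of_int \<bar>k\<bar> else 0)"
    have D: "((\<lambda>t. coeff (d t) k) has_vector_derivative
        (\<i> * of_real (l k) * coeff (c' s) k + (- \<i> * of_real \<mu> * coeff (proj M' (cubic (c' s))) k))
        - (\<i> * of_real L * coeff (c s) k + (- \<i> * of_real \<mu> * coeff (proj M (cubic (c s))) k))) (at s)"
      unfolding d_def coeff_simps l_def L_def
      by (intro has_vector_derivative_diff galerkin_coeff_derivative der der')
    \<comment> \<open>The coarser solution has no modes above \<open>M\<close>, so both equations
      may be given the symbol cut at \<open>M'\<close>. The linear parts then cancel without loss of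
      derivatives.\<close>
    have "of_real L * coeff (c s) k = of_real (l k) * coeff (c s) k"
      using coeff_eq_0_of_proj[OF pc, of k s] M by (cases "k \<in> {- int M..int M}") (auto simp: l_def L_def)
    then have L: "\<i> * of_real L * coeff (c s) k = \<i> * of_real (l k) * coeff (c s) k"
      by (simp only: mult.assoc)
    show ?thesis
      by (rule has_vector_derivative_eq_rhs[OF D], unfold L g_def d_def coeff_simps) (simp add: algebra_simps)
  qed
  have cont: "continuous_on UNIV (\<lambda>t. norm (d t))"
    unfolding d_def by (intro continuous_on_norm continuous_on_diff continuous_on_of_derivative[OF der]
        continuous_on_of_derivative[OF der'])
  have "norm (d t) \<le> (0 + E / (real M + 1) * t) * exp (3 * R\<^sup>2 * t)"
  proof (rule gronwall[OF cont _ _ _ t])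
    fix H s
    assume H: "H 0 = 0" "\<And>s. (H has_vector_derivative 3 * R\<^sup>2 * norm (d s) + E / (real M + 1)) (at s)"
      and s: "s \<in> {0..t}"
    have pd: "proj M' (d s) = d s"
      using pc[of s] pc'[of s] proj_mono[OF pc M]
      by (simp add: d_def linear_diff[OF bounded_linear.linear[OF bounded_linear_proj]])
    have "norm (d s) \<le> (\<Sum>k\<in>F. 1 * cmod (coeff (d s) k))"
      unfolding F_def by (rule wle_imp_norm[OF wle_of_proj[OF pd]]) simp
    also have "\<dots> \<le> (\<Sum>k\<in>F. 1 * cmod (coeff (d 0) k)) + (H s - H 0)"
    proof (rule duhamel[OF _ _ _ dd H(2)])
      fix r assume r: "r \<in> {0..s}"
      then have r': "r \<in> {0..t}" using s by auto
      let ?a = "cubic (c' r)" and ?b = "cubic (c r)"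
      have "(\<Sum>k\<in>F. 1 * cmod (g k r)) \<le> (\<Sum>k\<in>F. cmod (coeff (proj M' (?a - ?b)) k) + cmod (coeff (?b - proj M ?b) k))"
      proof (rule sum_mono)
        fix k assume "k \<in> F"
        then have "coeff (proj M' ?a) k - coeff (proj M ?b) k = coeff (proj M' (?a - ?b)) k + coeff (?b - proj M ?b) k"
          by (auto simp: F_def coeff_proj)
        then show "1 * cmod (g k r) \<le> cmod (coeff (proj M' (?a - ?b)) k) + cmod (coeff (?b - proj M ?b) k)"
          using norm_triangle_ineq by (simp add: g_def norm_mult mu del: coeff_simps)
      qed
      also have "\<dots> \<le> norm (proj M' (?a - ?b)) + norm (?b - proj M ?b)"
        unfolding sum.distrib by (intro add_mono sum_coeff_le_norm) (auto simp: F_def)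
      also have "\<dots> \<le> 3 * R\<^sup>2 * norm (d r) + E / (real M + 1)"
        unfolding d_def by (intro add_mono order_trans[OF norm_proj norm_cubic_diff] norm_proj_diff R E r')
      finally show "(\<Sum>k\<in>F. 1 * cmod (g k r)) \<le> 3 * R\<^sup>2 * norm (d r) + E / (real M + 1)" .
    qed (use s in \<open>auto simp: F_def\<close>)
    finally show "norm (d s) \<le> 0 + H s"
      by (simp add: d_def init H)
  qed (use E0 in auto)
  then show ?thesis by (simp add: d_def)
qed

section \<open>The operator |D| and the limit of the Galerkin solutions\<close>

definition absD :: "wiener \<Rightarrow> wiener" where "absD = fmult (\<lambda>k. of_int \<bar>k\<bar>)"

lemma coeff_absD:
  assumes "wle (pw 1) a B"
  shows "coeff (absD a) k = of_int \<bar>k\<bar> * coeff a k"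
  unfolding absD_def
proof (rule coeff_fmult_summable, rule summable_on_comparison_test[OF wle_summable[OF assms]])
  fix k show "cmod (of_int \<bar>k\<bar> * coeff a k) \<le> pw 1 k * cmod (coeff a k)"
    by (simp add: norm_mult pw_def mult_right_mono)
qed auto

text \<open>Interpolation by |k| \<le> r + (1 + |k|)^2 / r. The unbounded operator becomes
  continuous on sets bounded in the second weight, and \<open>r\<close> remains free to be
  optimised.\<close>

lemma norm_absD_diff:
  assumes a: "wle (pw 2) a B" and b: "wle (pw 2) b B" and r: "0 < r"
  shows "norm (absD a - absD b) \<le> r * norm (a - b) + 2 * B / r"
proof -
  have pw12: "pw 1 k \<le> pw 2 k" for k
    unfolding pw_def by (rule power_increasing) auto
  have w1: "wle (pw 1) x B" if "wle (pw 2) x B" for x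
  proof (rule wleI)
    fix F :: "int set" assume F: "finite F"
    have "(\<Sum>k\<in>F. pw 1 k * cmod (coeff x k)) \<le> (\<Sum>k\<in>F. pw 2 k * cmod (coeff x k))"
      by (intro sum_mono mult_right_mono pw12) simp
    also have "\<dots> \<le> B" by (rule wleD[OF that F])
    finally show "(\<Sum>k\<in>F. pw 1 k * cmod (coeff x k)) \<le> B" .
  qed
  show ?thesis
  proof (rule norm_leI)
    fix F :: "int set" assume F: "finite F"
    have "(\<Sum>k\<in>F. cmod (coeff (absD a - absD b) k))
        \<le> (\<Sum>k\<in>F. r * cmod (coeff (a - b) k) + (1 / r) * (pw 2 k * cmod (coeff (a - b) k)))"
    proof (rule sum_mono)
      fix k
      let ?k = "\<bar>real_of_int k\<bar>"
      have "?k \<le> r + (1 / r) * pw 2 k"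
      proof (cases "?k \<le> r")
        case True
        then show ?thesis using r by (simp add: add_increasing2)
      next
        case False
        then have "r * ?k \<le> (1 + ?k) * (1 + ?k)"
          by (intro mult_mono) auto
        then have "?k \<le> (1 / r) * pw 2 k"
          using r by (simp add: pw_def field_simps power2_eq_square)
        then show ?thesis using r by linarith
      qed
      then have "?k * cmod (coeff (a - b) k) \<le> (r + (1 / r) * pw 2 k) * cmod (coeff (a - b) k)"
        by (rule mult_right_mono) simp
      moreover have "coeff (absD a - absD b) k = of_int \<bar>k\<bar> * coeff (a - b) k"
        by (simp add: coeff_absD[OF w1[OF a]] coeff_absD[OF w1[OF b]] right_diff_distrib)
      ultimately show "cmod (coeff (absD a - absD b) k)
          \<le> r * cmod (coeff (a - b) k) + (1 / r) * (pw 2 k * cmod (coeff (a - b) k))"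
        by (simp add: norm_mult distrib_right mult.assoc del: coeff_simps)
    qed
    also have "\<dots> = r * (\<Sum>k\<in>F. cmod (coeff (a - b) k)) + (1 / r) * (\<Sum>k\<in>F. pw 2 k * cmod (coeff (a - b) k))"
      by (simp only: sum.distrib sum_distrib_left)
    also have "\<dots> \<le> r * norm (a - b) + (1 / r) * (B + B)"
      using r by (intro add_mono mult_left_mono sum_coeff_le_norm F wleD[OF wle_diff[OF a b]]) auto
    finally show "(\<Sum>k\<in>F. cmod (coeff (absD a - absD b) k)) \<le> r * norm (a - b) + 2 * B / r"
      by simp
  qed
qed

lemma galerkin_absD:
  assumes "proj M a = a"
  shows "galerkin M a = - (J * (absD a + proj M (cubic a)))"
proof -
  have "coeff (tabs M a) k = coeff (absD a) k" for k
    using coeff_eq_0_of_proj[OF assms, of k]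
    by (subst coeff_absD[OF wle_of_proj[OF assms pw_nonneg]], cases "k \<in> {- int M..int M}") (auto simp: coeff_tabs)
  then have "tabs M a = absD a" by (rule wiener_eqI)
  then show ?thesis by (simp add: galerkin_def)
qed

theorem global_solution:
  assumes c0: "proj M0 c0 = c0"
  shows "\<exists>c B. c 0 = c0 \<and> (\<forall>t. (c has_vector_derivative - (J * (absD (c t) + cubic (c t)))) (at t)) \<and>
    (\<forall>m T t. \<bar>t\<bar> \<le> T \<longrightarrow> wle (pw m) (c t) (B m T))"
proof -
  obtain B where B: "\<And>M c m T t. M0 \<le> M \<Longrightarrow> c 0 = c0 \<Longrightarrow>
      (\<And>t. proj M (c t) = c t) \<Longrightarrow> (\<And>t. (c has_vector_derivative galerkin M (c t)) (at t)) \<Longrightarrow>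
      \<bar>t\<bar> \<le> T \<Longrightarrow> wle (pw m) (c t) (B m T)"
    using galerkin_uniform_bound[OF c0] by blast
  have "\<exists>c. c 0 = c0 \<and> (\<forall>t. proj (M0 + n) (c t) = c t \<and> (c has_vector_derivative galerkin (M0 + n) (c t)) (at t))" for n
    by (rule galerkin_solution[OF proj_mono[OF c0]]) simp
  then obtain X where X0: "\<And>n. X n 0 = c0" and pX: "\<And>n t. proj (M0 + n) (X n t) = X n t"
    and derX: "\<And>n t. (X n has_vector_derivative galerkin (M0 + n) (X n t)) (at t)" by metis
  have wX: "wle (pw m) (X n t) (B m T)" if "\<bar>t\<bar> \<le> T" for m n t T
    using B[of "M0 + n" "X n" t T m] X0 pX derX that by simp
  define R where "R T = B 0 T" for T
  define E where "E T = 12 * (R T)\<^sup>2 * B 1 T" for T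
  have nX: "norm (X n t) \<le> R T" if "\<bar>t\<bar> \<le> T" for n t T
    unfolding R_def by (rule wle_imp_norm_pw[OF wX[OF that]])
  have R0: "0 \<le> R T" and B0: "0 \<le> B m T" if "0 \<le> T" for m T
    using wle_nonneg[OF wX[of 0 T 0]] wle_nonneg[OF wX[of 0 T m]] that by (auto simp: R_def)
  have cX: "wle (pw 1) (cubic (X n t)) (E T)" if t: "\<bar>t\<bar> \<le> T" for n t T
  proof (rule wle_mono[OF wle_pw_cubic[OF wX[OF t]]])
    have "(norm (X n t))\<^sup>2 \<le> (R T)\<^sup>2"
      using nX[OF t] by (rule power_mono) simp
    then show "3 * 4 ^ 1 * (norm (X n t))\<^sup>2 * B 1 T \<le> E T"
      using B0[of T 1] t by (auto simp: E_def intro!: mult_right_mono)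
  qed
  define K where "K T = E T * T * exp (3 * (R T)\<^sup>2 * T)" for T
  have E0: "0 \<le> E T" and K0: "0 \<le> K T" if "0 \<le> T" for T
    using R0[OF that] B0[OF that] that by (auto simp: E_def K_def)
  have diff: "norm (X (n + j) t - X n t) \<le> K T / (real n + 1)" if t: "\<bar>t\<bar> \<le> T" for n j t T
  proof -
    have T: "0 \<le> T" using t by linarith
    have fwd: "norm (X (n + j) t - X n t) \<le> E T / (real (M0 + n) + 1) * \<bar>t\<bar> * exp (3 * (R T)\<^sup>2 * \<bar>t\<bar>)"
    proof (cases "0 \<le> t")
      case True
      then show ?thesis
        using galerkin_difference_forward[of 1 "M0 + n" "M0 + (n + j)" t "X (n + j)" "X n" "R T" "E T"] t
          X0 pX derX nX cX by auto
    next
      case False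
      have "((\<lambda>s. X n (- s)) has_vector_derivative (-1) *\<^sub>R galerkin (M0 + n) (X n (- s))) (at s)" for n s
        using vector_diff_chain_at[of uminus "-1" s "X n" "galerkin (M0 + n) (X n (- s))"] derX[of n "- s"]
        by (simp add: o_def has_vector_derivative_minus has_vector_derivative_id)
      then show ?thesis
        using galerkin_difference_forward[of "-1" "M0 + n" "M0 + (n + j)" "- t" "\<lambda>s. X (n + j) (- s)" "\<lambda>s. X n (- s)" "R T" "E T"] t
          X0 pX nX cX False by auto
    qed
    also have "\<dots> \<le> E T / (real n + 1) * T * exp (3 * (R T)\<^sup>2 * T)"
      using t T E0[OF T] by (intro mult_mono frac_le) (auto intro!: mult_left_mono)
    finally show ?thesis by (simp add: K_def)
  qed
  have "convergent (\<lambda>n. X n t)" for t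
  proof (rule convergent_of_cauchy_bound)
    show "(\<lambda>n. K \<bar>t\<bar> / (real n + 1)) \<longlonglongrightarrow> 0"
      by real_asymp
  qed (rule diff[OF order_refl])
  then obtain c where lim: "\<And>t. (\<lambda>n. X n t) \<longlonglongrightarrow> c t"
    unfolding convergent_def by metis
  have wc: "wle (pw m) (c t) (B m T)" if "\<bar>t\<bar> \<le> T" for m t T
    using wX[OF that] by (intro wle_tendsto[OF tendsto_coeff[OF lim[of t]]]) auto
  have cdiff: "norm (X n t - c t) \<le> K T / (real n + 1)" if "\<bar>t\<bar> \<le> T" for n t T
    using norm_limit_diff_le[of "\<lambda>n. X n t", OF lim, of n "K T / (real n + 1)"] diff[OF that] by simp
  have "(c has_vector_derivative - (J * (absD (c t) + cubic (c t)))) (at t)" for t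
  proof (rule has_vector_derivative_limit[OF derX lim])
    define T where "T = \<bar>t\<bar> + 1"
    have T: "0 \<le> T" by (simp add: T_def)
    \<comment> \<open>The first two terms are \<open>norm_absD_diff\<close> with
      \<open>r = sqrt (real n + 1)\<close>, which balances the convergence rate 1 / (n + 1) against
      the bound 1 / r. The others are the errors of the cubic term and of its truncation.\<close>
    define e where "e n = (K T / sqrt (real n + 1) + 2 * B 2 T / sqrt (real n + 1))
      + (3 * (R T)\<^sup>2 * (K T / (real n + 1)) + E T / (real n + 1))" for n
    have "e \<longlonglongrightarrow> 0"
      unfolding e_def by real_asymp
    have e: "dist (galerkin (M0 + n) (X n t)) (- (J * (absD (c t) + cubic (c t)))) \<le> e n" if t: "\<bar>t\<bar> \<le> T" for n t
    proof -
      let ?a = "X n t" and ?c = "c t" and ?r = "sqrt (real n + 1)"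
      have nc: "norm ?c \<le> R T"
        unfolding R_def by (rule wle_imp_norm_pw[OF wc[OF t]])
      have "galerkin (M0 + n) ?a - (- (J * (absD ?c + cubic ?c)))
          = - (J * ((absD ?a - absD ?c) + ((cubic ?a - cubic ?c) - (cubic ?a - proj (M0 + n) (cubic ?a)))))"
        by (simp add: galerkin_absD[OF pX] right_diff_distrib distrib_left)
      then have "dist (galerkin (M0 + n) ?a) (- (J * (absD ?c + cubic ?c)))
          = norm ((absD ?a - absD ?c) + ((cubic ?a - cubic ?c) - (cubic ?a - proj (M0 + n) (cubic ?a))))"
        by (simp add: dist_norm)
      also have "\<dots> \<le> norm (absD ?a - absD ?c) + (norm (cubic ?a - cubic ?c) + norm (cubic ?a - proj (M0 + n) (cubic ?a)))"
        by (rule order_trans[OF norm_triangle_ineq add_left_mono[OF norm_triangle_ineq4]])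
      also have "\<dots> \<le> (?r * norm (?a - ?c) + 2 * B 2 T / ?r)
          + (3 * (R T)\<^sup>2 * norm (?a - ?c) + E T / (real (M0 + n) + 1))"
        by (intro add_mono norm_absD_diff wX wc t norm_cubic_diff nX nc norm_proj_diff cX) simp
      also have "\<dots> \<le> (?r * (K T / (real n + 1)) + 2 * B 2 T / ?r)
          + (3 * (R T)\<^sup>2 * (K T / (real n + 1)) + E T / (real n + 1))"
        using cdiff[OF t, of n] E0[OF T] B0[OF T, of 2] by (intro add_mono mult_left_mono frac_le) auto
      also have "?r * (K T / (real n + 1)) = K T / ?r"
        by (simp add: real_div_sqrt field_simps)
      finally show ?thesis unfolding e_def .
    qed
    show "uniform_limit {- T<..<T} (\<lambda>n t. galerkin (M0 + n) (X n t)) (\<lambda>t. - (J * (absD (c t) + cubic (c t)))) sequentially"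
      by (rule uniform_limit_of_bound[OF \<open>e \<longlonglongrightarrow> 0\<close>]) (auto intro!: e)
    show "\<bar>t\<bar> < T" by (simp add: T_def)
  qed
  moreover have "c 0 = c0"
    by (rule LIMSEQ_unique[OF lim]) (simp add: X0)
  ultimately show ?thesis
    using wc by blast
qed

section \<open>From weighted coefficient bounds to Sobolev norms\<close>

lemma sobolev_summand_le:
  assumes "\<sigma> \<le> real m / 2"
  shows "(1 + (of_int k)\<^sup>2) powr \<sigma> * (cmod (coeff a k))\<^sup>2 \<le> norm a * (pw m k * cmod (coeff a k))"
proof -
  let ?k = "\<bar>real_of_int k\<bar>"
  have "(1 + (of_int k)\<^sup>2) powr \<sigma> \<le> ((1 + ?k)\<^sup>2) powr \<sigma>" if "0 \<le> \<sigma>"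
    using that by (intro powr_mono2) (auto simp: power2_eq_square algebra_simps)
  moreover have "((1 + ?k)\<^sup>2) powr \<sigma> = (1 + ?k) powr (2 * \<sigma>)"
    by (simp add: powr_powr flip: powr_numeral)
  moreover have "(1 + ?k) powr (2 * \<sigma>) \<le> (1 + ?k) powr real m"
    using assms by (intro powr_mono) auto
  moreover have "(1 + (of_int k)\<^sup>2) powr \<sigma> \<le> 1" if "\<sigma> < 0"
  proof -
    have "1 \<le> 1 + (real_of_int k)\<^sup>2" by simp
    then show ?thesis
      using that powr_mono[of \<sigma> 0 "1 + (real_of_int k)\<^sup>2"] by (simp split: if_splits)
  qed
  ultimately have "(1 + (of_int k)\<^sup>2) powr \<sigma> \<le> pw m k"
    using order_trans[OF _ pw_ge_1[of m k]]
    by (cases "0 \<le> \<sigma>") (auto simp: pw_def powr_realpow add_pos_nonneg simp del: one_le_power)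
  then have "(1 + (of_int k)\<^sup>2) powr \<sigma> * (cmod (coeff a k) * cmod (coeff a k)) \<le> pw m k * (norm a * cmod (coeff a k))"
    by (intro mult_mono coeff_le_norm) auto
  then show ?thesis by (simp add: power2_eq_square mult_ac)
qed

lemma sobolev_summable:
  assumes "wle (pw m) a B" "\<sigma> \<le> real m / 2"
  shows "(\<lambda>k. (1 + (of_int k)\<^sup>2) powr \<sigma> * (cmod (coeff a k))\<^sup>2) summable_on UNIV"
  by (rule summable_on_comparison_test[OF summable_on_cmult_right[OF wle_summable[OF assms(1)], of "norm a"]])
    (auto intro!: sobolev_summand_le assms)

lemma sobolev_norm_ev:
  "sobolev_norm \<sigma> (ev a) = sqrt (\<Sum>\<^sub>\<infinity>k. (1 + (of_int k)\<^sup>2) powr \<sigma> * (cmod (coeff a k))\<^sup>2)"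
  by (simp add: sobolev_norm_def fourier_coeff_ev)

text \<open>One of the two factors |a_k| is estimated by \<open>norm a\<close>, the other keeps the
  weight. As the bound is a product, smallness in l^1 with a mere bound in a higher weight gives
  smallness in H^\<sigma>.\<close>

lemma sobolev_norm_ev_le:
  assumes "wle (pw m) a B" "\<sigma> \<le> real m / 2"
  shows "sobolev_norm \<sigma> (ev a) \<le> sqrt (norm a * B)"
proof -
  have "(\<Sum>\<^sub>\<infinity>k. (1 + (of_int k)\<^sup>2) powr \<sigma> * (cmod (coeff a k))\<^sup>2) \<le> (\<Sum>\<^sub>\<infinity>k. norm a * (pw m k * cmod (coeff a k)))"
    using assms by (intro infsum_mono sobolev_summable summable_on_cmult_right wle_summable sobolev_summand_le) auto
  also have "\<dots> = norm a * (\<Sum>\<^sub>\<infinity>k. pw m k * cmod (coeff a k))"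
    by (rule infsum_cmult_right')
  also have "\<dots> \<le> norm a * B"
    using wle_infsum[OF assms(1)] by (intro mult_left_mono) auto
  finally show ?thesis by (simp add: sobolev_norm_ev)
qed

lemma ev_in_sobolev:
  assumes "wle (pw m) a B" "\<sigma> \<le> real m / 2"
  shows "ev a \<in> sobolev \<sigma>"
proof -
  have "ev a \<in> borel_measurable lebesgue"
    using borel_measurable_continuous_onI[OF continuous_on_ev[of UNIV a]] by (simp add: measurable_completion)
  moreover have "set_integrable lebesgue {0..2 * pi} (\<lambda>x. (cmod (ev a x))\<^sup>2)"
    by (intro absolutely_integrable_continuous_real continuous_intros continuous_on_ev)
  ultimately show ?thesis
    using sobolev_summable[OF assms] by (simp add: sobolev_def periodic_ev fourier_coeff_ev)
qed

lemma abs_D_ev: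
  assumes "wle (pw 1) a B"
  shows "abs_D (ev a) x = ev (absD a) x"
  unfolding abs_D_def ev_def[of "absD a"] fourier_coeff_ev coeff_absD[OF assms] ..

lemma ev_cubic: "ev (cubic a) x = of_real ((cmod (ev a x))\<^sup>2) * ev a x"
  unfolding complex_norm_square by (simp add: cubic_def ev_mult ev_star mult_ac)

text \<open>Evaluation at \<open>x\<close> is bounded, linear and multiplicative, so the equation in
  the algebra becomes the classical pointwise one. Continuity in each H^\<sigma> comes from
  continuity in l^1 and the locally uniform bounds in all weights.\<close>

theorem half_wave_solution_ev:
  assumes c0: "c 0 = c0" and der: "\<And>t. (c has_vector_derivative - (J * (absD (c t) + cubic (c t)))) (at t)"
    and B: "\<And>m T t. \<bar>t\<bar> \<le> T \<Longrightarrow> wle (pw m) (c t) (B m T)"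
  shows "half_wave_solution (ev c0) (\<lambda>t. ev (c t))"
proof -
  have pde: "((\<lambda>\<tau>. ev (c \<tau>) x) has_vector_derivative - (\<i> * (abs_D (ev (c t)) x + of_real ((cmod (ev (c t) x))\<^sup>2) * ev (c t) x))) (at t)" for t x
    using bounded_linear.has_vector_derivative[OF bounded_linear_ev der[of t], of x]
    by (simp add: ev_minus ev_mult ev_J ev_add abs_D_ev[OF B[OF order_refl]] ev_cubic)
  have "continuous_in_sobolev \<sigma> (\<lambda>t. ev (c t))" for \<sigma>
  proof -
    obtain m :: nat where "2 * \<sigma> \<le> real m" using real_arch_simple by blast
    then have m: "\<sigma> \<le> real m / 2" by simp
    have "((\<lambda>\<tau>. sobolev_norm \<sigma> (\<lambda>x. ev (c \<tau>) x - ev (c t) x)) \<longlongrightarrow> 0) (at t)" for t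
    proof (rule Lim_null_comparison)
      define T where "T = \<bar>t\<bar> + 1"
      have "(c \<longlongrightarrow> c t) (at t)"
        using has_vector_derivative_continuous[OF der[of t]] by (simp add: continuous_within)
      then have "((\<lambda>\<tau>. sqrt (norm (c \<tau> - c t) * (B m T + B m T))) \<longlongrightarrow> sqrt (norm (c t - c t) * (B m T + B m T))) (at t)"
        by (intro tendsto_intros)
      then show "((\<lambda>\<tau>. sqrt (norm (c \<tau> - c t) * (B m T + B m T))) \<longlongrightarrow> 0) (at t)" by simp
      have "\<forall>\<^sub>F \<tau> in at t. dist \<tau> t < 1"
        by (simp add: eventually_at) (metis zero_less_one)
      then show "\<forall>\<^sub>F \<tau> in at t. norm (sobolev_norm \<sigma> (\<lambda>x. ev (c \<tau>) x - ev (c t) x)) \<le> sqrt (norm (c \<tau> - c t) * (B m T + B m T))"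
      proof eventually_elim
        case (elim \<tau>)
        then have "\<bar>\<tau>\<bar> \<le> T" by (simp add: T_def dist_real_def)
        then have "wle (pw m) (c \<tau> - c t) (B m T + B m T)"
          by (intro wle_diff B) (auto simp: T_def)
        from sobolev_norm_ev_le[OF this m] have "sobolev_norm \<sigma> (ev (c \<tau> - c t)) \<le> sqrt (norm (c \<tau> - c t) * (B m T + B m T))" .
        moreover have "0 \<le> sobolev_norm \<sigma> (ev (c \<tau> - c t))"
          by (auto simp: sobolev_norm_ev intro!: infsum_nonneg)
        ultimately show ?case
          by (simp add: ev_diff[abs_def])
      qed
    qed
    then show ?thesis
      using ev_in_sobolev[OF B[OF order_refl] m] by (auto simp: continuous_in_sobolev_def)
  qed
  then show ?thesis
    using pde by (auto simp: half_wave_solution_def c0 continuous_on_ev vector_derivative_at[OF pde] algebra_simps intro: differentiableI_vector[OF pde])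
qed

section \<open>Approximation by the transport dynamics\<close>

lemma wle_add:
  assumes "wle w a A" "wle w b B" "\<And>k. 0 \<le> w k"
  shows "wle w (a + b) (A + B)"
proof -
  have "wle w (- b) B" using assms(2) by (simp add: wle_def)
  from wle_diff[OF assms(1) this assms(3)] show ?thesis by simp
qed

lemma wle_scaleR: "wle w a A \<Longrightarrow> wle w (r *\<^sub>R a) (\<bar>r\<bar> * A)"
  unfolding wle_def
proof (intro allI impI)
  fix F :: "int set"
  assume a: "\<forall>F. finite F \<longrightarrow> (\<Sum>k\<in>F. w k * cmod (coeff a k)) \<le> A" and F: "finite F"
  have "(\<Sum>k\<in>F. w k * cmod (coeff (r *\<^sub>R a) k)) = \<bar>r\<bar> * (\<Sum>k\<in>F. w k * cmod (coeff a k))"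
    by (simp add: norm_mult sum_distrib_left mult_ac)
  then show "(\<Sum>k\<in>F. w k * cmod (coeff (r *\<^sub>R a) k)) \<le> \<bar>r\<bar> * A"
    using a F by (simp add: mult_left_mono)
qed

text \<open>Submultiplicativity bounds every power, hence the partial sums of the exponential
  series, and \<open>wle_tendsto\<close> passes to the limit. The condition on \<open>w 0\<close>
  serves the constant term 1.\<close>

lemma wle_exp:
  assumes w: "\<And>j k. w (j + k) \<le> w j * w k" "\<And>k. 0 \<le> w k" "w 0 \<le> 1" and a: "wle w a A"
  shows "wle w (exp a) (exp A)"
proof -
  have A: "0 \<le> A" using a by (rule wle_nonneg)
  have one: "wle w 1 1"
  proof (rule wleI)
    fix F :: "int set" assume F: "finite F"
    have "(\<Sum>k\<in>F. w k * cmod (coeff 1 k)) = (\<Sum>k\<in>F. if k = 0 then w 0 else 0)"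
      by (rule sum.cong) (auto simp: coeff_1)
    also have "\<dots> \<le> 1" using F w(3) by simp
    finally show "(\<Sum>k\<in>F. w k * cmod (coeff 1 k)) \<le> 1" .
  qed
  have pow: "wle w (a ^ n) (A ^ n)" for n
    by (induction n) (auto intro!: one wle_mult[OF w(1,2)] a)
  have part: "wle w (\<Sum>n<N. a ^ n /\<^sub>R fact n) (\<Sum>n<N. A ^ n /\<^sub>R fact n)" for N
  proof (induction N)
    case 0
    then show ?case by (simp add: wle_def)
  next
    case (Suc N)
    then show ?case
      using wle_add[OF Suc wle_scaleR[OF pow[of N], of "inverse (fact N)"] w(2)] by simp
  qed
  show ?thesis
  proof (rule wle_tendsto)
    show "(\<lambda>N. coeff (\<Sum>n<N. a ^ n /\<^sub>R fact n) k) \<longlonglongrightarrow> coeff (exp a) k" for k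
      by (rule tendsto_coeff) (use exp_converges[of a] in \<open>simp add: sums_def\<close>)
    have "(\<Sum>n<N. A ^ n /\<^sub>R fact n) \<le> exp A" for N
      using sum_le_suminf[OF sums_summable[OF exp_converges[of A]], of "{..<N}"] A exp_converges[of A]
      by (simp add: sums_iff)
    then show "\<forall>\<^sub>F N in sequentially. wle w (\<Sum>n<N. a ^ n /\<^sub>R fact n) (exp A)"
      using wle_mono[OF part] by simp
  qed
qed

lemma star_power: "star (a ^ n) = star a ^ n"
  by (induction n) (simp_all add: star_mult)

lemma star_exp: "star (exp a) = exp (star a)"
proof -
  have "(\<lambda>n. star (a ^ n /\<^sub>R fact n)) sums star (exp a)"
    by (rule bounded_linear.sums[OF bounded_linear_star exp_converges])
  then have "(\<lambda>n. star a ^ n /\<^sub>R fact n) sums star (exp a)"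
    by (simp add: star_scaleR star_power)
  then show ?thesis
    using exp_converges sums_unique2 by blast
qed

definition phase :: "wiener \<Rightarrow> real \<Rightarrow> wiener" where
  "phase f t = exp (t *\<^sub>R (- (J * (f * star f))))"

definition ode_sol :: "wiener \<Rightarrow> real \<Rightarrow> wiener" where
  "ode_sol f t = f * phase f t"

lemma phase_unitary: "phase f t * star (phase f t) = 1"
proof -
  have "star (phase f t) = exp (- (t *\<^sub>R (- (J * (f * star f)))))"
    unfolding phase_def star_exp by (simp add: star_scaleR star_minus star_mult star_J mult_ac)
  then show ?thesis
    unfolding phase_def by (simp only: exp_minus_inverse)
qed

lemma ode_sol_0: "ode_sol f 0 = f"
  by (simp add: ode_sol_def phase_def)

lemma cubic_ode_sol: "cubic (ode_sol f t) = f * star f * ode_sol f t"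
proof -
  have "cubic (ode_sol f t) = f * star f * ode_sol f t * (phase f t * star (phase f t))"
    by (simp add: cubic_def ode_sol_def star_mult mult_ac)
  then show ?thesis by (simp add: phase_unitary)
qed

lemma ode_sol_derivative: "(ode_sol f has_vector_derivative - (J * cubic (ode_sol f t))) (at t)"
proof -
  have "((\<lambda>t. f * phase f t) has_vector_derivative f * (- (J * (f * star f)) * phase f t)) (at t)"
    unfolding phase_def by (intro has_vector_derivative_mult_right exp_scaleR_has_vector_derivative_left)
  then show ?thesis
    by (simp add: ode_sol_def[abs_def] cubic_ode_sol[unfolded ode_sol_def] mult_ac)
qed

text \<open>The bound \<open>H\<close> is kept apart from \<open>A\<close>: for a packet
  \<open>A\<close> is exponentially small while \<open>H\<close> is moderate, and the smallness must
  survive as a prefactor outside the exponential.\<close>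

lemma wle_ode_sol:
  assumes w: "\<And>j k. w (j + k) \<le> w j * w k" "\<And>k. 0 \<le> w k" "w 0 \<le> 1"
    and f: "wle w f A" and h: "wle w (f * star f) H" and t: "0 \<le> t"
  shows "wle w (ode_sol f t) (A * exp (t * H))"
proof -
  have "wle w (t *\<^sub>R (- (J * (f * star f)))) (\<bar>t\<bar> * H)"
    using h by (intro wle_scaleR) (simp add: wle_def coeff_J_mult norm_mult)
  from wle_exp[OF w this] show ?thesis
    unfolding ode_sol_def phase_def using t by (intro wle_mult w f) simp
qed

section \<open>Translation to the moving frame\<close>

definition shift :: "real \<Rightarrow> wiener \<Rightarrow> wiener" where
  "shift t = fmult (\<lambda>k. cis (of_int k * t))"

lemma coeff_shift: "coeff (shift t a) k = cis (of_int k * t) * coeff a k"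
  unfolding shift_def by (rule coeff_fmult[where C = 1]) simp

lemma norm_shift [simp]: "norm (shift t a) = norm a"
  unfolding norm_wiener.rep_eq by (simp add: coeff_shift norm_mult)

lemma shift_diff: "shift t (a - b) = shift t a - shift t b"
  by (rule wiener_eqI) (simp add: coeff_shift right_diff_distrib)

lemma ev_shift: "ev (shift t a) x = ev a (x + t)"
  unfolding ev_def coeff_shift
  by (rule infsum_cong) (simp add: cis_mult distrib_left mult.commute mult.left_commute add.commute)

lemma cubic_shift: "cubic (shift t a) = shift t (cubic a)"
  by (rule ev_inject) (simp add: ev_shift ev_cubic)

lemma norm_cis_diff_le: "cmod (cis x - cis y) \<le> \<bar>x - y\<bar>"
proof -
  have le: "cmod (cis x - cis y) \<le> x - y" if "y < x" for x y
    using that cis_has_vector_derivative[of 1] 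
    by (intro differentiable_bound_general[of y x cis "\<lambda>x. x" "\<lambda>x. \<i> * cis x" "\<lambda>_. 1"])
      (auto intro!: continuous_on_cis continuous_intros derivative_eq_intros simp: norm_mult)
  show ?thesis
    using le[of x y] le[of y x] by (cases x y rule: linorder_cases) (auto simp: norm_minus_commute)
qed

lemma norm_shift_diff_le:
  assumes "wle (pw 1) a B"
  shows "norm (shift t a - shift s a) \<le> \<bar>t - s\<bar> * B"
proof (rule norm_leI)
  fix F :: "int set" assume F: "finite F"
  have "(\<Sum>k\<in>F. cmod (coeff (shift t a - shift s a) k)) \<le> (\<Sum>k\<in>F. \<bar>t - s\<bar> * (pw 1 k * cmod (coeff a k)))"
  proof (rule sum_mono)
    fix k
    have "coeff (shift t a - shift s a) k = (cis (of_int k * t) - cis (of_int k * s)) * coeff a k"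
      by (simp add: coeff_shift left_diff_distrib)
    then have "cmod (coeff (shift t a - shift s a) k) = cmod (cis (of_int k * t) - cis (of_int k * s)) * cmod (coeff a k)"
      by (simp add: norm_mult)
    also have "\<dots> \<le> \<bar>of_int k * t - of_int k * s\<bar> * cmod (coeff a k)"
      by (intro mult_right_mono norm_cis_diff_le) simp
    also have "\<dots> \<le> \<bar>t - s\<bar> * (pw 1 k * cmod (coeff a k))"
    proof -
      have "\<bar>of_int k * t - of_int k * s\<bar> = \<bar>t - s\<bar> * \<bar>real_of_int k\<bar>"
        unfolding right_diff_distrib[symmetric] by (simp add: abs_mult)
      then show ?thesis
        by (simp add: pw_def mult.assoc mult_left_mono mult_right_mono)
    qed
    finally show "cmod (coeff (shift t a - shift s a) k) \<le> \<bar>t - s\<bar> * (pw 1 k * cmod (coeff a k))" .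
  qed
  also have "\<dots> \<le> \<bar>t - s\<bar> * B"
    unfolding sum_distrib_left[symmetric] by (intro mult_left_mono wleD[OF assms F]) simp
  finally show "(\<Sum>k\<in>F. cmod (coeff (shift t a - shift s a) k)) \<le> \<bar>t - s\<bar> * B" .
qed

text \<open>Translations are continuous in \<open>t\<close> on each fixed element, but not uniformly
  on the unit ball; one weight at the base point \<open>s\<close> pays for the difference of two
  translations. Gronwall needs this continuity for the error in the moving frame.\<close>

lemma continuous_on_shift:
  assumes c: "continuous_on UNIV c" and B: "\<And>t. wle (pw 1) (c t) (B t)"
  shows "continuous_on UNIV (\<lambda>t. shift t (c t))"
  unfolding continuous_on_def
proof
  fix s :: real
  have lim: "(c \<longlongrightarrow> c s) (at s)"
    using c by (simp add: continuous_on_def)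
  have "((\<lambda>t. shift t (c t) - shift s (c s)) \<longlongrightarrow> 0) (at s)"
  proof (rule Lim_null_comparison)
    have "((\<lambda>t. norm (c t - c s) + \<bar>t - s\<bar> * B s) \<longlongrightarrow> norm (c s - c s) + \<bar>s - s\<bar> * B s) (at s)"
      by (intro tendsto_intros lim)
    then show "((\<lambda>t. norm (c t - c s) + \<bar>t - s\<bar> * B s) \<longlongrightarrow> 0) (at s)" by simp
    show "\<forall>\<^sub>F t in at s. norm (shift t (c t) - shift s (c s)) \<le> norm (c t - c s) + \<bar>t - s\<bar> * B s"
    proof (intro always_eventually allI)
      fix t
      have "shift t (c t) - shift s (c s) = shift t (c t - c s) + (shift t (c s) - shift s (c s))"
        by (simp add: shift_diff)
      also have "norm \<dots> \<le> norm (shift t (c t - c s)) + norm (shift t (c s) - shift s (c s))"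
        by (rule norm_triangle_ineq)
      also have "\<dots> \<le> norm (c t - c s) + \<bar>t - s\<bar> * B s"
        using norm_shift_diff_le[OF B] by simp
      finally show "norm (shift t (c t) - shift s (c s)) \<le> norm (c t - c s) + \<bar>t - s\<bar> * B s" .
    qed
  qed
  then show "((\<lambda>t. shift t (c t)) \<longlongrightarrow> shift s (c s)) (at s within UNIV)"
    by (simp add: LIM_zero_iff)
qed

text \<open>Only the known profile \<open>b\<close> is bounded in advance; the size of
  \<open>a\<close> is expressed through the difference, as a bootstrap argument requires.\<close>

lemma norm_cubic_diff':
  assumes "norm b \<le> V"
  shows "norm (cubic a - cubic b) \<le> 3 * (V + norm (a - b))\<^sup>2 * norm (a - b)"
proof (rule norm_cubic_diff)
  show "norm a \<le> V + norm (a - b)"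
    using norm_triangle_ineq[of "a - b" b] assms by simp
  show "norm b \<le> V + norm (a - b)"
    using assms by (rule add_increasing2[OF norm_ge_zero])
qed

text \<open>In the frame moving with speed one the equation becomes \<open>v' = - \<i> \<bar>v\<bar>\<^sup>2 v\<close> up to the
  term \<open>- \<i> (\<bar>D\<bar> - D) v\<close>, which only sees negative frequencies.\<close>

theorem ode_approximation:
  assumes der: "\<And>t. (c has_vector_derivative - (J * (absD (c t) + cubic (c t)))) (at t)"
    and B: "\<And>t. wle (pw 1) (c t) (B t)"
    and v: "\<And>t. (v has_vector_derivative - (J * cubic (v t))) (at t)" and init: "v 0 = c 0"
    and V: "\<And>s. s \<in> {0..T} \<Longrightarrow> norm (v s) \<le> V"
    and r: "\<And>s. s \<in> {0..T} \<Longrightarrow> wle (\<lambda>k. of_int (\<bar>k\<bar> - k)) (v s) r"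
    and small: "r * T * exp (3 * (V + 1)\<^sup>2 * T) < 1" and t: "t \<in> {0..T}"
  shows "norm (shift t (c t) - v t) \<le> r * T * exp (3 * (V + 1)\<^sup>2 * T)"
proof -
  have T: "0 \<le> T" using t by auto
  have r0: "0 \<le> r" using r[of 0] T by (auto intro: wle_nonneg)
  have V0: "0 \<le> V" using order_trans[OF norm_ge_zero V[of 0]] T by simp
  define d where "d t = shift t (c t) - v t" for t
  define y where "y t = norm (d t)" for t
  define \<phi> where "\<phi> t = 3 * (V + y t)\<^sup>2 * y t + r" for t
  have cont: "continuous_on UNIV y"
    unfolding y_def d_def
    by (intro continuous_on_norm continuous_on_diff continuous_on_shift[OF continuous_on_of_derivative[OF der] B]
        continuous_on_of_derivative[OF v])
  have "continuous_on UNIV \<phi>"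
    unfolding \<phi>_def by (intro continuous_intros cont)
  then obtain H where H: "H 0 = 0" "\<And>s. (H has_vector_derivative \<phi> s) (at s)"
    using antiderivative_exists by blast
  \<comment> \<open>The multiplier |k| - k acting on the error \<open>d\<close> is an oscillating
    factor that \<open>duhamel\<close> removes. It remains as a source only on the explicit
    \<open>v\<close>, whose negative modes are known to be small.\<close>
  define g where "g k s = - \<i> * (of_int (\<bar>k\<bar> - k) * coeff (v s) k + coeff (cubic (shift s (c s)) - cubic (v s)) k)" for k s
  have dd: "((\<lambda>t. coeff (d t) k) has_vector_derivative \<i> * of_real (- of_int (\<bar>k\<bar> - k)) * coeff (d s) k + g k s) (at s)" for k s
  proof -
    let ?e = "cis (of_int k * s)"
    have "((\<lambda>t. cis (of_int k * t) * coeff (c t) k - coeff (v t) k) has_vector_derivative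
        ?e * coeff (- (J * (absD (c s) + cubic (c s)))) k + \<i> * of_real (of_int k) * ?e * coeff (c s) k
        - coeff (- (J * cubic (v s))) k) (at s)"
      by (intro has_vector_derivative_diff has_vector_derivative_mult cis_has_vector_derivative
          bounded_linear.has_vector_derivative[OF bounded_linear_coeff] der v)
    moreover have "?e * coeff (cubic (c s)) k = coeff (cubic (shift s (c s))) k"
      by (simp add: cubic_shift coeff_shift)
    ultimately show ?thesis
      unfolding d_def g_def coeff_simps coeff_shift coeff_J_mult coeff_absD[OF B]
      by (elim has_vector_derivative_eq_rhs) (simp add: algebra_simps del: of_int_abs)
  qed
  have y_H: "y s \<le> H s" if s: "s \<in> {0..T}" for s
    unfolding y_def
  proof (rule norm_leI)
    fix F :: "int set" assume F: "finite F"
    have "(\<Sum>k\<in>F. 1 * cmod (coeff (d s) k)) \<le> (\<Sum>k\<in>F. 1 * cmod (coeff (d 0) k)) + (H s - H 0)"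
    proof (rule duhamel[OF F _ _ dd H(2)])
      fix q assume q: "q \<in> {0..s}"
      then have q': "q \<in> {0..T}" using s by auto
      have "(\<Sum>k\<in>F. 1 * cmod (g k q)) \<le> (\<Sum>k\<in>F. of_int (\<bar>k\<bar> - k) * cmod (coeff (v q) k)
          + cmod (coeff (cubic (shift q (c q)) - cubic (v q)) k))"
      proof (rule sum_mono)
        fix k
        have "1 * cmod (g k q) \<le> cmod (of_int (\<bar>k\<bar> - k) * coeff (v q) k) + cmod (coeff (cubic (shift q (c q)) - cubic (v q)) k)"
          unfolding g_def norm_mult[of "- \<i>"] by (simp add: norm_triangle_ineq del: coeff_simps of_int_diff of_int_abs)
        then show "1 * cmod (g k q) \<le> of_int (\<bar>k\<bar> - k) * cmod (coeff (v q) k)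
            + cmod (coeff (cubic (shift q (c q)) - cubic (v q)) k)"
          by (simp add: norm_mult del: coeff_simps of_int_diff of_int_abs)
      qed
      also have "\<dots> \<le> r + norm (cubic (shift q (c q)) - cubic (v q))"
        unfolding sum.distrib by (intro add_mono wleD[OF r[OF q'] F] sum_coeff_le_norm F)
      also have "\<dots> \<le> \<phi> q"
        using norm_cubic_diff'[OF V[OF q'], of "shift q (c q)"] by (simp add: \<phi>_def y_def d_def)
      finally show "(\<Sum>k\<in>F. 1 * cmod (g k q)) \<le> \<phi> q" .
    qed (use s in auto)
    then show "(\<Sum>k\<in>F. cmod (coeff (d s) k)) \<le> H s"
      by (simp add: d_def init coeff_shift H(1))
  qed
  have contH: "continuous_on S H" for S
    by (rule continuous_on_of_derivative[OF H(2)])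
  \<comment> \<open>The bootstrap runs on the majorant \<open>H\<close> rather than on
    \<open>y\<close>, because \<open>H\<close> is nondecreasing: a bound at one time holds at all
    earlier times.\<close>
  have H_mono: "H p \<le> H q" if "0 \<le> p" "p \<le> q" for p q
  proof (rule DERIV_nonneg_imp_nondecreasing[OF that(2)])
    fix x
    have "0 \<le> \<phi> x" using r0 by (auto simp: \<phi>_def y_def)
    then show "\<exists>z. (H has_real_derivative z) (at x) \<and> 0 \<le> z"
      using H(2)[of x] by (auto simp: has_real_derivative_iff_has_vector_derivative)
  qed
  define b where "b = 3 * (V + 1)\<^sup>2"
  \<comment> \<open>As long as \<open>H\<close> is at most 1, so is \<open>y\<close>; then
    \<open>\<phi>\<close> is at most \<open>b * H + r\<close> and a linear Gronwall inequality
    applies.\<close>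
  have small_H: "H q \<le> r * T * exp (b * T)" if q: "q \<in> {0..T}" and H1: "H q \<le> 1" for q
  proof -
    have "H q \<le> (0 + r * q) * exp (b * q)"
    proof (rule gronwall[OF contH _ r0])
      fix G s assume G: "G 0 = 0" "\<And>s. (G has_vector_derivative b * H s + r) (at s)" and s: "s \<in> {0..q}"
      have "H s - G s \<le> H 0 - G 0"
      proof (rule nonincreasing_on)
        fix p assume p: "p \<in> {0..s}"
        show "((\<lambda>t. H t - G t) has_real_derivative \<phi> p - (b * H p + r)) (at p)"
          using has_vector_derivative_diff[OF H(2) G(2)] by (simp add: has_real_derivative_iff_has_vector_derivative)
        have "y p \<le> H p" "H p \<le> 1" "0 \<le> y p"
          using y_H[of p] H_mono[of p q] H1 p s q by (auto simp: y_def)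
        then have "3 * (V + y p)\<^sup>2 * y p \<le> 3 * (V + 1)\<^sup>2 * H p"
          using V0 by (intro mult_mono power_mono) auto
        then show "\<phi> p - (b * H p + r) \<le> 0"
          by (simp add: \<phi>_def b_def)
      qed (use s in auto)
      then show "H s \<le> 0 + G s" by (simp add: G H)
    qed (use q in \<open>auto simp: b_def\<close>)
    also have "\<dots> \<le> r * T * exp (b * T)"
      using q r0 by (auto simp: b_def intro!: mult_mono)
    finally show ?thesis .
  qed
  \<comment> \<open>Continuity closes the bootstrap: at a time with \<open>H q = 1\<close> the
    previous bound would put \<open>H q\<close> strictly below 1.\<close>
  have "H T \<le> 1"
  proof (rule ccontr)
    assume "\<not> H T \<le> 1"
    then obtain q where q: "0 \<le> q" "q \<le> T" "H q = 1"
      using IVT'[of H 0 1 T] T contH H(1) by auto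
    then show False
      using small_H[of q] small by (simp add: b_def)
  qed
  then have "H t \<le> 1" using H_mono[of t T] t by auto
  then show ?thesis
    using y_H[OF t] small_H[OF t] by (simp add: y_def d_def b_def)
qed

section \<open>Decoherence of wave packets\<close>

definition l2 :: "wiener \<Rightarrow> real" where "l2 a = sqrt (tr (a * star a))"

lemma l2_nonneg: "0 \<le> l2 a"
  by (simp add: l2_def tr_self_star_nonneg)

lemma l2_squared: "(l2 a)\<^sup>2 = (\<Sum>\<^sub>\<infinity>j. (cmod (coeff a j))\<^sup>2)"
  using tr_self_star_nonneg[of a] by (simp add: l2_def tr_self_star)

lemma l2_leI:
  assumes "\<And>F. finite F \<Longrightarrow> L2_set (\<lambda>j. cmod (coeff a j)) F \<le> B"
  shows "l2 a \<le> B"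
proof -
  have B: "0 \<le> B" using assms[of "{}"] by simp
  have "(l2 a)\<^sup>2 \<le> B\<^sup>2"
    unfolding l2_squared
  proof (rule infsum_le_finite_sums[OF summable_coeff_squared])
    fix F :: "int set" assume F: "finite F"
    have "(L2_set (\<lambda>j. cmod (coeff a j)) F)\<^sup>2 \<le> B\<^sup>2"
      by (intro power_mono assms F L2_set_nonneg)
    then show "(\<Sum>j\<in>F. (cmod (coeff a j))\<^sup>2) \<le> B\<^sup>2"
      by (simp add: L2_set_def sum_nonneg)
  qed
  then show ?thesis using B by (rule power2_le_imp_le)
qed

lemma L2_set_le_l2: "finite F \<Longrightarrow> L2_set (\<lambda>j. cmod (coeff a j)) F \<le> l2 a"
  unfolding L2_set_def l2_def by (intro real_sqrt_le_mono sum_coeff_squared_le)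

lemma l2_triangle: "l2 (a + b) \<le> l2 a + l2 b"
proof (rule l2_leI)
  fix F :: "int set" assume F: "finite F"
  have "L2_set (\<lambda>j. cmod (coeff (a + b) j)) F \<le> L2_set (\<lambda>j. cmod (coeff a j) + cmod (coeff b j)) F"
    by (rule L2_set_mono) (auto simp: norm_triangle_ineq)
  also have "\<dots> \<le> L2_set (\<lambda>j. cmod (coeff a j)) F + L2_set (\<lambda>j. cmod (coeff b j)) F"
    by (rule L2_set_triangle_ineq)
  also have "\<dots> \<le> l2 a + l2 b"
    by (intro add_mono L2_set_le_l2 F)
  finally show "L2_set (\<lambda>j. cmod (coeff (a + b) j)) F \<le> l2 a + l2 b" .
qed

lemma l2_le_norm: "l2 a \<le> norm a"
proof (rule l2_leI)
  fix F :: "int set" assume F: "finite F"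
  have "L2_set (\<lambda>j. cmod (coeff a j)) F \<le> (\<Sum>j\<in>F. cmod (coeff a j))"
    by (rule L2_set_le_sum) simp
  then show "L2_set (\<lambda>j. cmod (coeff a j)) F \<le> norm a"
    using sum_coeff_le_norm[OF F, of a] by simp
qed

lemma l2_scaleR: "l2 (r *\<^sub>R a) = \<bar>r\<bar> * l2 a"
proof -
  have "tr (q *\<^sub>R x) = q * tr x" for q x
    by (simp add: tr_def)
  then have "tr (r *\<^sub>R a * star (r *\<^sub>R a)) = r\<^sup>2 * tr (a * star a)"
    by (simp add: star_scaleR power2_eq_square)
  then show ?thesis by (simp add: l2_def real_sqrt_mult)
qed

lemma l2_minus: "l2 (- a) = l2 a"
  using l2_scaleR[of "-1" a] by simp

lemma l2_unitary:
  assumes "u * star u = 1"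
  shows "l2 (a * u) = l2 a"
proof -
  have "a * u * star (a * u) = a * star a * (u * star u)"
    by (simp add: star_mult mult_ac)
  then show ?thesis using assms by (simp add: l2_def)
qed

lemma l2_diff_le: "\<bar>l2 a - l2 b\<bar> \<le> norm (a - b)"
  using l2_triangle[of "a - b" b] l2_triangle[of "b - a" a] l2_le_norm[of "a - b"] l2_minus[of "a - b"]
  by simp

lemma coeff_monomial_mult: "coeff (monomial j z * b) k = z * coeff b (k - j)"
proof -
  have "coeff (monomial j z * b) k = (\<Sum>\<^sub>\<infinity>i. if i = j then z * coeff b (k - i) else 0)"
    unfolding coeff_mult by (rule infsum_cong) (simp add: coeff_monomial)
  also have "\<dots> = z * coeff b (k - j)"
    by (rule infsumI, rule has_sum_single)
  finally show ?thesis .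
qed

lemma bij_diff_int: "bij_betw (\<lambda>k. k - j) (UNIV :: int set) UNIV"
  by (rule bij_betwI[of _ _ _ "\<lambda>k. k + j"]) auto

lemma l2_monomial_mult: "l2 (monomial j z * b) = cmod z * l2 b"
proof (rule power2_eq_imp_eq)
  have "(l2 (monomial j z * b))\<^sup>2 = (\<Sum>\<^sub>\<infinity>k. (cmod z)\<^sup>2 * (cmod (coeff b (k - j)))\<^sup>2)"
    unfolding l2_squared by (simp add: coeff_monomial_mult norm_mult power_mult_distrib)
  also have "\<dots> = (cmod z)\<^sup>2 * (\<Sum>\<^sub>\<infinity>k. (cmod (coeff b (k - j)))\<^sup>2)"
    by (rule infsum_cmult_right')
  also have "(\<Sum>\<^sub>\<infinity>k. (cmod (coeff b (k - j)))\<^sup>2) = (l2 b)\<^sup>2"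
    unfolding l2_squared using infsum_reindex_bij_betw[OF bij_diff_int, of "\<lambda>k. (cmod (coeff b k))\<^sup>2"] by simp
  finally show "(l2 (monomial j z * b))\<^sup>2 = (cmod z * l2 b)\<^sup>2"
    by (simp add: power_mult_distrib)
qed (auto simp: l2_nonneg)

text \<open>Young's inequality for l^1 and l^2: multiplication by an exponential is an isometry of
  l^2, and \<open>a\<close> is an absolutely convergent combination of exponentials. The l^2 norm
  passes to the limit by \<open>l2_diff_le\<close>.\<close>

lemma l2_mult_le: "l2 (a * b) \<le> norm a * l2 b"
proof (rule tendsto_upperbound)
  let ?S = "\<lambda>F. \<Sum>k\<in>F. monomial k (coeff a k)"
  have S: "(?S \<longlongrightarrow> a) (finite_subsets_at_top UNIV)"
    using has_sum_monomial[of a] by (simp add: has_sum_def)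
  have "((\<lambda>F. l2 (?S F * b) - l2 (a * b)) \<longlongrightarrow> 0) (finite_subsets_at_top UNIV)"
  proof (rule Lim_null_comparison)
    show "\<forall>\<^sub>F F in finite_subsets_at_top UNIV. norm (l2 (?S F * b) - l2 (a * b)) \<le> norm (?S F * b - a * b)"
      using l2_diff_le by simp
    have "((\<lambda>F. norm (?S F * b - a * b)) \<longlongrightarrow> norm (a * b - a * b)) (finite_subsets_at_top UNIV)"
      by (intro tendsto_intros S)
    then show "((\<lambda>F. norm (?S F * b - a * b)) \<longlongrightarrow> 0) (finite_subsets_at_top UNIV)" by simp
  qed
  then show "((\<lambda>F. l2 (?S F * b)) \<longlongrightarrow> l2 (a * b)) (finite_subsets_at_top UNIV)"
    by (simp add: LIM_zero_iff)
  have "l2 (?S F * b) \<le> (\<Sum>k\<in>F. cmod (coeff a k)) * l2 b" if "finite F" for F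
    using that
  proof induction
    case empty
    then show ?case by (simp add: l2_def tr_def)
  next
    case (insert k F)
    then have "l2 (?S (insert k F) * b) \<le> l2 (monomial k (coeff a k) * b) + l2 (?S F * b)"
      by (simp add: distrib_right l2_triangle)
    then show ?case
      using insert by (simp add: l2_monomial_mult distrib_right)
  qed
  then have "l2 (?S F * b) \<le> norm a * l2 b" if "finite F" for F
    using that sum_coeff_le_norm[OF that, of a] l2_nonneg[of b] by (meson mult_right_mono order_trans)
  then show "\<forall>\<^sub>F F in finite_subsets_at_top UNIV. l2 (?S F * b) \<le> norm a * l2 b"
    by (rule eventually_finite_subsets_at_top_weakI)
qed simp

lemma norm_exp_remainder_le:
  fixes x :: wiener
  assumes "norm x \<le> 1"
  shows "norm (exp x - 1 - x) \<le> (norm x)\<^sup>2"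
proof -
  have "norm (exp x - 1 - x) = norm (\<Sum>n. inverse (fact (n + 2)) *\<^sub>R (x ^ (n + 2)))"
    by (subst exp_first_two_terms) simp
  also have "\<dots> \<le> (\<Sum>n. inverse (fact (n + 2)) *\<^sub>R (norm x ^ (n + 2)))"
  proof (rule norm_suminf_le)
    show "norm (inverse (fact (n + 2)) *\<^sub>R (x ^ (n + 2))) \<le> inverse (fact (n + 2)) *\<^sub>R (norm x ^ (n + 2))" for n
      unfolding norm_scaleR by (simp add: mult_left_mono norm_power_ineq del: power_Suc fact_Suc)
    show "summable (\<lambda>n. inverse (fact (n + 2)) *\<^sub>R (norm x ^ (n + 2)))"
      using summable_ignore_initial_segment[OF summable_exp_generic[of "norm x"], of 2] by simp
  qed
  also have "\<dots> = exp (norm x) - 1 - norm x"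
    by (subst exp_first_two_terms) simp
  also have "\<dots> \<le> (norm x)\<^sup>2"
    using exp_bound[of "norm x"] assms by simp
  finally show ?thesis .
qed

text \<open>The normalised Dirichlet kernel of width \<open>K\<close>, modulated to frequency \<open>N\<close>.\<close>

definition packet :: "nat \<Rightarrow> nat \<Rightarrow> wiener" where
  "packet N K = (\<Sum>k\<in>{int N..<int N + int K}. monomial k (1 / of_nat K))"

lemma coeff_sum: "coeff (\<Sum>j\<in>F. g j) k = (\<Sum>j\<in>F. coeff (g j) k)"
  by (rule linear_sum[OF bounded_linear.linear[OF bounded_linear_coeff]])

lemma coeff_packet: "coeff (packet N K) k = (if k \<in> {int N..<int N + int K} then 1 / of_nat K else 0)"
  by (simp add: packet_def coeff_sum coeff_monomial)

lemma wle_packet: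
  assumes "\<And>k. 0 \<le> w k" "\<And>k. int N \<le> k \<Longrightarrow> w k \<le> A" "0 < K"
  shows "wle w (packet N K) A"
proof (rule wleI)
  fix F :: "int set" assume "finite F"
  then have "(\<Sum>k\<in>F. w k * cmod (coeff (packet N K) k)) = (\<Sum>k\<in>F \<inter> {int N..<int N + int K}. w k * (1 / real K))"
    by (intro sum.mono_neutral_cong_right) (auto simp: coeff_packet norm_divide)
  also have "\<dots> \<le> (\<Sum>k\<in>{int N..<int N + int K}. w k * (1 / real K))"
    by (rule sum_mono2) (auto simp: assms)
  also have "\<dots> \<le> (\<Sum>k\<in>{int N..<int N + int K}. A * (1 / real K))"
    by (intro sum_mono mult_right_mono assms) auto
  also have "\<dots> = A" using assms(3) by simp
  finally show "(\<Sum>k\<in>F. w k * cmod (coeff (packet N K) k)) \<le> A" .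
qed

lemma norm_packet_le: "0 < K \<Longrightarrow> norm (packet N K) \<le> 1"
  by (rule wle_imp_norm, rule wle_packet) auto

lemma infsum_packet:
  assumes "g 0 = 0"
  shows "(\<Sum>\<^sub>\<infinity>k. w k * g (coeff (packet N K) k)) = (\<Sum>k\<in>{int N..<int N + int K}. w k * (g (1 / of_nat K) :: real))"
proof -
  have "(\<Sum>\<^sub>\<infinity>k. w k * g (coeff (packet N K) k)) = (\<Sum>\<^sub>\<infinity>k\<in>{int N..<int N + int K}. w k * g (1 / of_nat K))"
    by (rule infsum_cong_neutral) (auto simp: coeff_packet assms)
  then show ?thesis by simp
qed

lemma l2_packet:
  assumes "0 < K"
  shows "l2 (packet N K) = 1 / sqrt (real K)"
proof (rule power2_eq_imp_eq)
  have "(l2 (packet N K))\<^sup>2 = (\<Sum>k\<in>{int N..<int N + int K}. 1 * (cmod (1 / of_nat K))\<^sup>2)"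
    unfolding l2_squared using infsum_packet[of "\<lambda>z. (cmod z)\<^sup>2" "\<lambda>_. 1"] by simp
  also have "\<dots> = (1 / sqrt (real K))\<^sup>2"
    using assms by (simp add: norm_divide power_divide power2_eq_square)
  finally show "(l2 (packet N K))\<^sup>2 = (1 / sqrt (real K))\<^sup>2" .
qed (auto simp: l2_nonneg)

lemma coeff_packet_star_eq_0:
  assumes "k \<notin> {- int K<..<int K}"
  shows "coeff (packet N K * star (packet N K)) k = 0"
proof -
  have "coeff (packet N K) j * coeff (star (packet N K)) (k - j) = 0" for j
    using assms by (auto simp: coeff_packet coeff_star)
  then show ?thesis by (simp only: coeff_mult infsum_0_simp)
qed

lemma ev_packet_0: "0 < K \<Longrightarrow> ev (packet N K) 0 = 1"
proof -
  have "ev (packet N K) 0 = (\<Sum>k\<in>{int N..<int N + int K}. ev (monomial k (1 / of_nat K)) 0)"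
    unfolding packet_def by (rule linear_sum[OF bounded_linear.linear[OF bounded_linear_ev]])
  then show "0 < K \<Longrightarrow> ?thesis" by (simp add: ev_monomial)
qed

text \<open>Cauchy--Schwarz: the \<open>2K - 1\<close> Fourier coefficients of \<open>\<bar>packet\<bar>\<^sup>2\<close> add up to \<open>1\<close>.\<close>

lemma tr_packet_quartic:
  fixes N K :: nat
  assumes K: "0 < K"
  defines "h \<equiv> packet N K * star (packet N K)"
  shows "1 / (2 * real K) \<le> tr (h * star h)"
proof -
  let ?I = "{- int K<..<int K}"
  have "1 = ev h 0" using K by (simp add: h_def ev_mult ev_star ev_packet_0)
  also have "\<dots> = (\<Sum>\<^sub>\<infinity>k\<in>?I. coeff h k)"
    unfolding ev_def by (rule infsum_cong_neutral) (auto simp: h_def intro!: coeff_packet_star_eq_0)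
  also have "\<dots> = (\<Sum>k\<in>?I. coeff h k)" by simp
  finally have "1 = cmod (\<Sum>k\<in>?I. coeff h k)" by simp
  also have "\<dots> \<le> (\<Sum>k\<in>?I. \<bar>1\<bar> * \<bar>cmod (coeff h k)\<bar>)"
    using norm_sum[of "coeff h" ?I] by simp
  also have "\<dots> \<le> L2_set (\<lambda>_. 1) ?I * L2_set (\<lambda>k. cmod (coeff h k)) ?I"
    by (rule L2_set_mult_ineq)
  also have "\<dots> \<le> L2_set (\<lambda>_. 1) ?I * l2 h"
    by (intro mult_left_mono L2_set_le_l2 L2_set_nonneg) simp
  finally have "1\<^sup>2 \<le> (L2_set (\<lambda>_. 1) ?I * l2 h)\<^sup>2"
    by (intro power_mono) auto
  also have "\<dots> = real (2 * K - 1) * tr (h * star h)"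
  proof -
    have "card ?I = 2 * K - 1" using K by (simp add: nat_diff_distrib)
    then have "(L2_set (\<lambda>_. 1 :: real) ?I)\<^sup>2 = real (2 * K - 1)"
      by (simp add: L2_set_def)
    then show ?thesis
      by (simp add: power_mult_distrib l2_def tr_self_star_nonneg)
  qed
  also have "\<dots> \<le> (2 * real K) * tr (h * star h)"
    by (intro mult_right_mono tr_self_star_nonneg) auto
  finally show ?thesis using K by (simp add: field_simps)
qed

text \<open>The square of the right side is the sixth moment of |P|. Expanding the square of
  \<open>P * (P * star P) - \<lambda> P\<close> bounds it below by 2 \<lambda> times the fourth
  moment minus \<lambda>^2 times the second, hence by (\<lambda> - \<lambda>^2) / K; the best choice
  is \<lambda> = 1/2.\<close>

lemma l2_packet_cubic:
  fixes N K :: nat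
  assumes K: "0 < K"
  defines "P \<equiv> packet N K"
  shows "1 / (2 * sqrt (real K)) \<le> l2 (P * (P * star P))"
proof -
  let ?h = "P * star P"
  let ?a = "P * ?h"
  have P: "tr (P * star P) = 1 / real K"
  proof -
    have "tr (P * star P) = (l2 P)\<^sup>2" by (simp add: l2_def tr_self_star_nonneg)
    then show ?thesis using K by (simp add: P_def l2_packet power_divide)
  qed
  have "0 \<le> tr ((?a - (1/2) *\<^sub>R P) * star (?a - (1/2) *\<^sub>R P))"
    by (rule tr_self_star_nonneg)
  also have "(?a - (1/2) *\<^sub>R P) * star (?a - (1/2) *\<^sub>R P)
      = ?a * star ?a - (1/2) *\<^sub>R (?h * star ?h) - (1/2) *\<^sub>R (?h * star ?h) + (1/4) *\<^sub>R (P * star P)"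
  proof -
    have ring: "(x - (1/2) *\<^sub>R p) * (y - (1/2) *\<^sub>R q)
        = x * y - (1/2) *\<^sub>R (x * q) - (1/2) *\<^sub>R (p * y) + (1/4) *\<^sub>R (p * q)" for x y p q :: wiener
      by (simp add: left_diff_distrib right_diff_distrib scaleR_diff_right)
    have "?a * star P = ?h * star ?h" "P * star ?a = ?h * star ?h"
      by (simp_all add: star_mult mult_ac)
    then show ?thesis
      unfolding star_diff star_scaleR ring by (simp only:)
  qed
  also have "tr \<dots> = tr (?a * star ?a) - tr (?h * star ?h) + (1/4) * tr (P * star P)"
    by (simp add: tr_def)
  finally have "1 / (4 * real K) \<le> tr (?a * star ?a)"
    using tr_packet_quartic[OF K, of N] P K unfolding P_def by (simp add: field_simps)
  then have "sqrt (1 / (4 * real K)) \<le> l2 ?a"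
    unfolding l2_def by (rule real_sqrt_le_mono)
  then show ?thesis by (simp add: real_sqrt_divide real_sqrt_mult)
qed

text \<open>The two phases differ by the factor \<open>exp x\<close> with x = - \<i> \<theta> |P|^2.
  Its linear term is bounded below through the sixth moment, the remainder costs \<theta>^2, and the
  change of amplitude costs \<delta>; the common unimodular phase drops out of the L^2 norm.\<close>

lemma l2_ode_sol_packet_diff:
  fixes a \<delta> t :: real and N K :: nat
  assumes K: "0 < K" and a: "0 \<le> a" and \<delta>: "0 \<le> \<delta>" and t: "0 \<le> t"
  defines "P \<equiv> packet N K" and "\<theta> \<equiv> t * a\<^sup>2 * ((1 + \<delta>)\<^sup>2 - 1)"
  assumes \<theta>: "\<theta> \<le> 1"
  shows "a / sqrt (real K) * (\<theta> / 2 - \<theta>\<^sup>2 - \<delta>) \<le> l2 (ode_sol (((1 + \<delta>) * a) *\<^sub>R P) t - ode_sol (a *\<^sub>R P) t)"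
proof -
  define h where "h = P * star P"
  define x where "x = - (\<theta> *\<^sub>R (J * h))"
  have "0 \<le> (1 + \<delta>)\<^sup>2 - 1" using \<delta> by (simp add: power2_eq_square algebra_simps)
  then have \<theta>0: "0 \<le> \<theta>" using t by (simp add: \<theta>_def)
  have "norm P \<le> 1" unfolding P_def by (rule norm_packet_le[OF K])
  then have "norm h \<le> 1"
    unfolding h_def using order_trans[OF norm_mult_ineq[of P "star P"]] mult_mono[of "norm P" 1 "norm P" 1] by simp
  then have nx: "norm x \<le> \<theta>" using \<theta>0 by (simp add: x_def mult_left_le)
  let ?e1 = "phase (a *\<^sub>R P) t" and ?e2 = "phase (((1 + \<delta>) * a) *\<^sub>R P) t"
  have ph: "phase (b *\<^sub>R P) t = exp (- ((t * b\<^sup>2) *\<^sub>R (J * h)))" for b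
    unfolding phase_def h_def by (simp add: star_scaleR power2_eq_square)
  have "t * ((1 + \<delta>) * a)\<^sup>2 = t * a\<^sup>2 + \<theta>"
    by (simp add: \<theta>_def power_mult_distrib right_diff_distrib)
  then have "?e2 = exp (- ((t * a\<^sup>2) *\<^sub>R (J * h)) + x)"
    unfolding ph by (simp add: x_def scaleR_add_left)
  also have "\<dots> = ?e1 * exp x"
    unfolding ph by (rule exp_add_commuting) (rule mult.commute)
  finally have e2: "?e2 = exp x * ?e1" by (simp add: mult.commute)
  have u: "P * (exp x - 1) = - (\<theta> *\<^sub>R (J * (P * h))) + (exp x - 1 - x) * P"
  proof -
    have "P * x = - (\<theta> *\<^sub>R (J * (P * h)))" by (simp add: x_def mult_ac)
    then show ?thesis by (simp add: right_diff_distrib left_diff_distrib mult.commute)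
  qed
  have R: "l2 ((exp x - 1 - x) * P) \<le> \<theta>\<^sup>2 / sqrt (real K)"
  proof -
    have "norm (exp x - 1 - x) \<le> (norm x)\<^sup>2"
      using norm_exp_remainder_le nx \<theta> by simp
    also have "\<dots> \<le> \<theta>\<^sup>2" using nx by (rule power_mono) simp
    finally have "norm (exp x - 1 - x) * l2 P \<le> \<theta>\<^sup>2 * l2 P"
      by (rule mult_right_mono) (rule l2_nonneg)
    then show ?thesis
      using l2_mult_le[of "exp x - 1 - x" P] by (simp add: P_def l2_packet[OF K])
  qed
  have M: "\<theta> / (2 * sqrt (real K)) \<le> l2 (- (\<theta> *\<^sub>R (J * (P * h))))"
  proof -
    have "l2 (J * (P * h)) = l2 (P * h)"
      using l2_unitary[of J "P * h"] J_squared by (simp add: star_J mult.commute)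
    then show ?thesis
      using mult_left_mono[OF l2_packet_cubic[OF K, of N] \<theta>0] \<theta>0 by (simp add: l2_minus l2_scaleR h_def P_def)
  qed
  have "l2 (- (\<theta> *\<^sub>R (J * (P * h)))) \<le> l2 (P * (exp x - 1)) + l2 ((exp x - 1 - x) * P)"
    using l2_triangle[of "P * (exp x - 1)" "- ((exp x - 1 - x) * P)"] unfolding l2_minus u by (simp add: l2_minus)
  then have main: "\<theta> / (2 * sqrt (real K)) - \<theta>\<^sup>2 / sqrt (real K) \<le> l2 (P * (exp x - 1))"
    using R M by linarith
  let ?D = "ode_sol (((1 + \<delta>) * a) *\<^sub>R P) t - ode_sol (a *\<^sub>R P) t"
  \<comment> \<open>Separates the pure phase difference at equal amplitude \<open>a\<close> from the
    extra amplitude \<open>\<delta> * a\<close> carried by the second solution.\<close>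
  have D: "a *\<^sub>R (P * (exp x - 1) * ?e1) = ?D + (- ((\<delta> * a) *\<^sub>R (P * ?e2)))"
  proof -
    have "P * (exp x - 1) * ?e1 = P * ?e2 - P * ?e1"
      unfolding e2 by (simp add: right_diff_distrib left_diff_distrib mult.assoc)
    moreover have "a *\<^sub>R (X - Y) = ((1 + \<delta>) * a) *\<^sub>R X - a *\<^sub>R Y + (- ((\<delta> * a) *\<^sub>R X))" for X Y :: wiener
      by (simp add: algebra_simps)
    ultimately show ?thesis
      by (simp only: ode_sol_def mult_scaleR_left)
  qed
  have "a * l2 (P * (exp x - 1)) = l2 (a *\<^sub>R (P * (exp x - 1) * ?e1))"
    using a by (simp add: l2_scaleR l2_unitary[OF phase_unitary])
  also have "\<dots> \<le> l2 ?D + l2 (- ((\<delta> * a) *\<^sub>R (P * ?e2)))"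
    unfolding D by (rule l2_triangle)
  also have "l2 (- ((\<delta> * a) *\<^sub>R (P * ?e2))) = \<delta> * a / sqrt (real K)"
    using a \<delta> by (simp add: l2_minus l2_scaleR l2_unitary[OF phase_unitary]) (simp add: P_def l2_packet[OF K])
  finally have "a * l2 (P * (exp x - 1)) - \<delta> * a / sqrt (real K) \<le> l2 ?D" by simp
  moreover have "a * (\<theta> / (2 * sqrt (real K)) - \<theta>\<^sup>2 / sqrt (real K)) \<le> a * l2 (P * (exp x - 1))"
    using main a by (rule mult_left_mono)
  ultimately show ?thesis by (simp add: algebra_simps)
qed

lemma packet_approximation:
  fixes b T \<eta> V :: real and N K :: nat
  defines "\<eta> \<equiv> b * exp (- (real N / real K)) * exp (T * (b\<^sup>2 * exp 1))" and "V \<equiv> b * exp (T * b\<^sup>2)"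
  assumes K: "0 < K" and b: "0 \<le> b"
    and der: "\<And>t. (c has_vector_derivative - (J * (absD (c t) + cubic (c t)))) (at t)"
    and B: "\<And>t. wle (pw 1) (c t) (B t)" and init: "c 0 = b *\<^sub>R packet N K"
    and small: "2 * K * \<eta> * T * exp (3 * (V + 1)\<^sup>2 * T) < 1" and t: "t \<in> {0..T}"
  shows "norm (shift t (c t) - ode_sol (b *\<^sub>R packet N K) t) \<le> 2 * K * \<eta> * T * exp (3 * (V + 1)\<^sup>2 * T)" (is ?A)
    and "wle (\<lambda>k. exp (- (of_int k / real K))) (ode_sol (b *\<^sub>R packet N K) t) \<eta>" (is ?B)
proof -
  let ?P = "packet N K"
  let ?f = "b *\<^sub>R ?P"
  let ?w = "\<lambda>k. exp (- (of_int k / real K))"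
  have h: "?f * star ?f = b\<^sup>2 *\<^sub>R (?P * star ?P)"
    by (simp add: star_scaleR power2_eq_square)
  have nP: "norm (?P * star ?P) \<le> 1"
    using norm_packet_le[OF K, of N] order_trans[OF norm_mult_ineq[of ?P "star ?P"]] mult_mono[of "norm ?P" 1 "norm ?P" 1] by simp
  have w: "wle ?w (ode_sol ?f s) \<eta>" if s: "s \<in> {0..T}" for s
  proof (rule wle_mono[OF wle_ode_sol[of ?w ?f "b * exp (- (real N / real K))" "b\<^sup>2 * exp 1" s]])
    show "?w (j + k) \<le> ?w j * ?w k" for j k
      by (simp add: exp_add[symmetric] add_divide_distrib)
    have "wle ?w ?P (exp (- (real N / real K)))"
    proof (rule wle_packet[OF _ _ K])
      fix k assume "int N \<le> k"
      then have "real N \<le> of_int k" by linarith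
      then show "?w k \<le> exp (- (real N / real K))" by (simp add: divide_right_mono)
    qed simp
    then show "wle ?w ?f (b * exp (- (real N / real K)))"
      using wle_scaleR[of ?w ?P _ b] b by simp
    \<comment> \<open>All frequencies of |P|^2 exceed - K, where the weight is at most e; beyond
      them the coefficients vanish.\<close>
    have "wle ?w (?P * star ?P) (exp 1)"
    proof (rule wleI)
      fix F :: "int set" assume F: "finite F"
      have "(\<Sum>k\<in>F. ?w k * cmod (coeff (?P * star ?P) k)) \<le> (\<Sum>k\<in>F. exp 1 * cmod (coeff (?P * star ?P) k))"
      proof (rule sum_mono)
        fix k show "?w k * cmod (coeff (?P * star ?P) k) \<le> exp 1 * cmod (coeff (?P * star ?P) k)"
        proof (cases "k \<in> {- int K<..<int K}")
          case True
          then have "- k \<le> int K" by auto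
          then have "- real_of_int k \<le> real K" by linarith
          then have "- (real_of_int k / real K) \<le> 1" using K by (simp add: field_simps)
          then show ?thesis by (intro mult_right_mono) auto
        qed (simp add: coeff_packet_star_eq_0)
      qed
      also have "\<dots> \<le> exp 1 * 1"
        unfolding sum_distrib_left[symmetric]
        by (intro mult_left_mono order_trans[OF sum_coeff_le_norm[OF F] nP]) simp
      finally show "(\<Sum>k\<in>F. ?w k * cmod (coeff (?P * star ?P) k)) \<le> exp 1" by simp
    qed
    then show "wle ?w (?f * star ?f) (b\<^sup>2 * exp 1)"
      unfolding h using wle_scaleR[of ?w "?P * star ?P" _ "b\<^sup>2"] by simp
    show "b * exp (- (real N / real K)) * exp (s * (b\<^sup>2 * exp 1)) \<le> \<eta>"
      unfolding \<eta>_def using b s by (intro mult_left_mono) (auto intro!: mult_right_mono)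
  qed (use s in auto)
  show ?B by (rule w[OF t])
  have "norm (shift t (c t) - ode_sol ?f t) \<le> (2 * K * \<eta>) * T * exp (3 * (V + 1)\<^sup>2 * T)"
  proof (rule ode_approximation[OF der B ode_sol_derivative _ _ _ small t])
    show "ode_sol ?f 0 = c 0" by (simp add: ode_sol_0 init)
    fix s assume s: "s \<in> {0..T}"
    have "wle (\<lambda>_. 1) (ode_sol ?f s) (b * exp (s * b\<^sup>2))"
    proof (rule wle_ode_sol)
      have "norm ?f \<le> b"
        using norm_packet_le[OF K, of N] b by (simp add: mult_left_le)
      then show "wle (\<lambda>_. 1) ?f b" by (rule wle_mono[OF wle_norm])
      have "norm (?f * star ?f) \<le> b\<^sup>2"
        unfolding h using nP by (simp add: mult_left_le)
      then show "wle (\<lambda>_. 1) (?f * star ?f) (b\<^sup>2)" by (rule wle_mono[OF wle_norm])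
    qed (use s in auto)
    from wle_imp_norm[OF this] have "norm (ode_sol ?f s) \<le> b * exp (s * b\<^sup>2)" .
    also have "\<dots> \<le> V"
      unfolding V_def using b s by (intro mult_left_mono) (auto intro!: mult_right_mono)
    finally show "norm (ode_sol ?f s) \<le> V" .
    show "wle (\<lambda>k. of_int (\<bar>k\<bar> - k)) (ode_sol ?f s) (2 * K * \<eta>)"
    proof (rule wleI)
      fix F :: "int set" assume F: "finite F"
      have "(\<Sum>k\<in>F. of_int (\<bar>k\<bar> - k) * cmod (coeff (ode_sol ?f s) k))
          \<le> (\<Sum>k\<in>F. (2 * K) * (?w k * cmod (coeff (ode_sol ?f s) k)))"
      proof (rule sum_mono)
        fix k :: int
        \<comment> \<open>For k < 0 the left side is 2 |k|, and x \<le> exp x at x = |k| / K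
          produces the factor \<open>2 * K\<close>. This exchanges the derivative for the
          exponential weight.\<close>
        have "of_int (\<bar>k\<bar> - k) \<le> 2 * real K * ?w k"
        proof (cases "0 \<le> k")
          case False
          have "- (of_int k / real K) \<le> ?w k"
            using exp_ge_add_one_self[of "- (of_int k / real K)"] by simp
          then have "real K * (- (of_int k / real K)) \<le> real K * ?w k"
            by (rule mult_left_mono) simp
          then show ?thesis using K False by simp
        qed simp
        then have "of_int (\<bar>k\<bar> - k) * cmod (coeff (ode_sol ?f s) k) \<le> (2 * real K * ?w k) * cmod (coeff (ode_sol ?f s) k)"
          by (rule mult_right_mono) simp
        then show "of_int (\<bar>k\<bar> - k) * cmod (coeff (ode_sol ?f s) k) \<le> (2 * K) * (?w k * cmod (coeff (ode_sol ?f s) k))"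
          by (simp only: mult.assoc)
      qed
      also have "\<dots> \<le> 2 * K * \<eta>"
        unfolding sum_distrib_left[symmetric] by (intro mult_left_mono wleD[OF w[OF s] F]) simp
      finally show "(\<Sum>k\<in>F. of_int (\<bar>k\<bar> - k) * cmod (coeff (ode_sol ?f s) k)) \<le> 2 * K * \<eta>" .
    qed
  qed
  then show ?A .
qed

text \<open>The cut at N / 2 is a compromise: below it, removing the weight gives back only exp(N /
  (2 K)) of the gain exp(- N / K), and above it the Sobolev weight is still at least (N / 2)^(2 s).
  All negative frequencies count as low.\<close>

definition low :: "nat \<Rightarrow> wiener \<Rightarrow> wiener" where
  "low N = fmult (\<lambda>k. if 2 * k < int N then 1 else 0)"

lemma coeff_low: "coeff (low N a) k = (if 2 * k < int N then coeff a k else 0)"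
  unfolding low_def by (subst coeff_fmult[where C = 1]) auto

lemma norm_diff_low_le: "norm (a - low N a) \<le> norm a"
proof (rule norm_leI)
  fix F :: "int set" assume F: "finite F"
  have "(\<Sum>k\<in>F. cmod (coeff (a - low N a) k)) \<le> (\<Sum>k\<in>F. cmod (coeff a k))"
    by (rule sum_mono) (simp add: coeff_low)
  then show "(\<Sum>k\<in>F. cmod (coeff (a - low N a) k)) \<le> norm a"
    using sum_coeff_le_norm[OF F, of a] by simp
qed

lemma norm_low_le:
  assumes "wle (\<lambda>k. exp (- (of_int k / real K))) a \<eta>"
  shows "norm (low N a) \<le> exp (real N / (2 * real K)) * \<eta>"
proof (rule norm_leI)
  fix F :: "int set" assume F: "finite F"
  let ?w = "\<lambda>k. exp (- (of_int k / real K))"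
  have "(\<Sum>k\<in>F. cmod (coeff (low N a) k)) \<le> (\<Sum>k\<in>F. exp (real N / (2 * real K)) * (?w k * cmod (coeff a k)))"
  proof (rule sum_mono)
    fix k
    show "cmod (coeff (low N a) k) \<le> exp (real N / (2 * real K)) * (?w k * cmod (coeff a k))"
    proof (cases "2 * k < int N")
      case True
      then have "real_of_int k \<le> real N / 2" by linarith
      then have "of_int k / real K \<le> real N / 2 / real K" by (rule divide_right_mono) simp
      then have "1 \<le> exp (real N / (2 * real K)) * ?w k"
        by (simp add: exp_add[symmetric])
      then have "1 * cmod (coeff a k) \<le> exp (real N / (2 * real K)) * ?w k * cmod (coeff a k)"
        by (rule mult_right_mono) simp
      then show ?thesis using True by (simp add: coeff_low mult.assoc)
    qed (simp add: coeff_low)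
  qed
  also have "\<dots> \<le> exp (real N / (2 * real K)) * \<eta>"
    unfolding sum_distrib_left[symmetric] by (intro mult_left_mono wleD[OF assms F]) simp
  finally show "(\<Sum>k\<in>F. cmod (coeff (low N a) k)) \<le> exp (real N / (2 * real K)) * \<eta>" .
qed

lemma low_diff: "low N (a - b) = low N a - low N b"
  by (rule wiener_eqI) (simp add: coeff_low)

lemma l2_high_shift: "l2 (shift t a - low N (shift t a)) = l2 (a - low N a)"
proof (rule power2_eq_imp_eq)
  have "cmod (coeff (shift t a - low N (shift t a)) k) = cmod (coeff (a - low N a) k)" for k
    by (simp add: coeff_low coeff_shift norm_mult)
  then show "(l2 (shift t a - low N (shift t a)))\<^sup>2 = (l2 (a - low N a))\<^sup>2"
    unfolding l2_squared by simp
qed (simp_all add: l2_nonneg)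

lemma sobolev_norm_high:
  assumes "wle (pw m) a B" "s \<le> real m / 2" "0 \<le> s" "0 < N"
  shows "(real N / 2) powr s * l2 (a - low N a) \<le> sobolev_norm s (ev a)"
proof -
  have "((real N / 2) powr s)\<^sup>2 * (l2 (a - low N a))\<^sup>2 = (\<Sum>\<^sub>\<infinity>k. ((real N / 2) powr s)\<^sup>2 * (cmod (coeff (a - low N a) k))\<^sup>2)"
    unfolding l2_squared by (rule infsum_cmult_right'[symmetric])
  also have "\<dots> \<le> (\<Sum>\<^sub>\<infinity>k. (1 + (of_int k)\<^sup>2) powr s * (cmod (coeff a k))\<^sup>2)"
  proof (rule infsum_mono)
    fix k :: int
    show "((real N / 2) powr s)\<^sup>2 * (cmod (coeff (a - low N a) k))\<^sup>2 \<le> (1 + (of_int k)\<^sup>2) powr s * (cmod (coeff a k))\<^sup>2"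
    proof (cases "2 * k < int N")
      case False
      then have "real N / 2 \<le> of_int k" by linarith
      then have "(real N / 2)\<^sup>2 \<le> (of_int k)\<^sup>2"
        by (rule power_mono) simp
      then have "(real N / 2)\<^sup>2 \<le> 1 + (of_int k)\<^sup>2"
        by linarith
      then have "((real N / 2)\<^sup>2) powr s \<le> (1 + (of_int k)\<^sup>2) powr s"
        using assms by (intro powr_mono2) auto
      moreover have "((real N / 2)\<^sup>2) powr s = ((real N / 2) powr s)\<^sup>2"
        unfolding power2_eq_square by (subst powr_mult) simp_all
      ultimately show ?thesis using False by (simp add: coeff_low mult_right_mono)
    qed (simp add: coeff_low)
  qed (intro summable_on_cmult_right summable_coeff_squared sobolev_summable[OF assms(1,2)])+
  finally have "sqrt (((real N / 2) powr s * l2 (a - low N a))\<^sup>2) \<le> sobolev_norm s (ev a)"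
    unfolding sobolev_norm_ev power_mult_distrib by (rule real_sqrt_le_mono)
  then show ?thesis by (simp add: l2_nonneg)
qed

lemma l2_high_lower_bound:
  assumes "norm (Z - D) \<le> e" "norm (low N D) \<le> q"
  shows "l2 D - q - e \<le> l2 (Z - low N Z)"
proof -
  have eq: "D = (Z - low N Z) + (low N D + ((D - Z) - low N (D - Z)))"
    by (simp add: low_diff)
  have "l2 D \<le> l2 (Z - low N Z) + (l2 (low N D) + l2 ((D - Z) - low N (D - Z)))"
    by (subst eq) (intro order_trans[OF l2_triangle] add_left_mono l2_triangle)
  also have "l2 (low N D) \<le> q"
    using l2_le_norm assms(2) by (rule order_trans)
  also have "l2 ((D - Z) - low N (D - Z)) \<le> e"
    using l2_le_norm[of "(D - Z) - low N (D - Z)"] norm_diff_low_le[of "D - Z" N] assms(1)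
    by (simp add: norm_minus_commute)
  finally show ?thesis by simp
qed

section \<open>Smooth data, the norm in time, and the choice of parameters\<close>

lemma smooth_torus_ev:
  assumes "proj M a = a"
  shows "ev a \<in> smooth_torus"
proof -
  define D where "D = fmult (\<lambda>k. if \<bar>k\<bar> \<le> int M then \<i> * of_int k else 0)"
  have coeff_D: "coeff (D a) k = (if \<bar>k\<bar> \<le> int M then \<i> * of_int k * coeff a k else 0)" for a k
    unfolding D_def by (subst coeff_fmult[where C = "real M"]) (auto simp: norm_mult)
  have ev_sum: "ev b x = (\<Sum>k\<in>{- int M..int M}. coeff b k * cis (of_int k * x))" if "proj M b = b" for b x
  proof -
    have "b = (\<Sum>k\<in>{- int M..int M}. monomial k (coeff b k))"
      using coeff_eq_0_of_proj[OF that] by (intro wiener_eqI) (simp add: coeff_sum coeff_monomial)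
    then have "ev b x = ev (\<Sum>k\<in>{- int M..int M}. monomial k (coeff b k)) x" by simp
    also have "\<dots> = (\<Sum>k\<in>{- int M..int M}. ev (monomial k (coeff b k)) x)"
      by (rule linear_sum[OF bounded_linear.linear[OF bounded_linear_ev]])
    finally show ?thesis by (simp add: ev_monomial)
  qed
  have proj_D: "proj M (D b) = D b" for b
    by (rule wiener_eqI) (simp add: coeff_proj coeff_D)
  have der: "(ev b has_vector_derivative ev (D b) x) (at x)" if "proj M b = b" for b x
  proof -
    have "((\<lambda>x. \<Sum>k\<in>{- int M..int M}. coeff b k * cis (of_int k * x)) has_vector_derivative
        (\<Sum>k\<in>{- int M..int M}. coeff b k * (\<i> * of_real (of_int k) * cis (of_int k * x)))) (at x)"
      by (intro has_vector_derivative_sum has_vector_derivative_mult_right cis_has_vector_derivative)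
    moreover have "(\<Sum>k\<in>{- int M..int M}. coeff b k * (\<i> * of_real (of_int k) * cis (of_int k * x))) = ev (D b) x"
      unfolding ev_sum[OF proj_D] by (rule sum.cong) (auto simp: coeff_D)
    ultimately show ?thesis
      by (simp add: ev_sum[OF that, abs_def])
  qed
  have "\<exists>b. proj M b = b \<and> ((\<lambda>g y. vector_derivative g (at y)) ^^ m) (ev a) = ev b" for m
  proof (induction m)
    case (Suc m)
    then obtain b where b: "proj M b = b" "((\<lambda>g y. vector_derivative g (at y)) ^^ m) (ev a) = ev b" by blast
    then have "((\<lambda>g y. vector_derivative g (at y)) ^^ Suc m) (ev a) = ev (D b)"
      by (simp add: b(2) vector_derivative_at[OF der[OF b(1)]])
    then show ?case using proj_D by blast
  qed (use assms in auto)
  then have "((\<lambda>g y. vector_derivative g (at y)) ^^ m) (ev a) differentiable (at x)" for m x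
    using differentiableI_vector[OF der] by metis
  then show ?thesis
    by (simp add: smooth_torus_def periodic_ev)
qed

text \<open>An essential supremum ignores single times, so the lower bound has to hold on a
  nondegenerate interval, which has positive measure.\<close>

lemma Linf_sobolev_norm_ge:
  assumes t: "0 \<le> t0" "t0 < t1" "t1 \<le> T" and le: "\<And>t. t \<in> {t0..t1} \<Longrightarrow> c \<le> sobolev_norm s (v t)"
  shows "ereal c \<le> Linf_sobolev_norm T s v"
proof (rule ccontr)
  let ?E = "Linf_sobolev_norm T s v"
  assume "\<not> ereal c \<le> ?E"
  then have less: "?E < ereal c" by simp
  have "AE t in restrict_space lebesgue {0..T}. ereal (sobolev_norm s (v t)) \<le> ?E"
    unfolding Linf_sobolev_norm_def by (rule esssup_AE)
  then have "AE t in lebesgue. t \<in> {0..T} \<longrightarrow> ereal (sobolev_norm s (v t)) \<le> ?E"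
    by (subst (asm) AE_restrict_space_iff) auto
  then have "AE t in lebesgue. t \<notin> {t0..t1}"
  proof (rule AE_mp, intro AE_I2 impI)
    fix r assume r: "r \<in> {0..T} \<longrightarrow> ereal (sobolev_norm s (v r)) \<le> ?E"
    show "r \<notin> {t0..t1}"
    proof
      assume "r \<in> {t0..t1}"
      then have "ereal (sobolev_norm s (v r)) \<le> ?E" "ereal c \<le> ereal (sobolev_norm s (v r))"
        using r t le[of r] by auto
      then show False using less by (meson less_le_not_le order_trans)
    qed
  qed
  then have "{t0..t1} \<in> null_sets lebesgue"
    by (subst AE_iff_null_sets) auto
  then show False using t by (auto simp: null_sets_def)
qed

text \<open>The 4096 is 64^2, for an amplitude of at least 64. In the last condition exp(2 sqrt(ln N
  + 1)) grows more slowly than any power of N, while the subtracted quotient is of size N^(1 - 2 s)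
  / ln N. The additional 1 in each place leaves room for rounding the packet width up to an
  integer.\<close>

lemma eventually_parameters:
  assumes "1/4 < s" "s < 1/2"
  shows "\<forall>\<^sub>F N :: nat in sequentially. 4096 \<le> ln (real N) \<and> N powr (2 * s) * ln N + 1 \<le> N \<and>
    (real N)\<^sup>2 * exp (6 * exp (2 * sqrt (ln N + 1)) - N / (2 * (N powr (2 * s) * ln N + 1))) \<le> 1/1000"
proof -
  have s: "2 * s < 1" "0 < s" using assms by auto
  have "((\<lambda>N. (N powr (2 * s) * ln N + 1) / N) \<longlongrightarrow> 0) at_top"
    using s by real_asymp
  then have 1: "\<forall>\<^sub>F N :: real in at_top. (N powr (2 * s) * ln N + 1) / N < 1"
    by (rule order_tendstoD) simp
  have "((\<lambda>N :: real. N\<^sup>2 * exp (6 * exp (2 * sqrt (ln N + 1)) - N / (2 * (N powr (2 * s) * ln N + 1)))) \<longlongrightarrow> 0) at_top"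
    using s by real_asymp
  then have 2: "\<forall>\<^sub>F N :: real in at_top. N\<^sup>2 * exp (6 * exp (2 * sqrt (ln N + 1)) - N / (2 * (N powr (2 * s) * ln N + 1))) < 1/1000"
    by (rule order_tendstoD) simp
  have 3: "\<forall>\<^sub>F N :: real in at_top. 4096 \<le> ln N"
    by real_asymp
  have "\<forall>\<^sub>F N :: real in at_top. 4096 \<le> ln N \<and> N powr (2 * s) * ln N + 1 \<le> N \<and>
    N\<^sup>2 * exp (6 * exp (2 * sqrt (ln N + 1)) - N / (2 * (N powr (2 * s) * ln N + 1))) \<le> 1/1000"
    using 1 2 3 eventually_gt_at_top[of 0] by eventually_elim (auto simp: divide_simps)
  then show ?thesis
    using filterlim_real_sequentially by (rule eventually_compose_filterlim)
qed

lemma sobolev_norm_scaleR: "sobolev_norm s (ev (r *\<^sub>R a)) = \<bar>r\<bar> * sobolev_norm s (ev a)"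
proof -
  have "(1 + (real_of_int k)\<^sup>2) powr s * (cmod (coeff (r *\<^sub>R a) k))\<^sup>2 = r\<^sup>2 * ((1 + (of_int k)\<^sup>2) powr s * (cmod (coeff a k))\<^sup>2)" for k
    by (simp add: norm_mult power_mult_distrib)
  then have "(\<Sum>\<^sub>\<infinity>k. (1 + (real_of_int k)\<^sup>2) powr s * (cmod (coeff (r *\<^sub>R a) k))\<^sup>2)
      = r\<^sup>2 * (\<Sum>\<^sub>\<infinity>k. (1 + (of_int k)\<^sup>2) powr s * (cmod (coeff a k))\<^sup>2)"
    by (simp only: infsum_cmult_right')
  then show ?thesis by (simp add: sobolev_norm_ev real_sqrt_mult)
qed

text \<open>Since K \<le> N, all frequencies of the packet are at most 2 N, where 1 + k^2 \<le> 5
  N^2; the power 5^s is then estimated generously by 25 = 5^2.\<close>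

lemma sobolev_norm_packet_le:
  assumes K: "0 < K" "K \<le> N" and s: "0 \<le> s" "s \<le> 1"
  shows "sobolev_norm s (ev (packet N K)) \<le> 5 * (N powr s / sqrt K)"
proof -
  have N: "0 < N" using K by simp
  have "(\<Sum>\<^sub>\<infinity>k. (1 + (real_of_int k)\<^sup>2) powr s * (cmod (coeff (packet N K) k))\<^sup>2)
      = (\<Sum>k\<in>{int N..<int N + int K}. (1 + (real_of_int k)\<^sup>2) powr s * (cmod (1 / of_nat K))\<^sup>2)"
    by (rule infsum_packet) simp
  also have "\<dots> \<le> (\<Sum>k\<in>{int N..<int N + int K}. (5 * N powr s)\<^sup>2 * (1 / real K)\<^sup>2)"
  proof (rule sum_mono)
    fix k assume k: "k \<in> {int N..<int N + int K}"
    have "1 \<le> real N" "0 \<le> real_of_int k" "real_of_int k \<le> 2 * real N"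
      using k K N by auto
    then have "1 + (real_of_int k)\<^sup>2 \<le> (real N)\<^sup>2 + (2 * real N)\<^sup>2"
      by (intro add_mono power_mono) auto
    then have "(1 + (real_of_int k)\<^sup>2) powr s \<le> (5 * (N * real N)) powr s"
      using s by (intro powr_mono2) (auto simp: power2_eq_square)
    also have "\<dots> = 5 powr s * (N powr s)\<^sup>2"
      using N by (simp add: powr_mult power2_eq_square)
    also have "\<dots> \<le> 25 * (N powr s)\<^sup>2"
      using powr_mono[of s 1 "5 :: real"] s by (intro mult_right_mono) auto
    finally have "(1 + (real_of_int k)\<^sup>2) powr s \<le> (5 * N powr s)\<^sup>2"
      by (simp add: power_mult_distrib)
    then show "(1 + (real_of_int k)\<^sup>2) powr s * (cmod (1 / of_nat K))\<^sup>2 \<le> (5 * N powr s)\<^sup>2 * (1 / real K)\<^sup>2"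
      by (simp add: norm_divide mult_right_mono)
  qed
  also have "\<dots> = (5 * (N powr s / sqrt K))\<^sup>2"
    using K by (simp add: power_mult_distrib power_divide power2_eq_square)
  finally show ?thesis
    unfolding sobolev_norm_ev by (simp add: real_le_lsqrt)
qed

lemma proj_packet: "proj (N + K) (packet N K) = packet N K"
  by (rule proj_eqI) (auto simp: coeff_packet)

lemma proj_scaleR: "proj M a = a \<Longrightarrow> proj M (r *\<^sub>R a) = r *\<^sub>R a"
  using linear_scale[OF bounded_linear.linear[OF bounded_linear_proj], of M r a] by simp

text \<open>Amplitude \<open>a\<close> and width \<open>K\<close> are linked to the frequency \<open>N\<close> by \<open>a N\<^sup>s = \<surd>K\<close>, which keeps the
  \<open>H\<^sup>s\<close> norm bounded, and \<open>a \<approx> \<surd>(ln N)\<close>; this growth is slow enough for the exponential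
  Gronwall losses to be beaten by \<open>exp (- N / K)\<close>, because \<open>K \<ll> N\<close> for \<open>s < 1/2\<close>.\<close>

lemma decoherence:
  fixes a s t :: real and N K :: nat
  assumes K: "0 < K" and N: "0 < N" and KN: "K \<le> N" and a: "64 \<le> a" and aK: "a = N powr (- s) * sqrt K" and s: "0 \<le> s" "s < 1/2"
    and small: "(real N)\<^sup>2 * exp (6 * exp (2 * a) - N / (2 * K)) \<le> 1/1000"
    and t: "1 / (8 * (2 * a + 1)) \<le> t" "t \<le> 1 / (4 * (2 * a + 1))"
    and c: "\<And>t. (c has_vector_derivative - (J * (absD (c t) + cubic (c t)))) (at t)" "c 0 = a *\<^sub>R packet N K"
      "\<And>m T t. \<bar>t\<bar> \<le> T \<Longrightarrow> wle (pw m) (c t) (B m T)"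
    and c': "\<And>t. (c' has_vector_derivative - (J * (absD (c' t) + cubic (c' t)))) (at t)" "c' 0 = (a + 1) *\<^sub>R packet N K"
      "\<And>m T t. \<bar>t\<bar> \<le> T \<Longrightarrow> wle (pw m) (c' t) (B' m T)"
  shows "1/128 \<le> sobolev_norm s (ev (c t - c' t))"
proof -
  let ?P = "packet N K"
  \<comment> \<open>Up to this time the phase parameter \<open>t * (2 * a + 1)\<close> stays at most
    1/4; the admissible times form the interval from T / 2 to T, where it is at least 1/8.\<close>
  define T where "T = 1 / (4 * (2 * a + 1))"
  have T0: "0 < T" "T \<le> 1 / (8 * a)" using a by (auto simp: T_def field_simps)
  have t0: "0 \<le> t" using t(1) a by (intro order_trans[OF _ t(1)]) simp
  have tT: "t \<in> {0..T}" using t t0 by (simp add: T_def)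
  \<comment> \<open>One quantity for all errors. Only half of the exponent N / K is kept, because
    removing the weight below N / 2 uses up the other half; the prefactor \<open>N\<close> dominates
    the loss of order \<open>K\<close> from the derivative.\<close>
  define G where "G = N * exp (6 * exp (2 * a) - N / (2 * K))"
  have G: "0 \<le> G" "real N * G \<le> 1/1000"
    using small by (auto simp: G_def power2_eq_square mult.assoc)
  have G1: "G \<le> 1/1000"
    using G N mult_right_mono[of 1 "real N" G] by simp
  have approx: "norm (shift t (d t) - ode_sol (b *\<^sub>R ?P) t) \<le> G \<and> norm (low N (ode_sol (b *\<^sub>R ?P) t)) \<le> 2 * G"
    if b: "a \<le> b" "b \<le> a + 1" and d: "\<And>t. (d has_vector_derivative - (J * (absD (d t) + cubic (d t)))) (at t)"
      "\<And>t. wle (pw 1) (d t) (A t)" "d 0 = b *\<^sub>R ?P" for b d A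
  proof -
    have b0: "0 \<le> b" "b \<le> 2 * a" using a b by auto
    have "b\<^sup>2 \<le> (a + 1)\<^sup>2" using b0 b by (intro power_mono) auto
    also have "\<dots> \<le> 2 * a * (2 * a + 1)"
      using a mult_mono[of 1 a 1 a] by (simp add: power2_eq_square algebra_simps)
    finally have "T * b\<^sup>2 \<le> T * (2 * a * (2 * a + 1))"
      using T0 by (intro mult_left_mono) auto
    also have "\<dots> = a / 2" using a by (simp add: T_def field_simps)
    \<comment> \<open>With \<open>T\<close> of order 1 / a the exponent is linear in
      \<open>a\<close> instead of quadratic, which keeps the Gronwall exponent below 4 exp(2
      a).\<close>
    finally have Tb: "T * b\<^sup>2 \<le> a / 2" .
    define \<eta> where "\<eta> = b * exp (- (real N / real K)) * exp (T * (b\<^sup>2 * exp 1))"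
    define V where "V = b * exp (T * b\<^sup>2)"
    have "T * (b\<^sup>2 * exp 1) \<le> a / 2 * 3"
      unfolding mult.assoc[symmetric] using Tb T0 exp_le a by (intro mult_mono) auto
    then have \<eta>: "\<eta> \<le> 2 * a * exp (- (real N / real K)) * exp (3 / 2 * a)"
      unfolding \<eta>_def using b0 by (intro mult_mono) auto
    have "V \<le> 2 * a * exp (a / 2)"
      unfolding V_def using b0 Tb by (intro mult_mono) auto
    moreover have "1 \<le> a * exp (a / 2)"
      using a mult_mono[of 1 a 1 "exp (a / 2)"] by simp
    ultimately have "V + 1 \<le> 3 * (a * exp (a / 2))" by simp
    then have "(V + 1)\<^sup>2 \<le> (3 * (a * exp (a / 2)))\<^sup>2"
      using b0 by (intro power_mono) (auto simp: V_def)
    also have "\<dots> = 9 * a\<^sup>2 * exp a"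
      by (simp add: power_mult_distrib flip: exp_of_nat_mult)
    finally have "3 * (V + 1)\<^sup>2 * T \<le> 3 * (9 * a\<^sup>2 * exp a) * (1 / (8 * a))"
      using T0 by (intro mult_mono) auto
    also have "\<dots> \<le> 4 * (a * exp a)"
      using a by (simp add: power2_eq_square)
    also have "\<dots> \<le> 4 * (exp a * exp a)"
    proof -
      have "a \<le> exp a" using exp_ge_add_one_self[of a] by linarith
      then show ?thesis by (intro mult_left_mono mult_right_mono) auto
    qed
    also have "\<dots> = 4 * exp (2 * a)"
      by (simp flip: exp_add)
    finally have growth: "3 * (V + 1)\<^sup>2 * T \<le> 4 * exp (2 * a)" .
    \<comment> \<open>Absorbs the terms linear in \<open>a\<close> into the exponent 6 exp(2 a) of
      \<open>G\<close>.\<close>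
    have a2: "a \<le> exp (2 * a) / 2"
      using exp_ge_add_one_self[of "2 * a"] by linarith
    have \<eta>0: "0 \<le> \<eta>" using b0 by (simp add: \<eta>_def)
    have "2 * K * \<eta> * T * exp (3 * (V + 1)\<^sup>2 * T)
        \<le> 2 * K * (2 * a * exp (- (real N / real K)) * exp (3 / 2 * a)) * (1 / (8 * a)) * exp (4 * exp (2 * a))"
      using \<eta> \<eta>0 T0 growth a by (intro mult_mono) auto
    also have "\<dots> = K / 2 * exp (- (real N / real K) + 3 / 2 * a + 4 * exp (2 * a))"
      using a by (simp only: exp_add) (simp add: field_simps)
    also have "\<dots> \<le> N * exp (6 * exp (2 * a) - N / (2 * K))"
    proof (intro mult_mono)
      have "real N / (2 * real K) \<le> real N / real K"
        using K by (intro frac_le) auto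
      then have "- (real N / real K) + 3 / 2 * a + 4 * exp (2 * a) \<le> 6 * exp (2 * a) - N / (2 * K)"
        using a2 exp_ge_zero[of "2 * a"] by linarith
      then show "exp (- (real N / real K) + 3 / 2 * a + 4 * exp (2 * a)) \<le> exp (6 * exp (2 * a) - N / (2 * K))"
        by (simp only: exp_le_cancel_iff)
    qed (use KN in auto)
    finally have err: "2 * K * \<eta> * T * exp (3 * (V + 1)\<^sup>2 * T) \<le> G" by (simp add: G_def)
    note pa = packet_approximation[of K b d A N T t, OF K b0(1) d, folded \<eta>_def V_def]
    have small': "2 * K * \<eta> * T * exp (3 * (V + 1)\<^sup>2 * T) < 1"
      using err G1 by linarith
    have "norm (shift t (d t) - ode_sol (b *\<^sub>R ?P) t) \<le> G"
      using pa(1)[OF small' tT] err by linarith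
    moreover have "norm (low N (ode_sol (b *\<^sub>R ?P) t)) \<le> exp (real N / (2 * real K)) * \<eta>"
      by (rule norm_low_le[OF pa(2)[OF small' tT]])
    moreover have "exp (real N / (2 * real K)) * \<eta> \<le> 2 * G"
    proof -
      have "exp (real N / (2 * real K)) * \<eta> \<le> exp (real N / (2 * real K)) * (2 * exp (2 * a) * exp (- (real N / real K)) * exp (3 / 2 * a))"
      proof (intro mult_left_mono order_trans[OF \<eta>] mult_right_mono)
        show "a \<le> exp (2 * a)" using exp_ge_add_one_self[of "2 * a"] a by linarith
      qed auto
      also have "\<dots> = 2 * exp (2 * a + 3 / 2 * a - real N / (2 * real K))"
      proof -
        have "real N / (2 * real K) + - (real N / real K) = - (real N / (2 * real K))"
          using K by (simp add: field_simps)
        then have "exp (real N / (2 * real K)) * exp (- (real N / real K)) = exp (- (real N / (2 * real K)))"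
          by (simp only: exp_add[symmetric])
        moreover have "x * (2 * p * y * q) = 2 * (p * q * (x * y))" for x y p q :: real
          by (simp only: mult_ac)
        ultimately show ?thesis
          by (simp only: exp_add diff_conv_add_uminus)
      qed
      also have "\<dots> \<le> 2 * (1 * exp (6 * exp (2 * a) - N / (2 * K)))"
      proof -
        have "2 * a + 3 / 2 * a - real N / (2 * real K) \<le> 6 * exp (2 * a) - N / (2 * K)"
          using a2 exp_ge_zero[of "2 * a"] by linarith
        then show ?thesis by simp
      qed
      also have "\<dots> \<le> 2 * G"
        unfolding G_def using N by (intro mult_left_mono mult_right_mono) auto
      finally show ?thesis .
    qed
    ultimately show ?thesis by linarith
  qed
  have ap: "norm (shift t (c t) - ode_sol (a *\<^sub>R ?P) t) \<le> G" "norm (low N (ode_sol (a *\<^sub>R ?P) t)) \<le> 2 * G"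
    using approx[of a c "\<lambda>t. B 1 \<bar>t\<bar>"] c by auto
  have ap': "norm (shift t (c' t) - ode_sol ((a + 1) *\<^sub>R ?P) t) \<le> G" "norm (low N (ode_sol ((a + 1) *\<^sub>R ?P) t)) \<le> 2 * G"
    using approx[of "a + 1" c' "\<lambda>t. B' 1 \<bar>t\<bar>"] c' by auto
  define D where "D = ode_sol ((a + 1) *\<^sub>R ?P) t - ode_sol (a *\<^sub>R ?P) t"
  define Z where "Z = shift t (c' t - c t)"
  define \<theta> where "\<theta> = t * (2 * a + 1)"
  have \<theta>: "1/8 \<le> \<theta>" "\<theta> \<le> 1/4"
    using t a by (auto simp: \<theta>_def field_simps)
  have \<theta>_eq: "t * a\<^sup>2 * ((1 + 1 / a)\<^sup>2 - 1) = \<theta>"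
    using a by (simp add: \<theta>_def power2_eq_square field_simps)
  have raw: "a / sqrt (real K) * (\<theta> / 2 - \<theta>\<^sup>2 - 1 / a) \<le> l2 (ode_sol (((1 + 1 / a) * a) *\<^sub>R ?P) t - ode_sol (a *\<^sub>R ?P) t)"
    using l2_ode_sol_packet_diff[OF K, of a "1 / a" t N] t0 a \<theta> unfolding \<theta>_eq by auto
  have e1: "(1 + 1 / a) * a = a + 1" using a by (simp add: field_simps)
  have e2: "a / sqrt (real K) = N powr (- s)" using aK K by simp
  \<comment> \<open>The function \<theta> / 2 - \<theta>^2 is concave, so on [1/8, 1/4] it is least
    at an endpoint, namely 3/64 at \<theta> = 1/8. The requirement \<open>64 \<le> a\<close> makes
    the amplitude loss at most 1/64.\<close>
  have X: "1 / 32 \<le> \<theta> / 2 - \<theta>\<^sup>2 - 1 / a"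
  proof -
    have "0 \<le> (\<theta> - 1/8) * (1/4 - \<theta>)" using \<theta> by (intro mult_nonneg_nonneg) auto
    then have "\<theta>\<^sup>2 \<le> 3/8 * \<theta> - 1/32" by (simp add: power2_eq_square algebra_simps)
    moreover have "1 / a \<le> 1/64" using a by (simp add: field_simps)
    ultimately show ?thesis using \<theta> by simp
  qed
  have l2D: "N powr (- s) * (1/32) \<le> l2 D"
    using order_trans[OF mult_left_mono[OF X, of "N powr (- s)"] raw[unfolded e1 e2]] by (simp add: D_def)
  have "norm (Z - D) \<le> 2 * G"
  proof -
    have "Z - D = (shift t (c' t) - ode_sol ((a + 1) *\<^sub>R ?P) t) - (shift t (c t) - ode_sol (a *\<^sub>R ?P) t)"
      by (simp add: Z_def D_def shift_diff)
    then have "norm (Z - D) \<le> norm (shift t (c' t) - ode_sol ((a + 1) *\<^sub>R ?P) t) + norm (shift t (c t) - ode_sol (a *\<^sub>R ?P) t)"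
      by (simp only: norm_triangle_ineq4)
    then show ?thesis using ap ap' by linarith
  qed
  moreover have "norm (low N D) \<le> 4 * G"
    unfolding D_def low_diff using ap(2) ap'(2) by (intro order_trans[OF norm_triangle_ineq4]) linarith
  ultimately have "l2 D - 4 * G - 2 * G \<le> l2 (Z - low N Z)"
    by (rule l2_high_lower_bound)
  then have "N powr (- s) * (1/32) - 6 * G \<le> l2 ((c' t - c t) - low N (c' t - c t))"
    using l2D by (simp add: Z_def l2_high_shift)
  also have "(c' t - c t) - low N (c' t - c t) = - ((c t - c' t) - low N (c t - c' t))"
    by (simp add: low_diff)
  finally have "N powr (- s) * (1/32) - 6 * G \<le> l2 ((c t - c' t) - low N (c t - c' t))"
    by (simp only: l2_minus)
  then have "(real N / 2) powr s * (N powr (- s) * (1/32) - 6 * G) \<le> (real N / 2) powr s * l2 ((c t - c' t) - low N (c t - c' t))"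
    by (rule mult_left_mono) simp
  also have "\<dots> \<le> sobolev_norm s (ev (c t - c' t))"
    by (rule sobolev_norm_high[OF wle_diff[OF c(3)[of t "\<bar>t\<bar>" 1] c'(3)[of t "\<bar>t\<bar>" 1]]]) (use s N in auto)
  finally have main: "(real N / 2) powr s * (N powr (- s) * (1/32) - 6 * G) \<le> sobolev_norm s (ev (c t - c' t))" .
  have "(real N / 2) powr s * N powr (- s) = 1 / 2 powr s"
    using N by (simp add: powr_divide powr_minus field_simps)
  moreover have "1 / 2 \<le> 1 / 2 powr s"
    using powr_mono[of s 1 "2 :: real"] s by (intro frac_le) auto
  ultimately have 1: "1 / 2 * (1/32) \<le> (real N / 2) powr s * N powr (- s) * (1/32)"
    by simp
  have "(real N / 2) powr s \<le> real N"
  proof -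
    have "(real N / 2) powr s \<le> real N powr s"
      using s by (intro powr_mono2) auto
    also have "\<dots> \<le> real N powr 1"
      using s N by (intro powr_mono) auto
    finally show ?thesis using N by simp
  qed
  then have "(real N / 2) powr s * G \<le> 1/1000"
    using G mult_right_mono[of "(real N / 2) powr s" "real N" G] by linarith
  \<comment> \<open>The main term is at least 1/64 and the errors amount to at most 6/1000, which
    leaves more than 1/128.\<close>
  then show ?thesis
    using main 1 by (simp add: right_diff_distrib mult_ac)
qed

theorem theorem1:
  fixes s :: real
  assumes "1/4 < s" and "s < 1/2"
  shows "\<exists>(f :: nat \<Rightarrow> real \<Rightarrow> complex) (f' :: nat \<Rightarrow> real \<Rightarrow> complex)
            (u :: nat \<Rightarrow> real \<Rightarrow> real \<Rightarrow> complex) (u' :: nat \<Rightarrow> real \<Rightarrow> real \<Rightarrow> complex).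
      (\<forall>n. f n \<in> smooth_torus) \<and> (\<forall>n. f' n \<in> smooth_torus) \<and>
      (\<exists>C. \<forall>n. sobolev_norm s (f n) \<le> C) \<and> (\<exists>C. \<forall>n. sobolev_norm s (f' n) \<le> C) \<and>
      (\<lambda>n. sobolev_norm s (\<lambda>x. f n x - f' n x)) \<longlonglongrightarrow> 0 \<and>
      (\<forall>n. half_wave_solution (f n) (u n)) \<and> (\<forall>n. half_wave_solution (f' n) (u' n)) \<and>
      (\<forall>T>0. liminf (\<lambda>n. Linf_sobolev_norm T s (\<lambda>t x. u n t x - u' n t x)) > 0)"
proof -
  obtain n0 where n0: "\<And>N. n0 \<le> N \<Longrightarrow> 4096 \<le> ln (real N) \<and> N powr (2 * s) * ln N + 1 \<le> N \<and>
    (real N)\<^sup>2 * exp (6 * exp (2 * sqrt (ln N + 1)) - N / (2 * (N powr (2 * s) * ln N + 1))) \<le> 1/1000"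
    using eventually_parameters[OF assms] unfolding eventually_sequentially by blast
  \<comment> \<open>Starting at \<open>n0\<close> makes the estimates on the parameters valid for
    every index and not just eventually.\<close>
  define N where "N n = n + n0" for n
  define \<kappa> where "\<kappa> n = N n powr (2 * s) * ln (N n)" for n
  define K where "K n = nat \<lceil>\<kappa> n\<rceil>" for n
  define a where "a n = N n powr (- s) * sqrt (K n)" for n
  have lnN: "4096 \<le> ln (real (N n))" and \<kappa>N: "\<kappa> n + 1 \<le> N n"
    and exp_small: "(real (N n))\<^sup>2 * exp (6 * exp (2 * sqrt (ln (N n) + 1)) - N n / (2 * (\<kappa> n + 1))) \<le> 1/1000" for n
    using n0[of "N n"] by (auto simp: N_def \<kappa>_def)
  have Npos: "0 < N n" for n
    using lnN[of n] by (cases "N n = 0") auto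
  have N1: "1 \<le> real (N n)" for n using Npos[of n] by simp
  have lnN0: "0 < ln (real (N n))" for n
    using lnN[of n] by linarith
  have \<kappa>0: "0 < \<kappa> n" for n
    unfolding \<kappa>_def by (rule mult_pos_pos[OF _ lnN0]) (use Npos[of n] in simp)
  have K\<kappa>: "\<kappa> n \<le> K n" "K n \<le> \<kappa> n + 1" for n
    using \<kappa>0[of n] by (auto simp: K_def)
  have K0: "0 < K n" for n using \<kappa>0[of n] K\<kappa>(1)[of n] by (cases "K n = 0") auto
  have KN: "K n \<le> N n" for n using K\<kappa>(2)[of n] \<kappa>N[of n] by linarith
  have powr2: "N n powr (- s) * N n powr (- s) = 1 / N n powr (2 * s)" for n
    using Npos[of n] by (simp add: powr_minus divide_simps flip: powr_add)
  have a_sq: "(a n)\<^sup>2 = K n / N n powr (2 * s)" for n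
  proof -
    have "(a n)\<^sup>2 = (N n powr (- s) * N n powr (- s)) * (sqrt (K n) * sqrt (K n))"
      by (simp only: a_def power2_eq_square mult_ac)
    then show ?thesis
      by (simp only: powr2 real_sqrt_mult_self) simp
  qed
  have a0: "0 \<le> a n" for n by (simp add: a_def)
  have Np: "1 \<le> real (N n) powr (2 * s)" for n
    using N1[of n] assms by (intro ge_one_powr_ge_zero) auto
  have a_lower: "sqrt (ln (N n)) \<le> a n" for n
  proof (rule real_le_lsqrt)
    show "ln (N n) \<le> (a n)\<^sup>2"
      unfolding a_sq pos_le_divide_eq[OF less_le_trans[OF zero_less_one Np]]
      using K\<kappa>(1)[of n] by (simp add: \<kappa>_def mult.commute)
  qed (use a0 in auto)
  have a_upper: "a n \<le> sqrt (ln (N n) + 1)" for n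
  proof (rule real_le_rsqrt)
    have "real (K n) \<le> N n powr (2 * s) * ln (N n) + N n powr (2 * s)"
      using K\<kappa>(2)[of n] Np[of n] by (simp add: \<kappa>_def)
    then show "(a n)\<^sup>2 \<le> ln (N n) + 1"
      unfolding a_sq pos_divide_le_eq[OF less_le_trans[OF zero_less_one Np]] by (simp add: algebra_simps)
  qed
  have "64 \<le> sqrt (ln (N n))" for n
    by (rule real_le_rsqrt) (use lnN[of n] in simp)
  then have a64: "64 \<le> a n" for n
    using a_lower[of n] by (rule order_trans)
  have small: "(real (N n))\<^sup>2 * exp (6 * exp (2 * a n) - N n / (2 * K n)) \<le> 1/1000" for n
  proof -
    have "real (N n) / (2 * (\<kappa> n + 1)) \<le> N n / (2 * K n)"
      using K\<kappa>(2)[of n] K0[of n] by (intro divide_left_mono) auto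
    then have "exp (6 * exp (2 * a n) - N n / (2 * K n)) \<le> exp (6 * exp (2 * sqrt (ln (N n) + 1)) - N n / (2 * (\<kappa> n + 1)))"
      using a_upper[of n] by (simp add: diff_mono)
    then show ?thesis
      using exp_small[of n] by (meson mult_left_mono order_trans zero_le_power2)
  qed
  let ?P = "\<lambda>n. packet (N n) (K n)"
  define c0 c0' where "c0 n = a n *\<^sub>R ?P n" and "c0' n = (a n + 1) *\<^sub>R ?P n" for n
  have proj0: "proj (N n + K n) (c0 n) = c0 n" and proj0': "proj (N n + K n) (c0' n) = c0' n" for n
    by (simp_all add: c0_def c0'_def proj_scaleR proj_packet)
  obtain c B where c: "\<And>n. c n 0 = c0 n"
      "\<And>n t. (c n has_vector_derivative - (J * (absD (c n t) + cubic (c n t)))) (at t)"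
      "\<And>n m T t. \<bar>t\<bar> \<le> T \<Longrightarrow> wle (pw m) (c n t) (B n m T)"
    using global_solution[OF proj0] by metis
  obtain c' B' where c': "\<And>n. c' n 0 = c0' n"
      "\<And>n t. (c' n has_vector_derivative - (J * (absD (c' n t) + cubic (c' n t)))) (at t)"
      "\<And>n m T t. \<bar>t\<bar> \<le> T \<Longrightarrow> wle (pw m) (c' n t) (B' n m T)"
    using global_solution[OF proj0'] by metis
  have packet_bound: "sobolev_norm s (ev (?P n)) \<le> 5 / a n" for n
  proof -
    have "sobolev_norm s (ev (?P n)) \<le> 5 * (N n powr s / sqrt (K n))"
      using assms by (intro sobolev_norm_packet_le K0 KN) auto
    also have "N n powr s / sqrt (K n) = 1 / a n"
      using Npos[of n] by (simp add: a_def powr_minus field_simps)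
    finally show ?thesis by simp
  qed
  have norm_bound: "sobolev_norm s (ev (r *\<^sub>R ?P n)) \<le> 10" if "0 \<le> r" "r \<le> a n + 1" for r n
  proof -
    have "sobolev_norm s (ev (r *\<^sub>R ?P n)) \<le> (2 * a n) * (5 / a n)"
      unfolding sobolev_norm_scaleR using that a64[of n] by (intro mult_mono packet_bound) (auto simp: sobolev_norm_ev infsum_nonneg)
    then show ?thesis using a64[of n] by simp
  qed
  have N_top: "filterlim (\<lambda>n. real (N n)) at_top sequentially"
    unfolding N_def by (rule filterlim_compose[OF filterlim_real_sequentially]) (rule filterlim_add_const_nat_at_top)
  have "((\<lambda>x. 5 / sqrt (ln x)) \<longlongrightarrow> 0) at_top" "((\<lambda>x. 1 / sqrt (ln x)) \<longlongrightarrow> 0) at_top"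
    by real_asymp+
  from this[THEN filterlim_compose, OF N_top]
  have lim5: "(\<lambda>n. 5 / sqrt (ln (N n))) \<longlonglongrightarrow> 0" and lim1: "(\<lambda>n. 1 / sqrt (ln (N n))) \<longlonglongrightarrow> 0" by auto
  have ln_pos: "0 < sqrt (ln (N n))" for n using lnN0 by (rule real_sqrt_gt_zero)
  have diff0: "(\<lambda>n. sobolev_norm s (\<lambda>x. ev (c0 n) x - ev (c0' n) x)) \<longlonglongrightarrow> 0"
  proof (rule Lim_null_comparison[OF _ lim5], intro always_eventually allI)
    fix n
    \<comment> \<open>The amplitudes differ by exactly 1, so the difference is one unscaled packet,
      of H^s norm at most 5 / a.\<close>
    have "c0 n - c0' n = (-1) *\<^sub>R ?P n"
      by (simp add: c0_def c0'_def scaleR_add_left)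
    then have "sobolev_norm s (\<lambda>x. ev (c0 n) x - ev (c0' n) x) = sobolev_norm s (ev (?P n))"
      using sobolev_norm_scaleR[of s "-1" "?P n"] by (simp add: ev_diff[symmetric])
    also have "\<dots> \<le> 5 / sqrt (ln (N n))"
      by (rule order_trans[OF packet_bound frac_le[OF _ order_refl ln_pos a_lower]]) simp
    finally show "norm (sobolev_norm s (\<lambda>x. ev (c0 n) x - ev (c0' n) x)) \<le> 5 / sqrt (ln (N n))"
      by (simp add: sobolev_norm_def infsum_nonneg)
  qed
  \<comment> \<open>The separation interval ends at 1 / (4 (2 a + 1)), which is at most 1 / sqrt(ln
    N) and hence eventually below any given \<open>T\<close>. The lower bound 1/128 on it depends on
    neither \<open>T\<close> nor \<open>n\<close>.\<close>
  have lower: "0 < liminf (\<lambda>n. Linf_sobolev_norm T s (\<lambda>t x. ev (c n t) x - ev (c' n t) x))" if T: "0 < T" for T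
  proof -
    have "\<forall>\<^sub>F n in sequentially. 1 / sqrt (ln (N n)) < T"
      using lim1 T by (rule order_tendstoD)
    then have "\<forall>\<^sub>F n in sequentially. ereal (1/128) \<le> Linf_sobolev_norm T s (\<lambda>t x. ev (c n t) x - ev (c' n t) x)"
    proof eventually_elim
      case (elim n)
      show ?case
      proof (rule Linf_sobolev_norm_ge)
        show "0 \<le> 1 / (8 * (2 * a n + 1))" "1 / (8 * (2 * a n + 1)) < 1 / (4 * (2 * a n + 1))"
          using a64[of n] by (auto simp: field_simps)
        have "a n \<le> 4 * (2 * a n + 1)" using a0[of n] by simp
        then have "1 / (4 * (2 * a n + 1)) \<le> 1 / sqrt (ln (N n))"
          by (intro frac_le[OF _ order_refl ln_pos] order_trans[OF a_lower]) simp_all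
        then show "1 / (4 * (2 * a n + 1)) \<le> T" using elim by simp
        fix t assume t: "t \<in> {1 / (8 * (2 * a n + 1))..1 / (4 * (2 * a n + 1))}"
        have "1/128 \<le> sobolev_norm s (ev (c n t - c' n t))"
          by (rule decoherence[OF K0 Npos KN a64 a_def _ assms(2) small _ _ c(2) _ c(3) c'(2) _ c'(3)])
            (use t assms in \<open>auto simp: c c' c0_def c0'_def\<close>)
        then show "1/128 \<le> sobolev_norm s (\<lambda>x. ev (c n t) x - ev (c' n t) x)"
          by (simp add: ev_diff[abs_def])
      qed
    qed
    then have "ereal (1/128) \<le> liminf (\<lambda>n. Linf_sobolev_norm T s (\<lambda>t x. ev (c n t) x - ev (c' n t) x))"
      by (rule Liminf_bounded)
    then show ?thesis by (rule less_le_trans[rotated]) simp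
  qed
  show ?thesis
  proof (intro exI conjI allI impI)
    show "ev (c0 n) \<in> smooth_torus" "ev (c0' n) \<in> smooth_torus" for n
      by (rule smooth_torus_ev, rule proj0 proj0')+
    show "sobolev_norm s (ev (c0 n)) \<le> 10" "sobolev_norm s (ev (c0' n)) \<le> 10" for n
      using a0[of n] by (auto simp: c0_def c0'_def intro!: norm_bound)
    show "half_wave_solution (ev (c0 n)) (\<lambda>t. ev (c n t))" "half_wave_solution (ev (c0' n)) (\<lambda>t. ev (c' n t))" for n
      by (rule half_wave_solution_ev, rule c c', rule c c', erule c c')+
  qed (use diff0 lower in auto)
qed

end
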